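(* Let $n\geq 5$ and let $d\geq 0$ be an integer. If $$d<\min\left\{k\left\lfloor\frac{n-1}{k+2}\right\rfloor \;\middle|\; k=2,\ldots,d+1\right\},$$ then $\mathrm{SAut}(F_n)$ has property $\mathrm{F}\mathcal{A}_d$. In particular, if $n\geq 5$ and $d<2\left\lfloor\frac{n-1}{4}\right\rfloor-1$, then $\mathrm{SAut}(F_n)$ has property $\mathrm{F}\mathcal{A}_d$.
   Context: $F_n$ is the free group of rank $n$. The abelianization $F_n\to\mathbb{Z}^n$ induces an epimorphism $\mathrm{Aut}(F_n)\to\mathrm{GL}_n(\mathbb{Z})$, and $\mathrm{SAut}(F_n)$ is the preimage of $\mathrm{SL}_n(\mathbb{Z})$ under this map. $\mathcal{A}_d$ denotes the class of (non-empty) complete CAT(0) metric spaces of covering dimension $d$. A group $G$ has property $\mathrm{F}\mathcal{A}_d$ if for every $X\in\mathcal{A}_d$, every action of $G$ on $X$ by isometries (i.e. every homomorphism $G\to\mathrm{Isom}(X)$) has a global fixed point, i.e. a point of $X$ fixed by all elements of $G$. For $d=0$ the set over which the minimum is taken is empty, and the minimum is read as $+\infty$ (i.e. the condition means $d<k\lfloor (n-1)/(k+2)\rfloor$ for every integer $k$ with $2\le k\le d+1$). *)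

theory Defs
  imports
    "HOL-Analysis.Analysis"
    "HOL-Algebra.Bij"
    "HOL-Library.Extended_Nat"
    "Jordan_Normal_Form.Determinant"
begin

section \<open>The free group of rank n\<close>

text \<open>
  A letter is a pair of an index and a sign: \<open>(i, True)\<close> stands for the generator \<open>x\<^sub>i\<close> and
  \<open>(i, False)\<close> for its inverse; the generators of \<open>free_group n\<close> are indexed by \<open>0, \<dots>, n - 1\<close>.
  Elements are reduced words, multiplied by concatenation followed by free reduction.
\<close>

type_synonym letter = "nat \<times> bool"

definition inv_letter :: "letter \<Rightarrow> letter"
  where "inv_letter x = (fst x, \<not> snd x)"

definition reduced :: "letter list \<Rightarrow> bool"
  where "reduced = successively (\<lambda>x y. y \<noteq> inv_letter x)"

fun letter_mult :: "letter \<Rightarrow> letter list \<Rightarrow> letter list" where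
  "letter_mult x [] = [x]"
| "letter_mult x (y # w) = (if y = inv_letter x then w else x # y # w)"

definition word_mult :: "letter list \<Rightarrow> letter list \<Rightarrow> letter list"
  where "word_mult u v = foldr letter_mult u v"

definition free_group :: "nat \<Rightarrow> letter list monoid"
  where "free_group n =
    \<lparr>carrier = {w. reduced w \<and> fst ` set w \<subseteq> {..<n}}, mult = word_mult, one = []\<rparr>"

definition free_gen :: "nat \<Rightarrow> letter list"
  where "free_gen i = [(i, True)]"

subsection \<open>The free group is a group\<close>

lemma inv_letter_simps [simp]:
  "inv_letter (inv_letter x) = x" "inv_letter x \<noteq> x" "x \<noteq> inv_letter x"
  "fst (inv_letter x) = fst x" "snd (inv_letter x) = (\<not> snd x)"
  by (auto simp: inv_letter_def prod_eq_iff)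

lemma reduced_Nil [simp]: "reduced []"
  by (simp add: reduced_def)

lemma reduced_Cons:
  "reduced (x # w) \<longleftrightarrow> reduced w \<and> (w \<noteq> [] \<longrightarrow> hd w \<noteq> inv_letter x)"
  by (cases w) (auto simp: reduced_def)

lemma reduced_letter_mult: "reduced w \<Longrightarrow> reduced (letter_mult x w)"
  by (cases w) (auto simp: reduced_Cons)

lemma letter_mult_inv:
  "reduced w \<Longrightarrow> letter_mult x (letter_mult (inv_letter x) w) = w"
proof (cases w)
  case (Cons y v)
  then show "reduced w \<Longrightarrow> ?thesis"
    by (cases v) (auto simp: reduced_Cons)
qed auto

lemma reduced_word_mult: "reduced v \<Longrightarrow> reduced (word_mult u v)"
  by (induction u) (auto simp: word_mult_def reduced_letter_mult)

lemma set_letter_mult: "set (letter_mult x w) \<subseteq> insert x (set w)"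
  by (cases w) auto

lemma set_word_mult: "set (word_mult u v) \<subseteq> set u \<union> set v"
proof (induction u)
  case (Cons x u)
  then show ?case
    using set_letter_mult[of x "word_mult u v"] by (auto simp: word_mult_def)
qed (simp add: word_mult_def)

lemma word_mult_letter_mult:
  assumes "reduced w"
  shows "word_mult (letter_mult x v) w = letter_mult x (word_mult v w)"
proof (cases v)
  case (Cons y u)
  show ?thesis
  proof (cases "y = inv_letter x")
    case True
    have "letter_mult x (letter_mult (inv_letter x) (word_mult u w)) = word_mult u w"
      by (intro letter_mult_inv reduced_word_mult assms)
    then show ?thesis using Cons True by (simp add: word_mult_def)
  qed (simp add: Cons word_mult_def)
qed (simp add: word_mult_def)

lemma word_mult_assoc:
  assumes "reduced w"
  shows "word_mult (word_mult u v) w = word_mult u (word_mult v w)"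
proof (induction u)
  case (Cons x u)
  then show ?case
    using word_mult_letter_mult[OF assms, of x "word_mult u v"] by (simp add: word_mult_def)
qed (simp add: word_mult_def)

lemma word_mult_Nil: "reduced u \<Longrightarrow> word_mult u [] = u"
proof (induction u)
  case (Cons x u)
  then have "word_mult u [] = u" by (simp add: reduced_Cons)
  with Cons.prems show ?case by (cases u) (auto simp: word_mult_def reduced_Cons)
qed (simp add: word_mult_def)

lemma word_mult_inverse:
  assumes "reduced v"
  shows "word_mult (rev (map inv_letter u)) (word_mult u v) = v"
proof (induction u)
  case (Cons x u)
  have "letter_mult (inv_letter x) (letter_mult x (word_mult u v)) = word_mult u v"
    using letter_mult_inv[OF reduced_word_mult[OF assms], of "inv_letter x"] by simp
  then show ?case using Cons by (simp add: word_mult_def)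
qed (simp add: word_mult_def)

lemma group_free_group: "group (free_group n)"
proof (rule groupI)
  fix u assume u: "u \<in> carrier (free_group n)"
  define v where "v = word_mult (rev (map inv_letter u)) []"
  have "reduced v" "set v \<subseteq> inv_letter ` set u"
    using set_word_mult[of "rev (map inv_letter u)" "[]"]
    by (auto simp: v_def reduced_word_mult)
  then have "v \<in> carrier (free_group n)"
    using u by (fastforce simp: free_group_def)
  moreover have "word_mult v u = word_mult (rev (map inv_letter u)) (word_mult u [])"
    using u word_mult_assoc[of u "rev (map inv_letter u)" "[]"]
    by (simp add: v_def free_group_def word_mult_Nil) (simp add: word_mult_def)
  then have "word_mult v u = []"
    using word_mult_inverse[of "[]" u] by simp
  ultimately show "\<exists>v\<in>carrier (free_group n). v \<otimes>\<^bsub>free_group n\<^esub> u = \<one>\<^bsub>free_group n\<^esub>"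
    by (auto simp: free_group_def)
next
  fix u v assume "u \<in> carrier (free_group n)" "v \<in> carrier (free_group n)"
  then show "u \<otimes>\<^bsub>free_group n\<^esub> v \<in> carrier (free_group n)"
    using set_word_mult[of u v] by (fastforce simp: free_group_def reduced_word_mult)
next
  fix u v w
  assume "w \<in> carrier (free_group n)"
  then show "u \<otimes>\<^bsub>free_group n\<^esub> v \<otimes>\<^bsub>free_group n\<^esub> w
      = u \<otimes>\<^bsub>free_group n\<^esub> (v \<otimes>\<^bsub>free_group n\<^esub> w)"
    by (simp add: free_group_def word_mult_assoc)
qed (simp_all add: free_group_def word_mult_def)

subsection \<open>The universal property\<close>

lemma free_gen_carrier: "i < n \<Longrightarrow> free_gen i \<in> carrier (free_group n)"
  by (auto simp: free_group_def free_gen_def reduced_def)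

definition letter_val :: "('b, 'c) monoid_scheme \<Rightarrow> (nat \<Rightarrow> 'b) \<Rightarrow> letter \<Rightarrow> 'b"
  where "letter_val G f x = (if snd x then f (fst x) else inv\<^bsub>G\<^esub> f (fst x))"

definition word_val :: "('b, 'c) monoid_scheme \<Rightarrow> (nat \<Rightarrow> 'b) \<Rightarrow> letter list \<Rightarrow> 'b"
  where "word_val G f w = foldr (\<lambda>x a. letter_val G f x \<otimes>\<^bsub>G\<^esub> a) w \<one>\<^bsub>G\<^esub>"

lemma free_group_inv_gen:
  assumes "i < n"
  shows "[(i, False)] = inv\<^bsub>free_group n\<^esub> (free_gen i)"
proof -
  interpret F: group "free_group n" by (rule group_free_group)
  have "[(i, False)] \<otimes>\<^bsub>free_group n\<^esub> free_gen i = \<one>\<^bsub>free_group n\<^esub>"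
    by (simp add: free_group_def free_gen_def word_mult_def inv_letter_def)
  moreover have "[(i, False)] \<in> carrier (free_group n)"
    using assms by (auto simp: free_group_def reduced_def)
  ultimately show ?thesis
    using F.inv_equality free_gen_carrier[OF assms] by metis
qed

context
  fixes G :: "('b, 'c) monoid_scheme" (structure) and f :: "nat \<Rightarrow> 'b" and n :: nat
  assumes G: "group G" and f: "\<And>i. i < n \<Longrightarrow> f i \<in> carrier G"
begin

interpretation group G by (rule G)

lemma letter_val_closed: "fst x < n \<Longrightarrow> letter_val G f x \<in> carrier G"
  by (simp add: letter_val_def f)

lemma word_val_closed: "fst ` set w \<subseteq> {..<n} \<Longrightarrow> word_val G f w \<in> carrier G"
  by (induction w) (auto simp: word_val_def letter_val_closed)

lemma word_val_letter_mult:
  assumes "fst x < n" "fst ` set w \<subseteq> {..<n}"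
  shows "word_val G f (letter_mult x w) = letter_val G f x \<otimes> word_val G f w"
proof (cases w)
  case (Cons y v)
  have v: "word_val G f v \<in> carrier G"
    using assms Cons by (intro word_val_closed) auto
  show ?thesis
  proof (cases "y = inv_letter x")
    case True
    have "letter_val G f x \<otimes> (letter_val G f y \<otimes> word_val G f v)
      = (letter_val G f x \<otimes> letter_val G f y) \<otimes> word_val G f v"
      using v True assms by (simp add: m_assoc letter_val_closed)
    also have "letter_val G f x \<otimes> letter_val G f y = \<one>"
      using assms True f[of "fst x"] by (simp add: letter_val_def)
    finally show ?thesis using Cons True v by (simp add: word_val_def)
  qed (simp add: Cons word_val_def)
qed (simp add: word_val_def)

lemma word_val_word_mult:
  assumes "fst ` set u \<subseteq> {..<n}" "fst ` set v \<subseteq> {..<n}"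
  shows "word_val G f (word_mult u v) = word_val G f u \<otimes> word_val G f v"
  using assms(1)
proof (induction u)
  case Nil
  then show ?case
    using word_val_closed[OF assms(2)] by (simp add: word_mult_def word_val_def)
next
  case (Cons x u)
  have uv: "fst ` set (word_mult u v) \<subseteq> {..<n}"
    using Cons.prems assms(2) set_word_mult[of u v] by fastforce
  have "word_val G f (word_mult (x # u) v) = letter_val G f x \<otimes> word_val G f (word_mult u v)"
    using word_val_letter_mult[OF _ uv, of x] Cons.prems by (simp add: word_mult_def)
  also have "\<dots> = (letter_val G f x \<otimes> word_val G f u) \<otimes> word_val G f v"
    using Cons assms(2) by (simp add: m_assoc letter_val_closed word_val_closed)
  finally show ?case by (simp add: word_val_def)
qed

lemma word_val_hom: "word_val G f \<in> hom (free_group n) G"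
  by (rule homI) (auto simp: free_group_def intro!: word_val_closed word_val_word_mult)

lemma word_val_gen: "i < n \<Longrightarrow> word_val G f (free_gen i) = f i"
  by (simp add: word_val_def free_gen_def letter_val_def f)

lemma free_group_hom_unique:
  assumes h: "h \<in> hom (free_group n) G" and gen: "\<And>i. i < n \<Longrightarrow> h (free_gen i) = f i"
    and "w \<in> carrier (free_group n)"
  shows "h w = word_val G f w"
  using assms(3)
proof (induction w)
  interpret h: group_hom "free_group n" G h
    by (rule group_hom.intro[OF group_free_group G]) (simp add: group_hom_axioms_def h)
  {
    case Nil
    show ?case using h.hom_one by (simp add: free_group_def word_val_def)
  next
    case (Cons x w)
    then have x: "fst x < n" and w: "w \<in> carrier (free_group n)"
      by (auto simp: free_group_def reduced_Cons)
    have xw: "x # w = [x] \<otimes>\<^bsub>free_group n\<^esub> w"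
      using Cons.prems by (cases w) (auto simp: free_group_def word_mult_def reduced_Cons)
    have "h [x] = letter_val G f x"
    proof (cases "snd x")
      case True
      then have "[x] = free_gen (fst x)" by (simp add: free_gen_def prod_eq_iff)
      then show ?thesis using True gen[OF x] by (simp add: letter_val_def)
    next
      case False
      then have "[x] = inv\<^bsub>free_group n\<^esub> (free_gen (fst x))"
        using free_group_inv_gen[OF x] by (cases x) simp
      then show ?thesis
        using False gen[OF x] h.hom_inv[OF free_gen_carrier[OF x]] by (simp add: letter_val_def)
    qed
    moreover have "[x] \<in> carrier (free_group n)"
      using x by (simp add: free_group_def reduced_def)
    ultimately have "h (x # w) = letter_val G f x \<otimes> h w"
      using h.hom_mult[of "[x]" w] w xw by simp
    then show ?case using Cons.IH[OF w] by (simp add: word_val_def)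
  }
qed

end

section \<open>Abelianization and the special automorphism group\<close>

text \<open>
  The abelianization of \<open>free_group n\<close> is identified with the integer vectors of dimension \<open>n\<close>;
  it sends the \<open>i\<close>-th generator to the \<open>i\<close>-th unit vector, that is, it takes a word to its vector
  of exponent sums.
\<close>

definition exponent_sum :: "letter list \<Rightarrow> nat \<Rightarrow> int"
  where "exponent_sum w i = (\<Sum>x\<leftarrow>w. if fst x = i then (if snd x then 1 else -1) else 0)"

definition abelianization :: "nat \<Rightarrow> letter list \<Rightarrow> int vec"
  where "abelianization n w = Matrix.vec n (exponent_sum w)"

text \<open>
  The matrix of the endomorphism of the integer lattice induced by an endomorphism \<open>\<phi>\<close> of the free
  group; its \<open>j\<close>-th column is the image of the \<open>j\<close>-th unit vector.
\<close>

definition induced_mat :: "nat \<Rightarrow> (letter list \<Rightarrow> letter list) \<Rightarrow> int mat"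
  where "induced_mat n \<phi> = mat_of_cols n (map (\<lambda>j. abelianization n (\<phi> (free_gen j))) [0..<n])"

definition SL_int :: "nat \<Rightarrow> int mat set"
  where "SL_int n = {A \<in> carrier_mat n n. Determinant.det A = 1}"

definition SAut :: "nat \<Rightarrow> (letter list \<Rightarrow> letter list) monoid"
  where "SAut n = AutoGroup (free_group n)
    \<lparr>carrier := {\<phi> \<in> carrier (AutoGroup (free_group n)). induced_mat n \<phi> \<in> SL_int n}\<rparr>"

lemma exponent_sum_letter_mult:
  "exponent_sum (letter_mult x w) i = exponent_sum [x] i + exponent_sum w i"
  by (cases w) (auto simp: exponent_sum_def)

lemma exponent_sum_word_mult:
  "exponent_sum (word_mult u v) i = exponent_sum u i + exponent_sum v i"
proof (induction u)
  case (Cons x u)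
  then show ?case
    using exponent_sum_letter_mult[of x "word_mult u v" i]
    by (simp add: word_mult_def) (simp add: exponent_sum_def)
qed (simp add: word_mult_def exponent_sum_def)

lemma abelianization_mult:
  "abelianization n (u \<otimes>\<^bsub>free_group n\<^esub> v) = abelianization n u + abelianization n v"
  by (auto simp: abelianization_def free_group_def exponent_sum_word_mult)

lemma abelianization_gen: "i < n \<Longrightarrow> abelianization n (free_gen i) = unit_vec n i"
  by (intro eq_vecI) (simp_all add: abelianization_def free_gen_def exponent_sum_def)

lemma induced_mat_carrier: "induced_mat n \<phi> \<in> carrier_mat n n"
  unfolding induced_mat_def
  using mat_of_cols_carrier(1)[of n "map (\<lambda>j. abelianization n (\<phi> (free_gen j))) [0..<n]"] by simp

lemma abelianization_induced_mat:
  assumes \<phi>: "\<phi> \<in> hom (free_group n) (free_group n)" and "w \<in> carrier (free_group n)"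
  shows "abelianization n (\<phi> w) = induced_mat n \<phi> *\<^sub>v abelianization n w"
  using assms(2)
proof (induction w)
  let ?F = "free_group n" and ?A = "induced_mat n \<phi>"
  interpret F: group ?F by (rule group_free_group)
  interpret \<phi>: group_hom ?F ?F \<phi>
    by (rule group_hom.intro[OF group_free_group group_free_group])
       (simp add: group_hom_axioms_def \<phi>)
  note A = induced_mat_carrier[of n \<phi>]
  have ab: "abelianization n u \<in> carrier_vec n" for u
    by (simp add: abelianization_def)
  have one: "abelianization n \<one>\<^bsub>?F\<^esub> = 0\<^sub>v n"
    by (auto simp: abelianization_def free_group_def exponent_sum_def)
  have inv: "abelianization n (inv\<^bsub>?F\<^esub> u) = - abelianization n u" if u: "u \<in> carrier ?F" for u
  proof -
    have "abelianization n (inv\<^bsub>?F\<^esub> u) + abelianization n u = 0\<^sub>v n"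
      using abelianization_mult[of n "inv\<^bsub>?F\<^esub> u" u] u one by simp
    then have "(abelianization n (inv\<^bsub>?F\<^esub> u) + abelianization n u) $ i = 0" if "i < n" for i
      using that by simp
    then have "abelianization n (inv\<^bsub>?F\<^esub> u) $ i = - abelianization n u $ i" if "i < n" for i
      using that ab[of u] by (simp add: eq_neg_iff_add_eq_0)
    then show ?thesis
      using ab[of u] ab[of "inv\<^bsub>?F\<^esub> u"] by (intro eq_vecI) simp_all
  qed
  have zero: "?A *\<^sub>v 0\<^sub>v n = 0\<^sub>v n"
    using A by (intro eq_vecI) auto
  have gen: "abelianization n (\<phi> (free_gen i)) = ?A *\<^sub>v abelianization n (free_gen i)"
    if "i < n" for i
  proof -
    have "col ?A i = abelianization n (\<phi> (free_gen i))"
      using that by (simp add: induced_mat_def ab)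
    moreover have "?A *\<^sub>v unit_vec n i = col ?A i"
      using A that by (intro eq_vecI) auto
    ultimately show ?thesis using that by (simp add: abelianization_gen)
  qed
  {
    case Nil
    show ?case
      using \<phi>.hom_one one zero by (simp add: free_group_def)
  next
    case (Cons x w)
    then have x: "fst x < n" and w: "w \<in> carrier ?F"
      by (auto simp: free_group_def reduced_Cons)
    have xw: "x # w = [x] \<otimes>\<^bsub>?F\<^esub> w"
      using Cons.prems by (cases w) (auto simp: free_group_def word_mult_def reduced_Cons)
    have xF: "[x] \<in> carrier ?F"
      using x by (simp add: free_group_def reduced_def)
    have "abelianization n (\<phi> [x]) = ?A *\<^sub>v abelianization n [x]"
    proof (cases "snd x")
      case True
      then have "[x] = free_gen (fst x)" by (simp add: free_gen_def prod_eq_iff)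
      then show ?thesis using gen[OF x] by simp
    next
      case False
      then have "[x] = inv\<^bsub>?F\<^esub> (free_gen (fst x))"
        using free_group_inv_gen[OF x] by (cases x) simp
      moreover have "?A *\<^sub>v (- abelianization n (free_gen (fst x)))
          = - (?A *\<^sub>v abelianization n (free_gen (fst x)))"
        using A ab[of "free_gen (fst x)"] by (intro eq_vecI) auto
      ultimately show ?thesis
        using gen[OF x] free_gen_carrier[OF x] by (simp add: inv)
    qed
    then have "abelianization n (\<phi> [x] \<otimes>\<^bsub>?F\<^esub> \<phi> w)
        = ?A *\<^sub>v abelianization n [x] + ?A *\<^sub>v abelianization n w"
      using Cons.IH[OF w] by (simp only: abelianization_mult)
    also have "\<dots> = ?A *\<^sub>v abelianization n (x # w)"
      by (simp only: xw abelianization_mult mult_add_distrib_mat_vec[OF A ab ab])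
    also have "\<phi> [x] \<otimes>\<^bsub>?F\<^esub> \<phi> w = \<phi> (x # w)"
      using \<phi>.hom_mult[OF xF w] by (simp only: xw)
    finally show ?case .
  }
qed

lemma induced_mat_compose:
  assumes \<phi>: "\<phi> \<in> hom (free_group n) (free_group n)" and \<psi>: "\<psi> \<in> hom (free_group n) (free_group n)"
  shows "induced_mat n (compose (carrier (free_group n)) \<psi> \<phi>) = induced_mat n \<psi> * induced_mat n \<phi>"
proof (rule mat_col_eqI)
  fix j assume "j < dim_col (induced_mat n \<psi> * induced_mat n \<phi>)"
  then have j: "j < n"
    using induced_mat_carrier[of n \<phi>] by simp
  have col: "col (induced_mat n \<alpha>) j = abelianization n (\<alpha> (free_gen j))" for \<alpha>
    using j by (simp add: induced_mat_def abelianization_def)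
  have "\<phi> (free_gen j) \<in> carrier (free_group n)"
    using \<phi> free_gen_carrier[OF j] by (rule hom_in_carrier)
  then have "abelianization n (\<psi> (\<phi> (free_gen j)))
      = induced_mat n \<psi> *\<^sub>v abelianization n (\<phi> (free_gen j))"
    by (rule abelianization_induced_mat[OF \<psi>])
  then show "col (induced_mat n (compose (carrier (free_group n)) \<psi> \<phi>)) j
      = col (induced_mat n \<psi> * induced_mat n \<phi>) j"
    using free_gen_carrier[OF j] col_mult2[OF induced_mat_carrier[of n \<psi>] induced_mat_carrier[of n \<phi>] j]
    by (simp add: col compose_eq)
qed (use induced_mat_carrier in \<open>simp_all add: induced_mat_def\<close>)

lemma induced_mat_id: "induced_mat n (\<lambda>w\<in>carrier (free_group n). w) = 1\<^sub>m n"
proof (rule mat_col_eqI)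
  fix j assume "j < dim_col (1\<^sub>m n :: int mat)"
  then have "j < n" by simp
  then show "col (induced_mat n (\<lambda>w\<in>carrier (free_group n). w)) j = col (1\<^sub>m n) j"
    by (simp add: induced_mat_def free_gen_carrier abelianization_gen)
qed (simp_all add: induced_mat_def)

lemma group_SAut: "group (SAut n)"
proof -
  let ?F = "free_group n"
  interpret A: group "AutoGroup ?F"
    by (rule group.AutoGroup[OF group_free_group])
  have mult: "\<phi> \<otimes>\<^bsub>AutoGroup ?F\<^esub> \<psi> = compose (carrier ?F) \<phi> \<psi>"
    if "\<phi> \<in> carrier (AutoGroup ?F)" "\<psi> \<in> carrier (AutoGroup ?F)" for \<phi> \<psi>
    using that by (simp add: AutoGroup_def BijGroup_def auto_def)
  have one: "\<one>\<^bsub>AutoGroup ?F\<^esub> = (\<lambda>w\<in>carrier ?F. w)"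
    by (simp add: AutoGroup_def BijGroup_def)
  have hom: "\<phi> \<in> hom ?F ?F" if "\<phi> \<in> carrier (AutoGroup ?F)" for \<phi>
    using that by (simp add: AutoGroup_def auto_def)
  have det: "Determinant.det (induced_mat n (\<phi> \<otimes>\<^bsub>AutoGroup ?F\<^esub> \<psi>))
      = Determinant.det (induced_mat n \<phi>) * Determinant.det (induced_mat n \<psi>)"
    if "\<phi> \<in> carrier (AutoGroup ?F)" "\<psi> \<in> carrier (AutoGroup ?F)" for \<phi> \<psi>
    by (simp add: mult that induced_mat_compose hom
        Determinant.det_mult[OF induced_mat_carrier induced_mat_carrier])
  have det_one: "Determinant.det (induced_mat n \<one>\<^bsub>AutoGroup ?F\<^esub>) = 1"
    by (simp add: one induced_mat_id)
  have "subgroup {\<phi> \<in> carrier (AutoGroup ?F). induced_mat n \<phi> \<in> SL_int n} (AutoGroup ?F)"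
  proof (rule A.subgroupI)
    fix \<phi> assume "\<phi> \<in> {\<phi> \<in> carrier (AutoGroup ?F). induced_mat n \<phi> \<in> SL_int n}"
    then have \<phi>: "\<phi> \<in> carrier (AutoGroup ?F)" "Determinant.det (induced_mat n \<phi>) = 1"
      by (simp_all add: SL_int_def)
    then have "Determinant.det (induced_mat n (inv\<^bsub>AutoGroup ?F\<^esub> \<phi>)) = 1"
      using det[OF _ \<phi>(1), of "inv\<^bsub>AutoGroup ?F\<^esub> \<phi>"] det_one by simp
    then show "inv\<^bsub>AutoGroup ?F\<^esub> \<phi> \<in> {\<phi> \<in> carrier (AutoGroup ?F). induced_mat n \<phi> \<in> SL_int n}"
      using \<phi>(1) by (simp add: SL_int_def induced_mat_carrier)
  next
    have "\<one>\<^bsub>AutoGroup ?F\<^esub> \<in> {\<phi> \<in> carrier (AutoGroup ?F). induced_mat n \<phi> \<in> SL_int n}"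
      using det_one by (simp add: SL_int_def induced_mat_carrier)
    then show "{\<phi> \<in> carrier (AutoGroup ?F). induced_mat n \<phi> \<in> SL_int n} \<noteq> {}"
      by blast
  next
    fix \<phi> \<psi>
    assume "\<phi> \<in> {\<phi> \<in> carrier (AutoGroup ?F). induced_mat n \<phi> \<in> SL_int n}"
      and "\<psi> \<in> {\<phi> \<in> carrier (AutoGroup ?F). induced_mat n \<phi> \<in> SL_int n}"
    then show "\<phi> \<otimes>\<^bsub>AutoGroup ?F\<^esub> \<psi> \<in> {\<phi> \<in> carrier (AutoGroup ?F). induced_mat n \<phi> \<in> SL_int n}"
      by (simp add: SL_int_def induced_mat_carrier det)
  qed auto
  then show ?thesis
    unfolding SAut_def by (rule A.subgroup_imp_group)
qed

section \<open>Isometric actions on CAT(0) spaces\<close>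

definition isometry_group :: "'a metric \<Rightarrow> ('a \<Rightarrow> 'a) monoid"
  where "isometry_group X = BijGroup (mspace X)
    \<lparr>carrier := {f \<in> Bij (mspace X).
       \<forall>x\<in>mspace X. \<forall>y\<in>mspace X. mdist X (f x) (f y) = mdist X x y}\<rparr>"

definition geodesic_segment :: "'a metric \<Rightarrow> 'a \<Rightarrow> 'a \<Rightarrow> 'a set \<Rightarrow> bool"
  where "geodesic_segment X x y S \<longleftrightarrow>
    (\<exists>c. c \<in> {0..mdist X x y} \<rightarrow> mspace X \<and> c 0 = x \<and> c (mdist X x y) = y \<and>
         (\<forall>s\<in>{0..mdist X x y}. \<forall>t\<in>{0..mdist X x y}. mdist X (c s) (c t) = \<bar>s - t\<bar>) \<and>
         S = c ` {0..mdist X x y})"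

definition geodesic_space :: "'a metric \<Rightarrow> bool"
  where "geodesic_space X \<longleftrightarrow> (\<forall>x\<in>mspace X. \<forall>y\<in>mspace X. \<exists>S. geodesic_segment X x y S)"

text \<open>
  \<open>p'\<close> is the comparison point, on the side from \<open>x'\<close> to \<open>y'\<close> of a comparison triangle, of the
  point \<open>p\<close> of the side \<open>S\<close> from \<open>x\<close> to \<open>y\<close>.
\<close>

definition comparison_point ::
    "'a metric \<Rightarrow> 'a \<Rightarrow> 'a set \<Rightarrow> real ^ 2 \<Rightarrow> real ^ 2 \<Rightarrow> 'a \<Rightarrow> real ^ 2 \<Rightarrow> bool"
  where "comparison_point X x S x' y' p p' \<longleftrightarrow>
    p \<in> S \<and> p' \<in> closed_segment x' y' \<and> dist x' p' = mdist X x p"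

definition CAT0 :: "'a metric \<Rightarrow> bool"
  where "CAT0 X \<longleftrightarrow> geodesic_space X \<and>
    (\<forall>x\<in>mspace X. \<forall>y\<in>mspace X. \<forall>z\<in>mspace X. \<forall>S T U.
      geodesic_segment X x y S \<longrightarrow> geodesic_segment X y z T \<longrightarrow> geodesic_segment X z x U \<longrightarrow>
      (\<forall>x' y' z'. dist x' y' = mdist X x y \<longrightarrow> dist y' z' = mdist X y z \<longrightarrow>
                  dist z' x' = mdist X z x \<longrightarrow>
        (let cmp = (\<lambda>p p'. comparison_point X x S x' y' p p' \<or>
                           comparison_point X y T y' z' p p' \<or>
                           comparison_point X z U z' x' p p')
         in \<forall>p p' q q'. cmp p p' \<longrightarrow> cmp q q' \<longrightarrow> mdist X p q \<le> dist p' q')))"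

subsection \<open>Covering dimension\<close>

definition covering_dim_le :: "'a topology \<Rightarrow> nat \<Rightarrow> bool"
  where "covering_dim_le T d \<longleftrightarrow>
    (\<forall>\<U>. (\<forall>U\<in>\<U>. openin T U) \<and> \<Union>\<U> = topspace T \<longrightarrow>
      (\<exists>\<V>. (\<forall>V\<in>\<V>. openin T V) \<and> \<Union>\<V> = topspace T \<and>
           (\<forall>V\<in>\<V>. \<exists>U\<in>\<U>. V \<subseteq> U) \<and>
           (\<forall>x\<in>topspace T. finite {V \<in> \<V>. x \<in> V} \<and> card {V \<in> \<V>. x \<in> V} \<le> d + 1)))"

text \<open>The dimension of the empty space is \<open>-1\<close>, hence it is excluded here.\<close>

definition has_covering_dim :: "'a topology \<Rightarrow> nat \<Rightarrow> bool"
  where "has_covering_dim T d \<longleftrightarrow>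
    topspace T \<noteq> {} \<and> covering_dim_le T d \<and> (\<forall>m<d. \<not> covering_dim_le T m)"

subsection \<open>The fixed point property\<close>

definition complete_CAT0_spaces :: "nat \<Rightarrow> 'a metric set"
  where "complete_CAT0_spaces d =
    {X. mspace X \<noteq> {} \<and> mcomplete_of X \<and> CAT0 X \<and> has_covering_dim (mtopology_of X) d}"

definition fixed_point_property :: "'a metric set \<Rightarrow> ('g, 'b) monoid_scheme \<Rightarrow> bool"
  where "fixed_point_property \<A> G \<longleftrightarrow>
    (\<forall>X\<in>\<A>. \<forall>\<rho>\<in>hom G (isometry_group X).
      \<exists>x\<in>mspace X. \<forall>g\<in>carrier G. \<rho> g x = x)"

end

theory Submission
  imports Defs
begin

text \<open>
  Two facts drive the proof. First, a form of Helly's theorem: let \<open>m\<close> families of \<open>k + 1\<close> closed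
  convex sets in a complete CAT(0) space of dimension less than \<open>m k\<close> be given such that sets always
  have a common point if they omit at least one member of each family. Then some family has a common
  point. Otherwise, barycenters give a map from a product of \<open>m\<close> simplices of dimension \<open>k\<close> to the space
  sending the faces into the convex sets, and pulling back a cover of small order contradicts
  Brouwer's fixed point theorem. Applied to fixed point sets, this says that if \<open>m\<close> commuting
  conjugates of a set \<open>T\<close> of \<open>k + 1\<close> isometries are given and every proper subset of \<open>T\<close> has a fixed
  point, then so does \<open>T\<close>.

  Second, \<open>SAut n\<close> is generated by elements \<open>sigma 0, \<dots>, sigma (n - 1)\<close> of finite order, arranged along
  a line such that the elements before any gap normalize the group generated by those after it. A
  minimal set \<open>T\<close> of these generators without a fixed point therefore is an initial segment of the
  line, and not one generating a finite group. If \<open>T\<close> has \<open>k + 1\<close> elements, then \<open>k \<ge> 2\<close>, and up to an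
  inversion of the letter \<open>0\<close> the set \<open>T\<close> only involves \<open>k + 2\<close> of the remaining \<open>n - 1\<close> letters. So
  there are \<open>(n - 1) div (k + 2)\<close> commuting conjugates of \<open>T\<close>, and as the dimension is less than
  \<open>k ((n - 1) div (k + 2))\<close>, the set \<open>T\<close> has a fixed point after all.
\<close>

section \<open>Brouwer's theorem and face-preserving self-maps of products of simplices\<close>

section \<open>Products of simplices\<close>

text \<open>Inversions and transpositions of letters are natural generators but have determinant -1.
  The inversion \<open>e0\<close> of the letter 0 repairs this. It commutes with everything
  supported on the other letters, so corrected automorphisms with disjoint supports away from 0
  still commute; the price is one letter, hence \<open>n - 1\<close> in the bound. The number
  \<open>k + 2\<close> comes from the shape of a minimal set: the index 2 may occur without 1, since
  the generators 0 and 2 share letters, so \<open>k + 1\<close> indices can reach up to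
  \<open>k + 1\<close>, and generator \<open>j\<close> involves letters up to \<open>j + 1\<close>.
  The bound is only called for when \<open>k\<close> does not exceed the dimension; for larger
  \<open>k\<close> a single copy and the ordinary theorem of Helly suffice. Covering dimension
  enters through the refinement of one open cover, indexed by the vertices of the product of
  simplices: that product has dimension \<open>m * k\<close>, and a generic point of it is no affine
  combination of \<open>m * k\<close> vertices. Everything about convexity, barycenters and
  projections follows from one quadratic inequality for the distance.\<close>

lemma brouwer_cube_fun:
  fixes I :: "'i::countable set" and h :: "('i \<Rightarrow> real) \<Rightarrow> 'i \<Rightarrow> real"
  defines "K \<equiv> PiE UNIV (\<lambda>i. if i \<in> I then {0..1} else {0})"
  assumes "finite I" and cont: "continuous_on K h" and im: "h ` K \<subseteq> K"
  shows "\<exists>x\<in>K. h x = x"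
proof -
  define N where "N = card I"
  obtain e where e: "bij_betw e I {..<N}"
    using ex_bij_betw_finite_nat[OF \<open>finite I\<close>] by (auto simp: N_def atLeast0LessThan)
  define b where "b = inv_into I e"
  have b: "b j \<in> I" "e (b j) = j" if "j < N" for j
    using that e by (auto simp: b_def bij_betw_def inv_into_into f_inv_into_f)
  have eN: "e i < N" "b (e i) = i" if "i \<in> I" for i
    using that e by (auto simp: b_def bij_betw_def)
  have memK: "x \<in> K \<longleftrightarrow> (\<forall>i. (i \<in> I \<longrightarrow> 0 \<le> x i \<and> x i \<le> 1) \<and> (i \<notin> I \<longrightarrow> x i = 0))" for x
    by (auto simp: K_def PiE_iff)
  have "compactin (product_topology (\<lambda>i. euclidean) UNIV) K"
    unfolding K_def compactin_PiE by auto
  then have "compact K"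
    by (simp add: euclidean_product_topology compactin_euclidean_iff)
  then have seqK: "seq_compact K"
    by (rule compact_imp_seq_compact)
  \<comment> \<open>Grid points of mesh \<open>1 / Suc p\<close>; \<open>q\<close> gives the
    numerators along the enumeration \<open>e\<close> of \<open>I\<close>.\<close>
  define z :: "nat \<Rightarrow> (nat \<Rightarrow> nat) \<Rightarrow> 'i \<Rightarrow> real"
    where "z p q = (\<lambda>i. if i \<in> I then real (q (e i)) / real (Suc p) else 0)" for p q
  have zK: "z p q \<in> K" if "\<forall>j<N. q j \<le> Suc p" for p q
    using that eN by (auto simp: memK z_def simp flip: of_nat_Suc)
  \<comment> \<open>Label 0 implies that \<open>h\<close> does not decrease the coordinate, label 1
    that it does not increase it. The conditions at 0 and \<open>Suc p\<close> force the boundary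
    labels that Kuhn's lemma asks for.\<close>
  define lab where "lab p q j = (if q j \<noteq> 0 \<and> (q j = Suc p \<or> h (z p q) (b j) < z p q (b j)) then 1 else 0 :: nat)" for p q j
  define nr where "nr q r \<longleftrightarrow> (\<forall>j<N. q j \<le> r j \<and> r j \<le> q j + 1)" for q r :: "nat \<Rightarrow> nat"
  have lab01: "lab p r i = 0 \<or> lab p r i = 1" for p r i
    by (simp add: lab_def)
  have "\<exists>q. (\<forall>i<N. q i < Suc p) \<and> (\<forall>i<N. \<exists>r s. nr q r \<and> nr q s \<and> lab p r i \<noteq> lab p s i)" for p
  proof -
    have "\<forall>x. (\<forall>i<N. x i \<le> Suc p) \<longrightarrow> (\<forall>i<N. lab p x i = 0 \<or> lab p x i = 1)"
      "\<forall>x. (\<forall>i<N. x i \<le> Suc p) \<longrightarrow> (\<forall>i<N. x i = 0 \<longrightarrow> lab p x i = 0)"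
      "\<forall>x. (\<forall>i<N. x i \<le> Suc p) \<longrightarrow> (\<forall>i<N. x i = Suc p \<longrightarrow> lab p x i = 1)"
      by (auto simp: lab_def)
    from kuhn_lemma[OF zero_less_Suc this] obtain q where "\<forall>i<N. q i < Suc p"
      "\<forall>i<N. \<exists>r s. nr q r \<and> nr q s \<and> lab p r i \<noteq> lab p s i"
      unfolding nr_def .
    then show ?thesis by blast
  qed
  then have "\<forall>p. \<exists>q. (\<forall>i<N. q i < Suc p) \<and> (\<forall>i<N. \<exists>r s. nr q r \<and> nr q s \<and> lab p r i \<noteq> lab p s i)" ..
  from choice[OF this] obtain q where
    q': "\<And>p. (\<forall>i<N. q p i < Suc p) \<and> (\<forall>i<N. \<exists>r s. nr (q p) r \<and> nr (q p) s \<and> lab p r i \<noteq> lab p s i)"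
    by blast
  then have q: "\<And>p i. i < N \<Longrightarrow> q p i < Suc p" by blast
  have "\<exists>r s. i < N \<longrightarrow> nr (q p) r \<and> nr (q p) s \<and> lab p r i = 0 \<and> lab p s i = 1" for p i
    using q'[of p] lab01 by (cases "i < N") (simp, metis, simp)
  then have "\<forall>p i. \<exists>r s. i < N \<longrightarrow> nr (q p) r \<and> nr (q p) s \<and> lab p r i = 0 \<and> lab p s i = 1" by blast
  then obtain r s where rs: "\<forall>p i. i < N \<longrightarrow> nr (q p) (r p i) \<and> nr (q p) (s p i) \<and> lab p (r p i) i = 0 \<and> lab p (s p i) i = 1"
    unfolding choice_iff by blast
  have r: "\<And>p i j. i < N \<Longrightarrow> j < N \<Longrightarrow> q p j \<le> r p i j \<and> r p i j \<le> q p j + 1"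
    and s: "\<And>p i j. i < N \<Longrightarrow> j < N \<Longrightarrow> q p j \<le> s p i j \<and> s p i j \<le> q p j + 1"
    and rl: "\<And>p i. i < N \<Longrightarrow> lab p (r p i) i = 0" and sl: "\<And>p i. i < N \<Longrightarrow> lab p (s p i) i = 1"
    using rs by (auto simp: nr_def)
  have "z p (q p) \<in> K" for p
    using q by (intro zK) (auto intro: less_imp_le)
  then obtain x \<sigma> where x: "x \<in> K" and \<sigma>: "strict_mono \<sigma>"
    and lim: "(\<lambda>p. z (\<sigma> p) (q (\<sigma> p))) \<longlonglongrightarrow> x"
    using seq_compactE[OF seqK, of "\<lambda>p. z p (q p)"] by (auto simp: o_def)
  \<comment> \<open>All corners of a Kuhn cell lie within one grid step of \<open>q p\<close> in
    each coordinate, so they tend to the same \<open>x\<close>. In the limit the corners labelled 0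
    and those labelled 1 give the two inequalities between \<open>h x\<close> and
    \<open>x\<close>.\<close>
  have near: "(\<lambda>p. z (\<sigma> p) (t (\<sigma> p))) \<longlonglongrightarrow> x"
    if t: "\<And>p j. j < N \<Longrightarrow> q p j \<le> t p j \<and> t p j \<le> q p j + 1" for t
  proof -
    have *: "(\<lambda>p. z (\<sigma> p) (t (\<sigma> p)) i - z (\<sigma> p) (q (\<sigma> p)) i) \<longlonglongrightarrow> 0" for i
    proof (rule Lim_null_comparison)
      show "(\<lambda>p. 1 / real (Suc (\<sigma> p))) \<longlonglongrightarrow> 0"
        using LIMSEQ_subseq_LIMSEQ[OF lim_inverse_n' [THEN LIMSEQ_Suc] \<sigma>] by (simp add: o_def)
      show "\<forall>\<^sub>F p in sequentially. norm (z (\<sigma> p) (t (\<sigma> p)) i - z (\<sigma> p) (q (\<sigma> p)) i) \<le> 1 / real (Suc (\<sigma> p))"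
      proof (intro always_eventually allI)
        fix p
        show "norm (z (\<sigma> p) (t (\<sigma> p)) i - z (\<sigma> p) (q (\<sigma> p)) i) \<le> 1 / real (Suc (\<sigma> p))"
        proof (cases "i \<in> I")
          case True
          have "q (\<sigma> p) (e i) \<le> t (\<sigma> p) (e i)" "t (\<sigma> p) (e i) \<le> q (\<sigma> p) (e i) + 1"
            using t eN(1)[OF True] by auto
          then have "\<bar>real (t (\<sigma> p) (e i)) - real (q (\<sigma> p) (e i))\<bar> \<le> 1"
            by linarith
          then show ?thesis
            using True by (simp add: z_def divide_right_mono flip: diff_divide_distrib)
        qed (simp add: z_def)
      qed
    qed
    have "(\<lambda>p. z (\<sigma> p) (t (\<sigma> p)) i) \<longlonglongrightarrow> x i" for i
    proof -
      have "(\<lambda>p. z (\<sigma> p) (q (\<sigma> p)) i) \<longlonglongrightarrow> x i"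
        using continuous_on_tendsto_compose[OF continuous_on_product_coordinates lim] by auto
      from tendsto_add[OF *[of i] this] show ?thesis by simp
    qed
    then have "limitin (product_topology (\<lambda>i. euclidean) UNIV) (\<lambda>p. z (\<sigma> p) (t (\<sigma> p))) x sequentially"
      by (simp add: limitin_componentwise)
    then show ?thesis
      by (simp add: euclidean_product_topology)
  qed
  have hlim: "(\<lambda>p. h (z (\<sigma> p) (t (\<sigma> p))) i) \<longlonglongrightarrow> h x i"
    if t: "\<And>p j. j < N \<Longrightarrow> q p j \<le> t p j \<and> t p j \<le> q p j + 1" for t i
  proof -
    have "z (\<sigma> p) (t (\<sigma> p)) \<in> K" for p
      using t q by (intro zK) (metis Suc_eq_plus1 Suc_leI le_trans)
    then show ?thesis
      using continuous_on_tendsto_compose[OF continuous_on_product_then_coordinatewise[OF cont, of i] near[OF t] x]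
      by (auto intro: always_eventually)
  qed
  have coord: "(\<lambda>p. z (\<sigma> p) (t (\<sigma> p)) i) \<longlonglongrightarrow> x i"
    if t: "\<And>p j. j < N \<Longrightarrow> q p j \<le> t p j \<and> t p j \<le> q p j + 1" for t i
    using continuous_on_tendsto_compose[OF continuous_on_product_coordinates near[OF t]] by auto
  have hx: "h x \<in> K" using x im by auto
  have "h x i = x i" for i
  proof (cases "i \<in> I")
    case True
    note i = eN[OF True]
    show ?thesis
    proof (rule antisym)
      show "x i \<le> h x i"
      proof (rule tendsto_le[OF _ hlim coord])
        show "\<forall>\<^sub>F p in sequentially. z (\<sigma> p) (r (\<sigma> p) (e i)) i \<le> h (z (\<sigma> p) (r (\<sigma> p) (e i))) i"
        proof (intro always_eventually allI)
          fix p
          let ?r = "r (\<sigma> p) (e i)"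
          have "z (\<sigma> p) ?r \<in> K"
            using r[OF i(1)] q by (intro zK) (metis Suc_eq_plus1 Suc_leI le_trans)
          then have "h (z (\<sigma> p) ?r) \<in> K" using im by auto
          then have "0 \<le> h (z (\<sigma> p) ?r) i" using True by (simp add: memK)
          moreover have "lab (\<sigma> p) ?r (e i) = 0" using rl[OF i(1)] .
          ultimately show "z (\<sigma> p) ?r i \<le> h (z (\<sigma> p) ?r) i"
            using True i by (cases "?r (e i) = 0") (auto simp: lab_def z_def split: if_splits)
        qed
      qed (use r[OF i(1)] in auto)
      show "h x i \<le> x i"
      proof (rule tendsto_le[OF _ coord hlim])
        show "\<forall>\<^sub>F p in sequentially. h (z (\<sigma> p) (s (\<sigma> p) (e i))) i \<le> z (\<sigma> p) (s (\<sigma> p) (e i)) i"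
        proof (intro always_eventually allI)
          fix p
          let ?r = "s (\<sigma> p) (e i)"
          have "z (\<sigma> p) ?r \<in> K"
            using s[OF i(1)] q by (intro zK) (metis Suc_eq_plus1 Suc_leI le_trans)
          then have "h (z (\<sigma> p) ?r) \<in> K" using im by auto
          then have "h (z (\<sigma> p) ?r) i \<le> 1" using True by (simp add: memK)
          moreover have "lab (\<sigma> p) ?r (e i) = 1" using sl[OF i(1)] .
          ultimately show "h (z (\<sigma> p) ?r) i \<le> z (\<sigma> p) ?r i"
            using True i by (auto simp: lab_def z_def split: if_splits simp del: of_nat_Suc)
        qed
      qed (use s[OF i(1)] in auto)
    qed
  next
    case False
    then show ?thesis using x hx by (simp add: memK)
  qed
  then show ?thesis using x by blast
qed

text \<open>Barycentric coordinates: \<open>x (i, j)\<close> is the coordinate of the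
  \<open>i\<close>-th factor at its vertex \<open>j\<close>. The entries outside the index set are
  pinned to 0, so that the product sits inside the cube of \<open>brouwer_cube_fun\<close>.\<close>

definition simplex_prod :: "nat \<Rightarrow> nat \<Rightarrow> (nat \<times> nat \<Rightarrow> real) set"
  where "simplex_prod m k = {x. (\<forall>i<m. (\<forall>j\<le>k. 0 \<le> x (i, j)) \<and> (\<Sum>j\<le>k. x (i, j)) = 1) \<and>
    (\<forall>p. p \<notin> {..<m} \<times> {..k} \<longrightarrow> x p = 0)}"

lemma simplex_prodI:
  assumes "\<And>p. 0 \<le> x p" "\<And>i. i < m \<Longrightarrow> (\<Sum>j\<le>k. x (i, j)) = 1" "\<And>p. p \<notin> {..<m} \<times> {..k} \<Longrightarrow> x p = 0"
  shows "x \<in> simplex_prod m k"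
  unfolding simplex_prod_def using assms by blast

lemma simplex_prodD:
  assumes "x \<in> simplex_prod m k"
  shows "i < m \<Longrightarrow> (\<Sum>j\<le>k. x (i, j)) = 1" and "p \<notin> {..<m} \<times> {..k} \<Longrightarrow> x p = 0"
    and "0 \<le> x p" and "x p \<le> 1"
proof -
  show sum: "(\<Sum>j\<le>k. x (i, j)) = 1" if "i < m" for i
    using assms that unfolding simplex_prod_def by blast
  show zero: "x p = 0" if "p \<notin> {..<m} \<times> {..k}" for p
    using assms that unfolding simplex_prod_def by blast
  have nonneg: "0 \<le> x (i, j)" if "i < m" "j \<le> k" for i j
    using assms that unfolding simplex_prod_def by blast
  have "x (i, j) \<le> 1" if ij: "i < m" "j \<le> k" for i j
  proof -
    have "x (i, j) \<le> (\<Sum>j\<le>k. x (i, j))"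
      using nonneg ij by (intro member_le_sum) auto
    then show ?thesis using sum ij by simp
  qed
  then show "0 \<le> x p" "x p \<le> 1"
    using nonneg zero[of p] by (cases p; cases "p \<in> {..<m} \<times> {..k}"; simp)+
qed

lemma brouwer_simplex_prod:
  assumes cont: "continuous_on (simplex_prod m k) h"
    and im: "h ` simplex_prod m k \<subseteq> simplex_prod m k"
  shows "\<exists>x\<in>simplex_prod m k. h x = x"
proof -
  let ?P = "simplex_prod m k" and ?I = "{..<m} \<times> {..k}"
  define K :: "(nat \<times> nat \<Rightarrow> real) set" where "K = PiE UNIV (\<lambda>i. if i \<in> ?I then {0..1} else {0})"
  have memK: "x \<in> K \<longleftrightarrow> (\<forall>i. (i \<in> ?I \<longrightarrow> 0 \<le> x i \<and> x i \<le> 1) \<and> (i \<notin> ?I \<longrightarrow> x i = 0))" for x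
    unfolding K_def PiE_iff extensional_UNIV by (simp add: if_distrib)
  define S where "S x i = (\<Sum>j\<le>k. x (i, j))" for x :: "nat \<times> nat \<Rightarrow> real" and i
  \<comment> \<open>Retraction of the cube: in each factor a deficit of the coordinate sum is spread
    evenly over the \<open>k + 1\<close> coordinates, and an excess is divided out. The maxima keep
    the denominator away from 0.\<close>
  define r where "r x = (\<lambda>p. if p \<in> ?I then (x p + max 0 (1 - S x (fst p)) / (k + 1)) / max 1 (S x (fst p)) else 0)"
    for x :: "nat \<times> nat \<Rightarrow> real"
  have PK: "?P \<subseteq> K"
    using simplex_prodD by (auto simp: memK simp del: mem_Sigma_iff)
  have rK: "r x \<in> ?P" if "x \<in> K" for x
  proof -
    have "(\<Sum>j\<le>k. r x (i, j)) = 1" if i: "i < m" for i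
    proof -
      have "(\<Sum>j\<le>k. r x (i, j)) = (\<Sum>j\<le>k. (x (i, j) + max 0 (1 - S x i) / (k + 1)) / max 1 (S x i))"
        using i by (intro sum.cong) (auto simp: r_def)
      also have "\<dots> = (S x i + max 0 (1 - S x i)) / max 1 (S x i)"
        by (simp add: sum.distrib S_def flip: sum_divide_distrib)
      also have "\<dots> = 1" by (auto simp: max_def)
      finally show ?thesis .
    qed
    moreover have "0 \<le> r x p" for p
      using \<open>x \<in> K\<close> by (auto simp: r_def memK)
    ultimately show ?thesis by (intro simplex_prodI) (auto simp: r_def)
  qed
  have rid: "r x = x" if "x \<in> ?P" for x
  proof
    fix p show "r x p = x p"
      using simplex_prodD(1,2)[OF that] by (cases p) (simp add: r_def S_def)
  qed
  have "continuous_on K (\<lambda>x. x p)" for p :: "nat \<times> nat"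
    by (rule continuous_on_subset[OF continuous_on_product_coordinates]) simp
  then have "continuous_on K (\<lambda>x. r x p)" for p
    unfolding r_def S_def by (cases "p \<in> ?I") (auto intro!: continuous_intros)
  then have "continuous_on K r"
    by (rule continuous_on_coordinatewise_then_product)
  moreover have "continuous_on (r ` K) h"
    using rK by (intro continuous_on_subset[OF cont]) auto
  ultimately have "continuous_on K (h \<circ> r)"
    by (rule continuous_on_compose)
  moreover have "(h \<circ> r) ` K \<subseteq> K"
    using rK im PK by force
  ultimately obtain x where x: "x \<in> K" "h (r x) = x"
    using brouwer_cube_fun[of ?I "h \<circ> r"] by (auto simp: K_def)
  then have "x \<in> ?P" using rK im by force
  then show ?thesis using x rid by force
qed

text \<open>
  The auxiliary map is Nash's: a fixed point of it can only increase coordinates on which \<open>g\<close> falls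
  short of \<open>y\<close>, and since the coordinates of each factor sum to 1, none does.
\<close>

lemma face_preserving_hits_interior:
  assumes cont: "continuous_on (simplex_prod m k) g"
    and im: "g ` simplex_prod m k \<subseteq> simplex_prod m k"
    and face: "\<And>x i j. x \<in> simplex_prod m k \<Longrightarrow> i < m \<Longrightarrow> j \<le> k \<Longrightarrow> x (i, j) = 0 \<Longrightarrow> g x (i, j) = 0"
    and y: "y \<in> simplex_prod m k" and pos: "\<And>i j. i < m \<Longrightarrow> j \<le> k \<Longrightarrow> 0 < y (i, j)"
  shows "\<exists>x\<in>simplex_prod m k. g x = y"
proof -
  let ?P = "simplex_prod m k" and ?I = "{..<m} \<times> {..k}"
  define e where "e x p = max 0 (y p - g x p)" for x p
  define E where "E x i = (\<Sum>j\<le>k. e x (i, j))" for x i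
  have e0: "0 \<le> e x p" for x p by (simp add: e_def)
  have E0: "0 \<le> E x i" for x i unfolding E_def by (intro sum_nonneg e0)
  define h where "h x = (\<lambda>p. if p \<in> ?I then (x p + e x p) / (1 + E x (fst p)) else 0)" for x
  have "continuous_on ?P (\<lambda>x. x p)" for p :: "nat \<times> nat"
    by (rule continuous_on_subset[OF continuous_on_product_coordinates]) simp
  moreover have "continuous_on ?P (\<lambda>x. g x p)" for p
    using cont by (rule continuous_on_product_then_coordinatewise)
  moreover have "1 + E x i \<noteq> 0" for x i using E0[of x i] by linarith
  ultimately have "continuous_on ?P (\<lambda>x. h x p)" for p
    unfolding h_def E_def e_def by (cases "p \<in> ?I") (auto intro!: continuous_intros)
  then have "continuous_on ?P h"
    by (rule continuous_on_coordinatewise_then_product)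
  moreover have "h x \<in> ?P" if x: "x \<in> ?P" for x
  proof -
    have "(\<Sum>j\<le>k. h x (i, j)) = 1" if i: "i < m" for i
    proof -
      have "(\<Sum>j\<le>k. h x (i, j)) = (\<Sum>j\<le>k. (x (i, j) + e x (i, j)) / (1 + E x i))"
        using i by (intro sum.cong) (auto simp: h_def)
      also have "\<dots> = ((\<Sum>j\<le>k. x (i, j)) + E x i) / (1 + E x i)"
        by (simp add: sum.distrib E_def flip: sum_divide_distrib)
      also have "\<dots> = 1" using x i E0[of x i] by (simp add: simplex_prod_def)
      finally show ?thesis .
    qed
    moreover have "0 \<le> h x p" for p
      using simplex_prodD(3)[OF x, of p] e0[of x p] E0[of x "fst p"] unfolding h_def by simp
    ultimately show ?thesis by (intro simplex_prodI) (auto simp: h_def)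
  qed
  ultimately obtain x where x: "x \<in> ?P" "h x = x"
    using brouwer_simplex_prod by blast
  have gx: "g x \<in> ?P" using x im by auto
  have fixed: "x (i, j) * E x i = e x (i, j)" if "i < m" "j \<le> k" for i j
  proof -
    have "x (i, j) = (x (i, j) + e x (i, j)) / (1 + E x i)"
      using fun_cong[OF x(2), of "(i, j)"] that by (simp add: h_def)
    then show ?thesis using E0[of x i] by (simp add: field_simps)
  qed
  \<comment> \<open>At a zero coordinate of the fixed point \<open>g\<close> vanishes too, so the
    shortfall there would be \<open>y (i, j)\<close>, which is positive; the fixed point equation
    makes it 0.\<close>
  have xpos: "0 < x (i, j)" if ij: "i < m" "j \<le> k" for i j
  proof (rule ccontr)
    assume "\<not> 0 < x (i, j)"
    then have "x (i, j) = 0" using simplex_prodD(3)[OF x(1), of "(i, j)"] by linarith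
    then have "g x (i, j) = 0" "e x (i, j) = 0" using face x ij fixed[OF ij] by auto
    then show False using pos[OF ij] by (simp add: e_def)
  qed
  have "y (i, j) = g x (i, j)" if ij: "i < m" "j \<le> k" for i j
  proof -
    have s: "(\<Sum>j\<le>k. g x (i, j)) = 1" "(\<Sum>j\<le>k. y (i, j)) = 1"
      using gx y ij by (auto simp: simplex_prod_def)
    have "E x i = 0"
    proof (rule ccontr)
      assume "E x i \<noteq> 0"
      then have "0 < E x i" using E0[of x i] by linarith
      then have "0 < e x (i, j)" if "j \<le> k" for j
        using fixed[OF ij(1) that] xpos[OF ij(1) that] by (metis mult_pos_pos)
      then have "g x (i, j) < y (i, j)" if "j \<le> k" for j
        using that by (fastforce simp: e_def)
      then have "(\<Sum>j\<le>k. g x (i, j)) < (\<Sum>j\<le>k. y (i, j))"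
        by (intro sum_strict_mono) auto
      then show False using s by simp
    qed
    then have "e x (i, j) = 0" if "j \<le> k" for j
      using fixed[OF ij(1) that] by simp
    then have le: "y (i, j) \<le> g x (i, j)" if "j \<le> k" for j
      using that unfolding e_def by (metis diff_ge_0_iff_ge diff_le_0_iff_le max.cobounded2)
    have "(\<Sum>j\<le>k. g x (i, j) - y (i, j)) = 0"
      using s by (simp add: sum_subtractf)
    then have "g x (i, j) - y (i, j) = 0"
      using le ij by (subst (asm) sum_nonneg_eq_0_iff) auto
    then show ?thesis by simp
  qed
  then have "g x p = y p" for p
    using simplex_prodD(2)[OF gx, of p] simplex_prodD(2)[OF y, of p] by (cases p) fastforce
  then have "g x = y" ..
  then show ?thesis using x by blast
qed

text \<open>There are \<open>N + 1\<close> unknowns and at most \<open>N\<close> equations. The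
  induction is Gaussian elimination: an equation \<open>t0\<close> in which the last unknown occurs
  is used to remove it from the others.\<close>

lemma underdetermined_system:
  fixes v :: "'t \<Rightarrow> nat \<Rightarrow> real"
  assumes "finite B" "card B \<le> N"
  shows "\<exists>a. (\<exists>e\<le>N. a e \<noteq> 0) \<and> (\<forall>t\<in>B. (\<Sum>e\<le>N. a e * v t e) = 0)"
  using assms
proof (induction N arbitrary: B v)
  case 0
  then show ?case by (intro exI[of _ "\<lambda>_. 1"]) auto
next
  case (Suc N)
  show ?case
  proof (cases "\<forall>t\<in>B. v t (Suc N) = 0")
    case True
    then show ?thesis
      by (intro exI[of _ "\<lambda>e. if e = Suc N then 1 else 0"]) auto
  next
    case False
    then obtain t0 where t0: "t0 \<in> B" "v t0 (Suc N) \<noteq> 0" by blast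
    define c where "c = v t0 (Suc N)"
    define v' where "v' t e = v t e - v t (Suc N) / c * v t0 e" for t e
    have "card (B - {t0}) \<le> N" using t0 Suc.prems by simp
    then obtain a where a: "\<exists>e\<le>N. a e \<noteq> 0" "\<forall>t\<in>B - {t0}. (\<Sum>e\<le>N. a e * v' t e) = 0"
      using Suc.IH[of "B - {t0}" v'] Suc.prems by blast
    define s where "s = (\<Sum>e\<le>N. a e * v t0 e)"
    define a' where "a' = a(Suc N := - s / c)"
    have sum: "sum (\<lambda>e. a' e * v t e) {..Suc N} = (\<Sum>e\<le>N. a e * v t e) - s / c * v t (Suc N)" for t
    proof -
      have "(\<Sum>e\<le>N. a' e * v t e) = (\<Sum>e\<le>N. a e * v t e)"
        by (intro sum.cong) (auto simp: a'_def)
      then show ?thesis by (simp add: a'_def)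
    qed
    have "sum (\<lambda>e. a' e * v t e) {..Suc N} = 0" if t: "t \<in> B" for t
    proof (cases "t = t0")
      case True
      then show ?thesis using t0 unfolding sum by (simp add: s_def c_def)
    next
      case False
      then have "(\<Sum>e\<le>N. a e * v' t e) = 0" using a t by blast
      moreover have "(\<Sum>e\<le>N. a e * v' t e) = (\<Sum>e\<le>N. a e * v t e) - s * (v t (Suc N) / c)"
        by (simp add: v'_def s_def algebra_simps sum_subtractf sum_distrib_left)
      ultimately show ?thesis unfolding sum by simp
    qed
    moreover have "\<exists>e\<le>Suc N. a' e \<noteq> 0"
      using a(1) unfolding a'_def by (metis Suc_n_not_le_n fun_upd_apply le_SucI)
    ultimately show ?thesis by blast
  qed
qed

text \<open>
  The witness has free coordinates on a moment curve: an affine relation satisfied by few vertices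
  is a polynomial equation for the parameter \<open>\<tau>\<close>.
\<close>

lemma generic_interior_point:
  fixes m k :: nat
  assumes k: "k \<ge> 1"
  defines "V \<equiv> PiE {..<m} (\<lambda>_. {..k})"
  shows "\<exists>y\<in>simplex_prod m k. (\<forall>i<m. \<forall>j\<le>k. 0 < y (i, j)) \<and>
    (\<forall>B\<subseteq>V. \<forall>w :: (nat \<Rightarrow> nat) \<Rightarrow> real. card B \<le> m * k \<longrightarrow> (\<Sum>t\<in>B. w t) = 1 \<longrightarrow>
      (\<exists>i<m. \<exists>j\<le>k. y (i, j) \<noteq> (\<Sum>t\<in>B. w t * of_bool (t i = j))))"
proof -
  define N where "N = m * k"
  have "finite V" by (simp add: V_def finite_PiE)
  \<comment> \<open>The vertex \<open>t\<close> in free coordinates: entry 0 is the constant 1,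
    recording that weights sum to 1, and entry \<open>i * k + j\<close> with \<open>j\<close> from 1
    to \<open>k\<close> is the coordinate \<open>(i, j)\<close>. The coordinates with
    \<open>j = 0\<close> are determined by the others.\<close>
  define v :: "(nat \<Rightarrow> nat) \<Rightarrow> nat \<Rightarrow> real"
    where "v t e = (if e = 0 then 1 else of_bool (t ((e - 1) div k) = (e - 1) mod k + 1))" for t e
  have "\<exists>a. B \<subseteq> V \<and> card B \<le> N \<longrightarrow> (\<exists>e\<le>N. a e \<noteq> 0) \<and> (\<forall>t\<in>B. (\<Sum>e\<le>N. a e * v t e) = 0)" for B
    using underdetermined_system[of B N v] finite_subset[OF _ \<open>finite V\<close>] by blast
  then have "\<forall>B. \<exists>a. B \<subseteq> V \<and> card B \<le> N \<longrightarrow> (\<exists>e\<le>N. a e \<noteq> 0) \<and> (\<forall>t\<in>B. (\<Sum>e\<le>N. a e * v t e) = 0)" ..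
  from choice[OF this] obtain a where a: "\<And>B. B \<subseteq> V \<Longrightarrow> card B \<le> N \<Longrightarrow> (\<exists>e\<le>N. a B e \<noteq> 0)"
    "\<And>B t. B \<subseteq> V \<Longrightarrow> card B \<le> N \<Longrightarrow> t \<in> B \<Longrightarrow> (\<Sum>e\<le>N. a B e * v t e) = 0"
    by blast
  define p where "p B = (\<Sum>e\<le>N. monom (a B e) e)" for B
  have coeff_p: "coeff (p B) e = (if e \<le> N then a B e else 0)" for B e
    by (simp add: p_def coeff_sum)
  have "p B \<noteq> 0" if "B \<subseteq> V" "card B \<le> N" for B
    using a(1)[OF that] by (metis coeff_p coeff_0)
  then have "finite (\<Union>B\<in>{B. B \<subseteq> V \<and> card B \<le> N}. {x. poly (p B) x = 0})"
    using \<open>finite V\<close> poly_roots_finite by auto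
  \<comment> \<open>Below \<open>1 / (k + 1)\<close> the \<open>k\<close> powers of
    \<open>\<tau>\<close> in one factor sum to less than 1, which leaves a positive coordinate at
    \<open>j = 0\<close>.\<close>
  moreover have "infinite {0<..<1 / real (k + 1)}" by (simp add: infinite_Ioo)
  ultimately have "{0<..<1 / real (k + 1)} - (\<Union>B\<in>{B. B \<subseteq> V \<and> card B \<le> N}. {x. poly (p B) x = 0}) \<noteq> {}"
    by (rule infinite_imp_nonempty[OF Diff_infinite_finite])
  then obtain \<tau> where "\<tau> \<in> {0<..<1 / real (k + 1)}"
    "\<tau> \<notin> (\<Union>B\<in>{B. B \<subseteq> V \<and> card B \<le> N}. {x. poly (p B) x = 0})"
    by blast
  then have \<tau>: "0 < \<tau>" "\<tau> < 1 / real (k + 1)"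
    and root: "\<And>B. B \<subseteq> V \<Longrightarrow> card B \<le> N \<Longrightarrow> poly (p B) \<tau> \<noteq> 0"
    by simp_all
  have \<tau>1: "\<tau> * real (k + 1) < 1" using \<tau> by (simp add: field_simps)
  define y where "y = (\<lambda>(i, j). if i < m \<and> j \<le> k then
    (if j = 0 then 1 - (\<Sum>l=1..k. \<tau> ^ (i * k + l)) else \<tau> ^ (i * k + j)) else 0)"
  have "\<tau> * 1 \<le> \<tau> * real (k + 1)" using \<tau> by (intro mult_left_mono) auto
  then have "\<tau> \<le> 1" using \<tau>1 by linarith
  have "(\<Sum>l=1..k. \<tau> ^ (i * k + l)) \<le> (\<Sum>l=1..k. \<tau>)" for i
  proof (intro sum_mono)
    fix l assume "l \<in> {1..k}"
    then show "\<tau> ^ (i * k + l) \<le> \<tau>"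
      using power_decreasing[of 1 "i * k + l" \<tau>] \<tau> \<open>\<tau> \<le> 1\<close> by simp
  qed
  moreover have "(\<Sum>l=1..k. \<tau>) < 1" using \<tau>1 \<tau> by (simp add: algebra_simps)
  ultimately have lt1: "(\<Sum>l=1..k. \<tau> ^ (i * k + l)) < 1" for i
    by (meson le_less_trans)
  have pos: "0 < y (i, j)" if "i < m" "j \<le> k" for i j
    using that lt1[of i] \<tau> by (simp add: y_def)
  have "(\<Sum>j\<le>k. y (i, j)) = 1" if "i < m" for i
  proof -
    have "{..k} = insert 0 {1..k}" by auto
    moreover have "(\<Sum>j=1..k. y (i, j)) = (\<Sum>l=1..k. \<tau> ^ (i * k + l))"
      using that by (intro sum.cong) (auto simp: y_def)
    ultimately show ?thesis using that by (simp add: y_def)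
  qed
  then have "y \<in> simplex_prod m k"
    using pos by (intro simplex_prodI) (auto simp: y_def less_imp_le split: prod.splits)
  moreover have "\<exists>i<m. \<exists>j\<le>k. y (i, j) \<noteq> (\<Sum>t\<in>B. w t * of_bool (t i = j))"
    if B: "B \<subseteq> V" "card B \<le> m * k" and w: "(\<Sum>t\<in>B. w t) = 1" for B and w :: "(nat \<Rightarrow> nat) \<Rightarrow> real"
  proof (rule ccontr)
    assume "\<not> ?thesis"
    then have eq: "y (i, j) = (\<Sum>t\<in>B. w t * of_bool (t i = j))" if "i < m" "j \<le> k" for i j
      using that by blast
    \<comment> \<open>An affine relation between \<open>y\<close> and the vertices in
      \<open>B\<close>, tested against the coefficients \<open>a B\<close>, would make
      \<open>\<tau>\<close> a root of \<open>p B\<close>.\<close>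
    have pow: "(\<Sum>t\<in>B. w t * v t e) = \<tau> ^ e" if e: "e \<le> N" for e
    proof (cases "e = 0")
      case True
      then show ?thesis using w by (simp add: v_def)
    next
      case False
      define i j where "i = (e - 1) div k" and "j = (e - 1) mod k + 1"
      have "e - 1 < m * k" using e False by (simp add: N_def)
      then have ij: "i < m" "j \<le> k" "j \<noteq> 0"
        using k by (auto simp: i_def j_def less_mult_imp_div_less Suc_leI)
      have "i * k + j = e" using False by (simp add: i_def j_def)
      then have "y (i, j) = \<tau> ^ e" using ij by (simp add: y_def)
      then show ?thesis using eq[OF ij(1,2)] False by (simp add: v_def i_def j_def)
    qed
    have "poly (p B) \<tau> = (\<Sum>e\<le>N. a B e * \<tau> ^ e)"
      by (simp add: p_def poly_sum poly_monom)
    also have "\<dots> = (\<Sum>e\<le>N. a B e * (\<Sum>t\<in>B. w t * v t e))"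
      by (intro sum.cong) (auto simp: pow)
    also have "\<dots> = (\<Sum>e\<le>N. \<Sum>t\<in>B. w t * (a B e * v t e))"
      by (simp add: sum_distrib_left algebra_simps)
    also have "\<dots> = (\<Sum>t\<in>B. w t * (\<Sum>e\<le>N. a B e * v t e))"
      by (subst sum.swap) (simp add: sum_distrib_left)
    also have "\<dots> = 0" using a(2) B by (intro sum.neutral) (auto simp: N_def)
    finally show False using root B by (simp add: N_def)
  qed
  ultimately show ?thesis using pos by blast
qed

text \<open>The weights define a self-map that sends \<open>x\<close> to the mean of the vertices
  \<open>t\<close> with weights \<open>w t x\<close>. It preserves faces, so it hits the generic
  interior point \<open>y\<close>; but \<open>y\<close> is no affine combination of
  \<open>m * k\<close> or fewer vertices.\<close>

lemma no_face_avoiding_partition: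
  fixes w :: "(nat \<Rightarrow> nat) \<Rightarrow> (nat \<times> nat \<Rightarrow> real) \<Rightarrow> real" and m k :: nat
  assumes k: "k \<ge> 1"
  defines "V \<equiv> PiE {..<m} (\<lambda>_. {..k})"
  assumes cont: "\<And>t. t \<in> V \<Longrightarrow> continuous_on (simplex_prod m k) (w t)"
    and nonneg: "\<And>t x. t \<in> V \<Longrightarrow> x \<in> simplex_prod m k \<Longrightarrow> 0 \<le> w t x"
    and one: "\<And>x. x \<in> simplex_prod m k \<Longrightarrow> (\<Sum>t\<in>V. w t x) = 1"
    and face: "\<And>t x i. t \<in> V \<Longrightarrow> x \<in> simplex_prod m k \<Longrightarrow> i < m \<Longrightarrow> x (i, t i) = 0 \<Longrightarrow> w t x = 0"
    and card: "\<And>x. x \<in> simplex_prod m k \<Longrightarrow> card {t \<in> V. w t x \<noteq> 0} \<le> m * k"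
  shows False
proof -
  let ?P = "simplex_prod m k" and ?I = "{..<m} \<times> {..k}"
  have "finite V" by (simp add: V_def finite_PiE)
  define g where "g x = (\<lambda>p. if p \<in> ?I then \<Sum>t\<in>V. w t x * of_bool (t (fst p) = snd p) else 0)" for x
  have "continuous_on ?P (\<lambda>x. g x p)" for p
    unfolding g_def using cont by (cases "p \<in> ?I") (auto intro!: continuous_intros)
  then have "continuous_on ?P g"
    by (rule continuous_on_coordinatewise_then_product)
  moreover have "g x \<in> ?P" if x: "x \<in> ?P" for x
  proof -
    have "(\<Sum>j\<le>k. g x (i, j)) = 1" if i: "i < m" for i
    proof -
      have "(\<Sum>j\<le>k. g x (i, j)) = (\<Sum>j\<le>k. \<Sum>t\<in>V. w t x * of_bool (t i = j))"
        using i by (intro sum.cong) (auto simp: g_def)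
      also have "\<dots> = (\<Sum>t\<in>V. \<Sum>j\<le>k. w t x * of_bool (t i = j))"
        by (rule sum.swap)
      also have "\<dots> = (\<Sum>t\<in>V. w t x)"
      proof (intro sum.cong refl)
        fix t assume "t \<in> V"
        then have "t i \<in> {..k}" using i by (auto simp: V_def PiE_iff)
        then show "(\<Sum>j\<le>k. w t x * of_bool (t i = j)) = w t x"
          by (simp add: of_bool_def if_distrib cong: if_cong)
      qed
      finally show ?thesis using one[OF x] by simp
    qed
    moreover have "0 \<le> g x p" for p
      using nonneg x by (auto simp: g_def intro!: sum_nonneg)
    ultimately show ?thesis by (intro simplex_prodI) (auto simp: g_def)
  qed
  moreover have "g x (i, j) = 0" if "x \<in> ?P" "i < m" "j \<le> k" "x (i, j) = 0" for x i j
    using that face by (auto simp: g_def intro!: sum.neutral)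
  moreover obtain y where y: "y \<in> ?P" "\<forall>i<m. \<forall>j\<le>k. 0 < y (i, j)"
    "\<And>B (u :: (nat \<Rightarrow> nat) \<Rightarrow> real). B\<subseteq>V \<Longrightarrow> card B \<le> m * k \<Longrightarrow> (\<Sum>t\<in>B. u t) = 1 \<Longrightarrow>
      (\<exists>i<m. \<exists>j\<le>k. y (i, j) \<noteq> (\<Sum>t\<in>B. u t * of_bool (t i = j)))"
    using generic_interior_point[OF k, of m] unfolding V_def by auto
  ultimately obtain x where x: "x \<in> ?P" "g x = y"
    using face_preserving_hits_interior[of m k g y] by blast
  let ?B = "{t \<in> V. w t x \<noteq> 0}"
  have "(\<Sum>t\<in>?B. w t x) = 1"
    using one[OF x(1)] \<open>finite V\<close> by (subst sum.mono_neutral_left[of V]) auto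
  then obtain i j where ij: "i < m" "j \<le> k" "y (i, j) \<noteq> (\<Sum>t\<in>?B. w t x * of_bool (t i = j))"
    using y(3)[of ?B "\<lambda>t. w t x"] card[OF x(1)] by auto
  moreover have "(\<Sum>t\<in>?B. w t x * of_bool (t i = j)) = (\<Sum>t\<in>V. w t x * of_bool (t i = j))"
    using \<open>finite V\<close> by (intro sum.mono_neutral_left) auto
  moreover have "y (i, j) = (\<Sum>t\<in>V. w t x * of_bool (t i = j))"
    using x(2) ij by (auto simp: g_def)
  ultimately show False by simp
qed

section \<open>From comparison triangles to a quadratic inequality for distances\<close>

section \<open>Complete CAT(0) spaces\<close>

lemma dist_vec2: "dist x y = sqrt ((x $ 1 - y $ 1)\<^sup>2 + (x $ 2 - y $ 2)\<^sup>2)" for x y :: "real ^ 2"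
  by (simp add: dist_vec_def L2_set_def UNIV_2 dist_real_def)

lemma comparison_triangle_exists:
  fixes a b c :: real
  assumes "0 \<le> a" "0 \<le> b" "0 \<le> c" "a \<le> b + c" "b \<le> c + a" "c \<le> a + b"
  shows "\<exists>x y z :: real ^ 2. dist x y = a \<and> dist y z = b \<and> dist z x = c"
proof (cases "a = 0")
  case True
  then have "b = c" using assms by linarith
  moreover have "dist (vector [0, 0]) (vector [c, 0] :: real ^ 2) = c"
    using assms by (simp add: dist_vec2)
  ultimately show ?thesis
    using True by (metis dist_commute dist_self)
next
  case False
  then have a: "0 < a" using assms by linarith
  \<comment> \<open>The law of cosines: with the side of length \<open>a\<close> on the first axis
    starting at the origin, this is the first coordinate of the third vertex.\<close>
  define u where "u = (c\<^sup>2 + a\<^sup>2 - b\<^sup>2) / (2 * a)"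
  have ua: "2 * a * u = c\<^sup>2 + a\<^sup>2 - b\<^sup>2" using a by (simp add: u_def)
  have "(c - a)\<^sup>2 \<le> b\<^sup>2" using assms by (intro abs_le_square_iff[THEN iffD1]) linarith
  moreover have "b\<^sup>2 \<le> (c + a)\<^sup>2" using assms by (intro power_mono) auto
  ultimately have "2 * a * u \<le> 2 * a * c" "2 * a * (- c) \<le> 2 * a * u"
    unfolding ua by (simp_all add: power2_eq_square algebra_simps)
  moreover have "0 < 2 * a" using a by simp
  ultimately have "u \<le> c" "- c \<le> u" using mult_le_cancel_left_pos by blast+
  then have "u\<^sup>2 \<le> c\<^sup>2" by (intro abs_le_square_iff[THEN iffD1]) linarith
  then have v: "(sqrt (c\<^sup>2 - u\<^sup>2))\<^sup>2 = c\<^sup>2 - u\<^sup>2" by simp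
  have "(a - u)\<^sup>2 + (c\<^sup>2 - u\<^sup>2) = b\<^sup>2"
    using ua by (simp add: power2_eq_square algebra_simps)
  then have "dist (vector [0, 0]) (vector [a, 0] :: real ^ 2) = a \<and>
      dist (vector [a, 0]) (vector [u, sqrt (c\<^sup>2 - u\<^sup>2)] :: real ^ 2) = b \<and>
      dist (vector [u, sqrt (c\<^sup>2 - u\<^sup>2)]) (vector [0, 0] :: real ^ 2) = c"
    using assms(1-3) v by (simp add: dist_vec2)
  then show ?thesis by blast
qed

lemma dist_convex_combination_squared:
  fixes x y z :: "'a :: real_inner"
  shows "(dist z ((1 - t) *\<^sub>R x + t *\<^sub>R y))\<^sup>2
    = (1 - t) * (dist z x)\<^sup>2 + t * (dist z y)\<^sup>2 - t * (1 - t) * (dist x y)\<^sup>2"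
  unfolding dist_norm power2_norm_eq_inner
  by (simp add: inner_simps inner_commute algebra_simps)

text \<open>Comparison between a vertex and a point of the opposite side, where the planar distance
  is given by Stewart's theorem. The point \<open>z\<close> does not depend on \<open>w\<close>.
  This inequality is all that the later arguments use of the CAT(0) condition.\<close>

lemma CAT0_imp_CN:
  assumes X: "CAT0 X" and x: "x \<in> mspace X" and y: "y \<in> mspace X" and t: "0 \<le> t" "t \<le> 1"
  shows "\<exists>z\<in>mspace X. \<forall>w\<in>mspace X. (mdist X w z)\<^sup>2
    \<le> (1 - t) * (mdist X w x)\<^sup>2 + t * (mdist X w y)\<^sup>2 - t * (1 - t) * (mdist X x y)\<^sup>2"
proof -
  interpret Metric_space "mspace X" "mdist X" by simp
  have geo: "\<exists>S. geodesic_segment X a b S" if "a \<in> mspace X" "b \<in> mspace X" for a b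
    using X that by (auto simp: CAT0_def geodesic_space_def)
  obtain S where S: "geodesic_segment X x y S" using geo x y by blast
  define L where "L = mdist X x y"
  from S obtain c where c: "c \<in> {0..L} \<rightarrow> mspace X" "c 0 = x" "c L = y" "S = c ` {0..L}"
    and cd: "\<And>s t. s \<in> {0..L} \<Longrightarrow> t \<in> {0..L} \<Longrightarrow> mdist X (c s) (c t) = \<bar>s - t\<bar>"
    unfolding geodesic_segment_def L_def by blast
  have L0: "0 \<le> L" by (simp add: L_def)
  have tL: "t * L \<in> {0..L}" using t L0 by (auto simp: mult_left_le_one_le)
  define z where "z = c (t * L)"
  have z: "z \<in> S" "z \<in> mspace X" using c tL by (auto simp: z_def)
  have xz: "mdist X x z = t * L" using cd[of 0 "t * L"] tL c L0 by (simp add: z_def)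
  have "(mdist X w z)\<^sup>2 \<le> (1 - t) * (mdist X w x)\<^sup>2 + t * (mdist X w y)\<^sup>2 - t * (1 - t) * (mdist X x y)\<^sup>2"
    if w: "w \<in> mspace X" for w
  proof -
    obtain T U where T: "geodesic_segment X y w T" and U: "geodesic_segment X w x U"
      using geo x y w by blast
    have wT: "w \<in> T"
      using T unfolding geodesic_segment_def by (metis atLeastAtMost_iff image_eqI nonneg order_refl)
    obtain x' y' w' :: "real ^ 2" where tri: "dist x' y' = mdist X x y" "dist y' w' = mdist X y w" "dist w' x' = mdist X w x"
      using comparison_triangle_exists[of "mdist X x y" "mdist X y w" "mdist X w x"]
        triangle[OF x w y] triangle[OF y x w] triangle[OF w y x] by (auto simp: commute)
    define z' where "z' = (1 - t) *\<^sub>R x' + t *\<^sub>R y'"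
    have "x' - z' = t *\<^sub>R (x' - y')" by (simp add: z'_def algebra_simps)
    then have "dist x' z' = t * dist x' y'" using t by (simp add: dist_norm)
    then have cz: "comparison_point X x S x' y' z z'"
      using z xz tri t by (auto simp: comparison_point_def L_def z'_def closed_segment_def)
    have cw: "comparison_point X y T y' w' w w'"
      using wT tri by (simp add: comparison_point_def)
    have "mdist X w z \<le> dist w' z'"
      using X[unfolded CAT0_def Let_def] x y w S T U tri cz cw by blast
    then have "(mdist X w z)\<^sup>2 \<le> (dist w' z')\<^sup>2" by (intro power_mono) auto
    also have "\<dots> = (1 - t) * (dist w' x')\<^sup>2 + t * (dist w' y')\<^sup>2 - t * (1 - t) * (dist x' y')\<^sup>2"
      unfolding z'_def by (rule dist_convex_combination_squared)
    finally show ?thesis by (simp add: tri commute[of w y] flip: tri(2) dist_commute[of y' w'])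
  qed
  then show ?thesis using z by blast
qed

section \<open>Minimizers, projections and barycenters\<close>

locale hadamard_space = Metric_space +
  assumes complete: mcomplete
    and nonempty: "M \<noteq> {}"
    and CN: "\<And>x y t. \<lbrakk>x \<in> M; y \<in> M; 0 \<le> t; t \<le> 1\<rbrakk> \<Longrightarrow>
      \<exists>z\<in>M. \<forall>w\<in>M. (d w z)\<^sup>2 \<le> (1 - t) * (d w x)\<^sup>2 + t * (d w y)\<^sup>2 - t * (1 - t) * (d x y)\<^sup>2"
begin

text \<open>The point at ratio \<open>t\<close> on the geodesic from \<open>x\<close> to
  \<open>y\<close>, described without paths: by \<open>between_dist\<close> and
  \<open>between_unique\<close> the inequality pins it down.\<close>

definition between :: "real \<Rightarrow> 'a \<Rightarrow> 'a \<Rightarrow> 'a \<Rightarrow> bool"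
  where "between t x y z \<longleftrightarrow> z \<in> M \<and>
    (\<forall>w\<in>M. (d w z)\<^sup>2 \<le> (1 - t) * (d w x)\<^sup>2 + t * (d w y)\<^sup>2 - t * (1 - t) * (d x y)\<^sup>2)"

definition geodesically_convex :: "'a set \<Rightarrow> bool"
  where "geodesically_convex C \<longleftrightarrow> C \<subseteq> M \<and>
    (\<forall>x\<in>C. \<forall>y\<in>C. \<forall>t\<in>{0..1}. \<forall>z. between t x y z \<longrightarrow> z \<in> C)"

lemma between_exists: "\<lbrakk>x \<in> M; y \<in> M; 0 \<le> t; t \<le> 1\<rbrakk> \<Longrightarrow> \<exists>z. between t x y z"
  using CN unfolding between_def by meson

lemma between_unique:
  assumes "x \<in> M" "y \<in> M" "0 \<le> t" "t \<le> 1" "between t x y z" "z' \<in> M"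
    and "d x z' \<le> t * d x y" "d y z' \<le> (1 - t) * d x y"
  shows "z' = z"
proof -
  have "(d z' x)\<^sup>2 \<le> (t * d x y)\<^sup>2" "(d z' y)\<^sup>2 \<le> ((1 - t) * d x y)\<^sup>2"
    using assms by (auto simp: commute intro!: power_mono)
  then have "(1 - t) * (d z' x)\<^sup>2 \<le> (1 - t) * (t * d x y)\<^sup>2" "t * (d z' y)\<^sup>2 \<le> t * ((1 - t) * d x y)\<^sup>2"
    using assms by (auto intro!: mult_left_mono)
  moreover have "(d z' z)\<^sup>2 \<le> (1 - t) * (d z' x)\<^sup>2 + t * (d z' y)\<^sup>2 - t * (1 - t) * (d x y)\<^sup>2"
    using assms unfolding between_def by blast
  moreover have "(1 - t) * (t * d x y)\<^sup>2 + t * ((1 - t) * d x y)\<^sup>2 = t * (1 - t) * (d x y)\<^sup>2"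
    by (simp add: power2_eq_square algebra_simps)
  ultimately have "(d z' z)\<^sup>2 \<le> 0" by linarith
  then show ?thesis using assms by (auto simp: between_def)
qed

lemma between_dist:
  assumes "x \<in> M" "y \<in> M" "0 \<le> t" "t \<le> 1" "between t x y z"
  shows "d x z \<le> t * d x y" "d y z \<le> (1 - t) * d x y"
proof -
  have "(d x z)\<^sup>2 \<le> (1 - t) * (d x x)\<^sup>2 + t * (d x y)\<^sup>2 - t * (1 - t) * (d x y)\<^sup>2"
    "(d y z)\<^sup>2 \<le> (1 - t) * (d y x)\<^sup>2 + t * (d y y)\<^sup>2 - t * (1 - t) * (d x y)\<^sup>2"
    using assms unfolding between_def by blast+
  then have "(d x z)\<^sup>2 \<le> (t * d x y)\<^sup>2" "(d y z)\<^sup>2 \<le> ((1 - t) * d x y)\<^sup>2"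
    using assms by (simp_all add: commute[of y x] power2_eq_square algebra_simps)
  then show "d x z \<le> t * d x y" "d y z \<le> (1 - t) * d x y"
    using assms by (auto intro: power2_le_imp_le)
qed

lemma geodesically_convex_space: "geodesically_convex M"
  by (auto simp: geodesically_convex_def between_def)

lemma limitin_dist:
  assumes "limitin mtopology \<sigma> l sequentially" "p \<in> M"
  shows "(\<lambda>n. d (\<sigma> n) p) \<longlonglongrightarrow> d l p"
proof -
  have l: "l \<in> M" "\<forall>\<^sub>F n in sequentially. \<sigma> n \<in> M" "(\<lambda>n. d (\<sigma> n) l) \<longlonglongrightarrow> 0"
    using assms(1) by (auto simp: limitin_metric_dist_null)
  have "(\<lambda>n. d (\<sigma> n) p - d l p) \<longlonglongrightarrow> 0"
  proof (rule Lim_null_comparison[OF _ l(3)])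
    show "\<forall>\<^sub>F n in sequentially. norm (d (\<sigma> n) p - d l p) \<le> d (\<sigma> n) l"
      using l(2)
    proof eventually_elim
      case (elim n)
      then show ?case
        using mdist_reverse_triangle[of "\<sigma> n" p l] l assms by (simp add: commute)
    qed
  qed
  from tendsto_add[OF this tendsto_const[of "d l p"]] show ?thesis by simp
qed

text \<open>At a midpoint the value lies below the mean by at least a quarter of the squared
  distance, so points with values near the infimum are near each other and a minimizing sequence is
  Cauchy. The quadratic growth away from the minimizer is what later yields uniqueness, invariance
  and continuity.\<close>

lemma strongly_convex_minimizer:
  fixes F :: "'a \<Rightarrow> real"
  assumes C: "closedin mtopology C" "geodesically_convex C" "C \<noteq> {}"
    and F0: "\<And>x. x \<in> C \<Longrightarrow> 0 \<le> F x"
    and conv: "\<And>x y t z. \<lbrakk>x \<in> C; y \<in> C; 0 \<le> t; t \<le> 1; between t x y z\<rbrakk> \<Longrightarrow>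
      F z \<le> (1 - t) * F x + t * F y - t * (1 - t) * (d x y)\<^sup>2"
    and cont: "\<And>\<sigma> l. limitin mtopology \<sigma> l sequentially \<Longrightarrow> (\<lambda>n. F (\<sigma> n)) \<longlonglongrightarrow> F l"
  shows "\<exists>b\<in>C. \<forall>x\<in>C. F b + (d b x)\<^sup>2 \<le> F x"
proof -
  have CM: "C \<subseteq> M" using C by (simp add: geodesically_convex_def)
  define m where "m = Inf (F ` C)"
  have bdd: "bdd_below (F ` C)" using F0 by (intro bdd_belowI2)
  have m: "m \<le> F x" if "x \<in> C" for x
    unfolding m_def using bdd that by (rule cINF_lower)
  have "\<exists>x\<in>C. F x < m + 1 / real (Suc n)" for n
    using cInf_lessD[of "F ` C" "m + 1 / real (Suc n)"] C by (auto simp: m_def)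
  then obtain \<sigma> where \<sigma>: "\<And>n. \<sigma> n \<in> C" "\<And>n. F (\<sigma> n) < m + 1 / real (Suc n)" by metis
  have quarter: "(d x y)\<^sup>2 \<le> 4 * e" if "x \<in> C" "y \<in> C" "F x < m + e" "F y < m + e" for x y e
  proof -
    have "x \<in> M" "y \<in> M" using that CM by auto
    then obtain z where z: "between (1/2) x y z" using between_exists[of x y "1/2"] by auto
    moreover have "(1/2 :: real) \<in> {0..1}" by simp
    ultimately have "z \<in> C" using C that unfolding geodesically_convex_def by blast
    then show ?thesis
      using conv[OF that(1,2) _ _ z] m[of z] that by simp
  qed
  have "MCauchy \<sigma>"
    unfolding MCauchy_def
  proof (intro conjI allI impI)
    show "range \<sigma> \<subseteq> M" using \<sigma> CM by auto
    fix \<epsilon> :: real assume "0 < \<epsilon>"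
    then obtain N where N: "1 / real (Suc N) < \<epsilon>\<^sup>2 / 4"
      using reals_Archimedean[of "\<epsilon>\<^sup>2 / 4"] by (auto simp: inverse_eq_divide)
    have "d (\<sigma> n) (\<sigma> n') < \<epsilon>" if "N \<le> n" "N \<le> n'" for n n'
    proof -
      have "F (\<sigma> k) < m + 1 / real (Suc N)" if "N \<le> k" for k
        using \<sigma>(2)[of k] that frac_le[of 1 1 "real (Suc N)" "real (Suc k)"] by simp
      then have "(d (\<sigma> n) (\<sigma> n'))\<^sup>2 \<le> 4 * (1 / real (Suc N))"
        using quarter \<sigma>(1) that by blast
      also have "\<dots> < \<epsilon>\<^sup>2" using N by simp
      finally show ?thesis using \<open>0 < \<epsilon>\<close> by (simp add: power_less_imp_less_base)
    qed
    then show "\<exists>N. \<forall>n n'. N \<le> n \<longrightarrow> N \<le> n' \<longrightarrow> d (\<sigma> n) (\<sigma> n') < \<epsilon>" by blast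
  qed
  then obtain b where lim: "limitin mtopology \<sigma> b sequentially"
    using complete by (auto simp: mcomplete_def)
  have b: "b \<in> C"
    using C(1) lim \<sigma>(1) unfolding metric_closedin_iff_sequentially_closed by blast
  have "F b \<le> m"
  proof (rule LIMSEQ_le[OF cont[OF lim]])
    show "(\<lambda>n. m + 1 / real (Suc n)) \<longlonglongrightarrow> m"
      using tendsto_add[OF tendsto_const[of m] lim_inverse_n'[THEN LIMSEQ_Suc]] by simp
    show "\<exists>N. \<forall>n\<ge>N. F (\<sigma> n) \<le> m + 1 / real (Suc n)"
      using \<sigma>(2) less_imp_le by blast
  qed
  have "F b + (d b x)\<^sup>2 \<le> F x" if x: "x \<in> C" for x
  proof (rule ccontr)
    assume "\<not> ?thesis"
    then have gt: "F x - F b < (d b x)\<^sup>2" by simp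
    have "F b \<le> F x" using \<open>F b \<le> m\<close> m[OF x] by linarith
    have dpos: "0 < (d b x)\<^sup>2" using gt \<open>F b \<le> F x\<close> by linarith
    \<comment> \<open>Minimality of \<open>F b\<close> along the geodesic to \<open>x\<close> gives
      \<open>(1 - t) * (d b x)\<^sup>2 \<le> F x - F b\<close> for each positive \<open>t\<close>.
      The value chosen here is half of the one at which equality holds, and so violates
      this.\<close>
    define t where "t = ((d b x)\<^sup>2 - (F x - F b)) / (2 * (d b x)\<^sup>2)"
    have t: "0 < t" "t \<le> 1" using gt dpos \<open>F b \<le> F x\<close> by (auto simp: t_def field_simps)
    have "b \<in> M" "x \<in> M" using b x CM by auto
    then obtain z where z: "between t b x z" using between_exists[of b x t] t by auto
    moreover have "t \<in> {0..1}" using t by simp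
    ultimately have "z \<in> C" using C b x unfolding geodesically_convex_def by blast
    then have "F b \<le> (1 - t) * F b + t * F x - t * (1 - t) * (d b x)\<^sup>2"
      using conv[OF b x _ _ z] t m[of z] \<open>F b \<le> m\<close> by linarith
    then have "0 \<le> t * (F x - F b - (1 - t) * (d b x)\<^sup>2)" by (simp add: algebra_simps)
    then have "(1 - t) * (d b x)\<^sup>2 \<le> F x - F b" using t by (simp add: zero_le_mult_iff)
    moreover have "t * (d b x)\<^sup>2 = ((d b x)\<^sup>2 - (F x - F b)) / 2" using dpos by (simp add: t_def)
    moreover have "(1 - t) * (d b x)\<^sup>2 = (d b x)\<^sup>2 - t * (d b x)\<^sup>2" by (simp add: left_diff_distrib)
    ultimately show False using gt by argo
  qed
  then show ?thesis using b by blast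
qed

definition energy :: "'i set \<Rightarrow> ('i \<Rightarrow> real) \<Rightarrow> ('i \<Rightarrow> 'a) \<Rightarrow> 'a \<Rightarrow> real"
  where "energy I w p x = (\<Sum>i\<in>I. w i * (d x (p i))\<^sup>2)"

definition mass_system :: "'i set \<Rightarrow> ('i \<Rightarrow> real) \<Rightarrow> ('i \<Rightarrow> 'a) \<Rightarrow> bool"
  where "mass_system I w p \<longleftrightarrow> finite I \<and> (\<forall>i\<in>I. 0 \<le> w i) \<and> sum w I = 1 \<and> (\<forall>i\<in>I. p i \<in> M)"

lemma mass_systemD:
  assumes "mass_system I w p"
  shows "finite I" "i \<in> I \<Longrightarrow> 0 \<le> w i" "sum w I = 1" "i \<in> I \<Longrightarrow> p i \<in> M"
  using assms by (simp_all add: mass_system_def)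

lemma energy_minimizer:
  assumes "mass_system I w p"
    and C: "closedin mtopology C" "geodesically_convex C" "C \<noteq> {}"
  shows "\<exists>b\<in>C. \<forall>x\<in>C. energy I w p b + (d b x)\<^sup>2 \<le> energy I w p x"
proof (rule strongly_convex_minimizer[OF C])
  note I = mass_systemD[OF assms(1)]
  show "0 \<le> energy I w p x" for x
    using I by (auto simp: energy_def intro!: sum_nonneg)
  show "(\<lambda>n. energy I w p (\<sigma> n)) \<longlonglongrightarrow> energy I w p l" if "limitin mtopology \<sigma> l sequentially" for \<sigma> l
    unfolding energy_def using I limitin_dist[OF that] by (auto intro!: tendsto_intros)
  fix x y t z assume xy: "x \<in> C" "y \<in> C" and t: "0 \<le> t" "t \<le> 1" and z: "between t x y z"
  have zp: "(d z (p i))\<^sup>2 \<le> (1 - t) * (d x (p i))\<^sup>2 + t * (d y (p i))\<^sup>2 - t * (1 - t) * (d x y)\<^sup>2"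
    if "i \<in> I" for i
    using z I(4)[OF that] unfolding between_def by (metis commute)
  have "energy I w p z \<le> (\<Sum>i\<in>I. w i * ((1 - t) * (d x (p i))\<^sup>2 + t * (d y (p i))\<^sup>2 - t * (1 - t) * (d x y)\<^sup>2))"
    unfolding energy_def using I zp by (intro sum_mono mult_left_mono) auto
  also have "\<dots> = (1 - t) * energy I w p x + t * energy I w p y - t * (1 - t) * (d x y)\<^sup>2 * sum w I"
    unfolding energy_def sum_distrib_left sum.distrib[symmetric] sum_subtractf[symmetric]
    by (intro sum.cong) (auto simp: algebra_simps)
  finally show "energy I w p z \<le> (1 - t) * energy I w p x + t * energy I w p y - t * (1 - t) * (d x y)\<^sup>2"
    using I by simp
qed

text \<open>The nearest point is the energy minimizer for a single mass; the extra term is the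
  Pythagorean inequality at the foot point.\<close>

lemma projection_exists:
  assumes "closedin mtopology C" "geodesically_convex C" "C \<noteq> {}" "p \<in> M"
  shows "\<exists>c\<in>C. \<forall>x\<in>C. (d c p)\<^sup>2 + (d c x)\<^sup>2 \<le> (d x p)\<^sup>2"
  using energy_minimizer[of "{()}" "\<lambda>_. 1" "\<lambda>_. p" C] assms by (auto simp: energy_def mass_system_def)

definition barycenter :: "'i set \<Rightarrow> ('i \<Rightarrow> real) \<Rightarrow> ('i \<Rightarrow> 'a) \<Rightarrow> 'a"
  where "barycenter I w p = (SOME b. b \<in> M \<and> (\<forall>x\<in>M. energy I w p b + (d b x)\<^sup>2 \<le> energy I w p x))"

context
  fixes I :: "'i set" and w :: "'i \<Rightarrow> real" and p :: "'i \<Rightarrow> 'a"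
  assumes mass: "mass_system I w p"
begin

private lemmas I = mass_systemD[OF mass]

lemma barycenter: "barycenter I w p \<in> M"
  "x \<in> M \<Longrightarrow> energy I w p (barycenter I w p) + (d (barycenter I w p) x)\<^sup>2 \<le> energy I w p x"
proof -
  have "\<exists>b. b \<in> M \<and> (\<forall>x\<in>M. energy I w p b + (d b x)\<^sup>2 \<le> energy I w p x)"
    using energy_minimizer[OF mass _ geodesically_convex_space nonempty]
    by (metis closedin_topspace topspace_mtopology)
  from someI_ex[OF this, folded barycenter_def]
  show "barycenter I w p \<in> M"
    "x \<in> M \<Longrightarrow> energy I w p (barycenter I w p) + (d (barycenter I w p) x)\<^sup>2 \<le> energy I w p x"
    by blast+
qed

lemma barycenter_unique:
  assumes "x \<in> M" "energy I w p x \<le> energy I w p (barycenter I w p)"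
  shows "x = barycenter I w p"
proof -
  have "(d (barycenter I w p) x)\<^sup>2 \<le> 0"
    using barycenter(2)[OF assms(1)] assms(2) by linarith
  then show ?thesis using assms barycenter(1) by auto
qed

text \<open>Projecting the barycenter to \<open>C\<close> does not increase its distance to a point
  of \<open>C\<close>, hence does not increase the energy. Since the minimizer is unique, the
  barycenter is its own projection.\<close>

lemma barycenter_in_convex:
  assumes C: "closedin mtopology C" "geodesically_convex C"
    and p: "\<And>i. i \<in> I \<Longrightarrow> w i \<noteq> 0 \<Longrightarrow> p i \<in> C"
  shows "barycenter I w p \<in> C"
proof -
  let ?b = "barycenter I w p"
  have "\<exists>i\<in>I. w i \<noteq> 0" using I(3) by (metis sum.neutral zero_neq_one)
  then have "C \<noteq> {}" using p by blast
  then obtain c where c: "c \<in> C" "\<And>x. x \<in> C \<Longrightarrow> (d c ?b)\<^sup>2 + (d c x)\<^sup>2 \<le> (d x ?b)\<^sup>2"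
    using projection_exists[OF C _ barycenter(1)] by blast
  have CM: "C \<subseteq> M" using C by (simp add: geodesically_convex_def)
  have "energy I w p c \<le> energy I w p ?b"
    unfolding energy_def
  proof (intro sum_mono)
    fix i assume i: "i \<in> I"
    show "w i * (d c (p i))\<^sup>2 \<le> w i * (d ?b (p i))\<^sup>2"
    proof (cases "w i = 0")
      case False
      then have "(d c ?b)\<^sup>2 + (d c (p i))\<^sup>2 \<le> (d ?b (p i))\<^sup>2"
        using c p i by (metis commute)
      then have "(d c (p i))\<^sup>2 \<le> (d ?b (p i))\<^sup>2" by (smt (verit) zero_le_power2)
      then show ?thesis using I(2)[OF i] by (intro mult_left_mono)
    qed simp
  qed
  then show ?thesis using barycenter_unique c CM by blast
qed

text \<open>The energy at \<open>p j\<close> is at most the square of \<open>R\<close>, so the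
  minimum is too, and the barycenter lies within \<open>R\<close> of some mass point; a second step
  of length at most \<open>R\<close> leads to \<open>p j\<close>.\<close>

lemma barycenter_dist_vertex:
  assumes R: "\<And>i j. i \<in> I \<Longrightarrow> j \<in> I \<Longrightarrow> d (p i) (p j) \<le> R" and j: "j \<in> I"
  shows "d (barycenter I w p) (p j) \<le> 2 * R"
proof -
  let ?b = "barycenter I w p"
  have R0: "0 \<le> R" using R[OF j j] nonneg[of "p j" "p j"] by linarith
  have "energy I w p (p j) \<le> (\<Sum>i\<in>I. w i * R\<^sup>2)"
    unfolding energy_def using I R j by (intro sum_mono mult_left_mono power_mono) auto
  also have "\<dots> = R\<^sup>2" using I(3) by (simp flip: sum_distrib_right)
  finally have eR: "energy I w p ?b \<le> R\<^sup>2"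
    using barycenter(2)[OF I(4)[OF j]] by (smt (verit) zero_le_power2)
  have "\<exists>i\<in>I. d ?b (p i) \<le> R"
  proof (rule ccontr)
    assume "\<not> ?thesis"
    then have gt: "R < d ?b (p i)" if "i \<in> I" for i using that by force
    have "\<exists>i\<in>I. w i \<noteq> 0" using I(3) by (metis sum.neutral zero_neq_one)
    then obtain i where i: "i \<in> I" "0 < w i" using I(2) by force
    have "(\<Sum>i\<in>I. w i * R\<^sup>2) < energy I w p ?b"
      unfolding energy_def
    proof (rule sum_strict_mono_ex1[OF I(1)])
      show "\<forall>i\<in>I. w i * R\<^sup>2 \<le> w i * (d ?b (p i))\<^sup>2"
        using I gt R0 by (intro ballI mult_left_mono power_mono) (auto simp: less_imp_le)
      show "\<exists>i\<in>I. w i * R\<^sup>2 < w i * (d ?b (p i))\<^sup>2"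
        using i gt[OF i(1)] R0 by (intro bexI[of _ i] mult_strict_left_mono power_strict_mono) auto
    qed
    moreover have "(\<Sum>i\<in>I. w i * R\<^sup>2) = R\<^sup>2" using I(3) by (simp flip: sum_distrib_right)
    ultimately show False using eR by linarith
  qed
  then obtain i where i: "i \<in> I" "d ?b (p i) \<le> R" by blast
  then show ?thesis using triangle[OF barycenter(1) I(4)[OF i(1)] I(4)[OF j]] R[OF i(1) j] by linarith
qed

end

text \<open>Each growth inequality is evaluated at the other barycenter and the two are added. What
  remains are differences of weights times differences of squared distances, and these are at most
  the square of \<open>2 * R\<close>.\<close>

lemma barycenter_lipschitz:
  assumes w: "mass_system I w p" and w': "mass_system I w' p"
    and R: "\<And>i j. i \<in> I \<Longrightarrow> j \<in> I \<Longrightarrow> d (p i) (p j) \<le> R"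
  shows "(d (barycenter I w p) (barycenter I w' p))\<^sup>2 \<le> 2 * R\<^sup>2 * (\<Sum>i\<in>I. \<bar>w i - w' i\<bar>)"
proof -
  let ?b = "barycenter I w p" and ?b' = "barycenter I w' p"
  note B = barycenter[OF w] and B' = barycenter[OF w']
  have "energy I w p ?b + (d ?b ?b')\<^sup>2 \<le> energy I w p ?b'"
    "energy I w' p ?b' + (d ?b ?b')\<^sup>2 \<le> energy I w' p ?b"
    using B(2)[OF B'(1)] B'(2)[OF B(1)] by (simp_all add: commute[of ?b' ?b])
  then have "2 * (d ?b ?b')\<^sup>2 \<le> energy I w p ?b' - energy I w p ?b + (energy I w' p ?b - energy I w' p ?b')"
    by linarith
  also have "\<dots> = (\<Sum>i\<in>I. (w i - w' i) * ((d ?b' (p i))\<^sup>2 - (d ?b (p i))\<^sup>2))"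
    unfolding energy_def sum_subtractf[symmetric] sum.distrib[symmetric]
    by (intro sum.cong) (auto simp: algebra_simps)
  also have "\<dots> \<le> (\<Sum>i\<in>I. \<bar>w i - w' i\<bar> * (4 * R\<^sup>2))"
  proof (intro sum_mono)
    fix i assume i: "i \<in> I"
    have "d ?b (p i) \<le> 2 * R" "d ?b' (p i) \<le> 2 * R"
      using barycenter_dist_vertex[OF w R i] barycenter_dist_vertex[OF w' R i] by auto
    then have "(d ?b (p i))\<^sup>2 \<le> (2 * R)\<^sup>2" "(d ?b' (p i))\<^sup>2 \<le> (2 * R)\<^sup>2"
      by (meson nonneg power_mono)+
    moreover have "\<bar>A - B\<bar> \<le> D" if "A \<le> D" "B \<le> D" "0 \<le> A" "0 \<le> B" for A B D :: real
      using that by linarith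
    ultimately have "\<bar>(d ?b' (p i))\<^sup>2 - (d ?b (p i))\<^sup>2\<bar> \<le> 4 * R\<^sup>2"
      by (simp add: power_mult_distrib)
    then have "\<bar>w i - w' i\<bar> * \<bar>(d ?b' (p i))\<^sup>2 - (d ?b (p i))\<^sup>2\<bar> \<le> \<bar>w i - w' i\<bar> * (4 * R\<^sup>2)"
      by (intro mult_left_mono) auto
    then show "(w i - w' i) * ((d ?b' (p i))\<^sup>2 - (d ?b (p i))\<^sup>2) \<le> \<bar>w i - w' i\<bar> * (4 * R\<^sup>2)"
      by (metis abs_le_D1 abs_mult)
  qed
  also have "\<dots> = 2 * (2 * R\<^sup>2 * (\<Sum>i\<in>I. \<bar>w i - w' i\<bar>))"
    by (simp add: sum_distrib_left algebra_simps)
  finally show ?thesis by linarith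
qed

text \<open>
  With one family this is Helly's theorem. In general the sets \<open>C i j\<close> have as nerve a join of
  boundaries of simplices; the dual of that join is the boundary of the product of simplices on
  which the barycentric map below is defined.
\<close>

theorem helly_join:
  fixes C :: "nat \<Rightarrow> nat \<Rightarrow> 'a set" and m k dd :: nat
  assumes k: "k \<ge> 1" and dim: "covering_dim_le mtopology dd" "dd < m * k"
    and closed: "\<And>i j. i < m \<Longrightarrow> j \<le> k \<Longrightarrow> closedin mtopology (C i j)"
    and convex: "\<And>i j. i < m \<Longrightarrow> j \<le> k \<Longrightarrow> geodesically_convex (C i j)"
    and meet: "\<And>t. t \<in> PiE {..<m} (\<lambda>_. {..k}) \<Longrightarrow>
      \<exists>x\<in>M. \<forall>i<m. \<forall>j\<le>k. j \<noteq> t i \<longrightarrow> x \<in> C i j"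
  shows "\<exists>i<m. \<exists>x\<in>M. \<forall>j\<le>k. x \<in> C i j"
proof (rule ccontr)
  assume "\<not> ?thesis"
  then have miss: "\<exists>j\<le>k. x \<notin> C i j" if "x \<in> M" "i < m" for x i using that by blast
  define V where "V = PiE {..<m} (\<lambda>_. {..k})"
  let ?P = "simplex_prod m k"
  have "finite V" by (simp add: V_def finite_PiE)
  have Vk: "t i \<le> k" if "t \<in> V" "i < m" for t i using that by (auto simp: V_def PiE_iff)
  have "\<exists>x. t \<in> V \<longrightarrow> x \<in> M \<and> (\<forall>i<m. \<forall>j\<le>k. j \<noteq> t i \<longrightarrow> x \<in> C i j)" for t
    using meet[of t] by (auto simp: V_def)
  then have "\<forall>t. \<exists>x. t \<in> V \<longrightarrow> x \<in> M \<and> (\<forall>i<m. \<forall>j\<le>k. j \<noteq> t i \<longrightarrow> x \<in> C i j)" ..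
  from choice[OF this] obtain p where p: "\<And>t. t \<in> V \<Longrightarrow> p t \<in> M"
    and pC: "\<And>t i j. t \<in> V \<Longrightarrow> i < m \<Longrightarrow> j \<le> k \<Longrightarrow> j \<noteq> t i \<Longrightarrow> p t \<in> C i j"
    by blast
  \<comment> \<open>Multilinear coordinates: the vertices of the product of simplices carry the
    products of the barycentric coordinates as masses.\<close>
  define wt where "wt x t = (\<Prod>i<m. x (i, t i))" for x :: "nat \<times> nat \<Rightarrow> real" and t
  have mass: "mass_system V (wt x) p" if x: "x \<in> ?P" for x
  proof -
    have "sum (wt x) V = (\<Prod>i<m. \<Sum>j\<le>k. x (i, j))"
      unfolding wt_def V_def by (simp add: prod_sum_PiE)
    also have "\<dots> = 1" using simplex_prodD(1)[OF x] by simp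
    finally show ?thesis
      using \<open>finite V\<close> p simplex_prodD(3)[OF x] by (auto simp: mass_system_def wt_def intro!: prod_nonneg)
  qed
  define f where "f x = barycenter V (wt x) p" for x
  have fM: "f x \<in> M" if "x \<in> ?P" for x using barycenter(1)[OF mass[OF that]] by (simp add: f_def)
  define R where "R = (\<Sum>s\<in>V. \<Sum>t\<in>V. d (p s) (p t))"
  have R: "d (p s) (p t) \<le> R" if "s \<in> V" "t \<in> V" for s t
  proof -
    have "d (p s) (p t) \<le> (\<Sum>t\<in>V. d (p s) (p t))"
      using that \<open>finite V\<close> by (intro member_le_sum) auto
    also have "\<dots> \<le> R"
      unfolding R_def using that \<open>finite V\<close>
      by (intro member_le_sum[of s V "\<lambda>s. \<Sum>t\<in>V. d (p s) (p t)"]) (auto intro: sum_nonneg)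
    finally show ?thesis .
  qed
  have fcont: "continuous_map (top_of_set ?P) mtopology f"
    unfolding continuous_map_to_metric
  proof (intro ballI allI impI)
    fix x and \<epsilon> :: real assume "x \<in> topspace (top_of_set ?P)" and "0 < \<epsilon>"
    then have x: "x \<in> ?P" by simp
    define H where "H y = 2 * R\<^sup>2 * (\<Sum>t\<in>V. \<bar>wt x t - wt y t\<bar>)" for y
    have "continuous_on ?P (\<lambda>y. y q)" for q :: "nat \<times> nat"
      by (rule continuous_on_subset[OF continuous_on_product_coordinates]) simp
    then have "continuous_on ?P H"
      unfolding H_def wt_def by (intro continuous_intros)
    then have "openin (top_of_set ?P) (?P \<inter> H -` {..<\<epsilon>\<^sup>2})"
      by (rule continuous_openin_preimage_gen) simp
    moreover have "x \<in> ?P \<inter> H -` {..<\<epsilon>\<^sup>2}" using x \<open>0 < \<epsilon>\<close> by (simp add: H_def)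
    moreover have "f y \<in> mball (f x) \<epsilon>" if "y \<in> ?P \<inter> H -` {..<\<epsilon>\<^sup>2}" for y
    proof -
      have y: "y \<in> ?P" "H y < \<epsilon>\<^sup>2" using that by auto
      have "(d (f x) (f y))\<^sup>2 \<le> H y"
        unfolding f_def H_def using barycenter_lipschitz[OF mass[OF x] mass[OF y(1)] R] by simp
      then have "d (f x) (f y) < \<epsilon>"
        using y \<open>0 < \<epsilon>\<close> by (meson le_less_trans less_imp_le power_less_imp_less_base)
      then show ?thesis using fM x y by simp
    qed
    ultimately show "\<exists>U. openin (top_of_set ?P) U \<and> x \<in> U \<and> (\<forall>y\<in>U. f y \<in> mball (f x) \<epsilon>)"
      by blast
  qed
  \<comment> \<open>On the face \<open>x (i, j) = 0\<close> only vertices \<open>t\<close> with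
    \<open>t i\<close> different from \<open>j\<close> carry mass, and their points
    \<open>p t\<close> all lie in \<open>C i j\<close>.\<close>
  have fC: "f x \<in> C i j" if x: "x \<in> ?P" and ij: "i < m" "j \<le> k" and "x (i, j) = 0" for x i j
    unfolding f_def
  proof (rule barycenter_in_convex[OF mass[OF x] closed[OF ij] convex[OF ij]])
    fix t assume t: "t \<in> V" "wt x t \<noteq> 0"
    then have "x (i, t i) \<noteq> 0" using ij by (auto simp: wt_def)
    then have "j \<noteq> t i" using \<open>x (i, j) = 0\<close> by auto
    then show "p t \<in> C i j" using pC t ij by blast
  qed
  \<comment> \<open>These sets cover the space because no family has a common point, and
    \<open>U t\<close> is disjoint from the image under \<open>f\<close> of every face
    \<open>x (i, t i) = 0\<close>.\<close>
  define U where "U t = M - (\<Union>i<m. C i (t i))" for t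
  have Uo: "openin mtopology (U t)" if "t \<in> V" for t
  proof -
    have "closedin mtopology (\<Union>i<m. C i (t i))"
      using closed Vk[OF that] by (intro closedin_Union) auto
    then show ?thesis
      unfolding U_def by (metis openin_diff openin_topspace topspace_mtopology)
  qed
  have Ucov: "\<exists>t\<in>V. x \<in> U t" if "x \<in> M" for x
  proof -
    have "\<forall>i. \<exists>j. i < m \<longrightarrow> j \<le> k \<and> x \<notin> C i j" using miss[OF that] by blast
    from choice[OF this] obtain t where "\<And>i. i < m \<Longrightarrow> t i \<le> k \<and> x \<notin> C i (t i)" by blast
    then have "restrict t {..<m} \<in> V" "x \<in> U (restrict t {..<m})"
      using that by (auto simp: V_def U_def)
    then show ?thesis by blast
  qed
  have "U t \<subseteq> M" for t by (auto simp: U_def)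
  then have "(\<forall>u\<in>U ` V. openin mtopology u) \<and> \<Union>(U ` V) = topspace mtopology"
    unfolding topspace_mtopology using Uo Ucov by blast
  from mp[OF spec[OF dim(1)[unfolded covering_dim_le_def]] this]
  obtain \<V> where "(\<forall>v\<in>\<V>. openin mtopology v) \<and> \<Union>\<V> = topspace mtopology \<and>
      (\<forall>v\<in>\<V>. \<exists>u\<in>U ` V. v \<subseteq> u) \<and>
      (\<forall>x\<in>topspace mtopology. finite {v \<in> \<V>. x \<in> v} \<and> card {v \<in> \<V>. x \<in> v} \<le> dd + 1)"
    by (rule exE)
  then have \<V>: "\<And>v. v \<in> \<V> \<Longrightarrow> openin mtopology v" "\<Union>\<V> = M"
      "\<And>v. v \<in> \<V> \<Longrightarrow> \<exists>u\<in>U ` V. v \<subseteq> u"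
      "\<And>x. x \<in> M \<Longrightarrow> finite {v \<in> \<V>. x \<in> v} \<and> card {v \<in> \<V>. x \<in> v} \<le> dd + 1"
    unfolding topspace_mtopology by blast+
  have "\<forall>v. \<exists>t. v \<in> \<V> \<longrightarrow> t \<in> V \<and> v \<subseteq> U t" using \<V>(3) by blast
  from choice[OF this] obtain \<tau> where \<tau>: "\<And>v. v \<in> \<V> \<Longrightarrow> \<tau> v \<in> V \<and> v \<subseteq> U (\<tau> v)" by blast
  \<comment> \<open>Members of the refinement are merged according to a chosen vertex, so the cover
    becomes indexed by \<open>V\<close> and its order does not grow: a point lies in at most
    \<open>dd + 1\<close> of these sets, which is at most \<open>m * k\<close>.\<close>
  define W where "W t = \<Union>{v \<in> \<V>. \<tau> v = t}" for t
  have Wo: "openin mtopology (W t)" for t unfolding W_def using \<V>(1) by (intro openin_Union) auto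
  have WU: "W t \<subseteq> U t" for t using \<tau> by (auto simp: W_def)
  have Wcov: "\<exists>t\<in>V. x \<in> W t" if "x \<in> M" for x
    using that \<V>(2) \<tau> unfolding W_def by blast
  have Wcard: "card {t \<in> V. x \<in> W t} \<le> m * k" if "x \<in> M" for x
  proof -
    have "{t \<in> V. x \<in> W t} \<subseteq> \<tau> ` {v \<in> \<V>. x \<in> v}" by (auto simp: W_def)
    then have "card {t \<in> V. x \<in> W t} \<le> card {v \<in> \<V>. x \<in> v}"
      using \<V>(4)[OF that] by (meson card_image_le card_mono finite_imageI le_trans)
    then show ?thesis using \<V>(4)[OF that] dim(2) by linarith
  qed
  define Q where "Q t = ?P - {x \<in> ?P. f x \<in> W t}" for t
  \<comment> \<open>If \<open>Q t\<close> is empty, then \<open>W t\<close> contains the whole image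
    of \<open>f\<close> and the function has to be positive, whereas \<open>infdist\<close> to the
    empty set is 0; hence the default value 1.\<close>
  define \<phi> where "\<phi> t x = (if Q t = {} then 1 else infdist x (Q t))" for t x
  have \<phi>cont: "continuous_on ?P (\<phi> t)" for t
    unfolding \<phi>_def by (cases "Q t = {}") (auto intro!: continuous_intros)
  have \<phi>0: "0 \<le> \<phi> t x" for t x by (simp add: \<phi>_def infdist_nonneg)
  have \<phi>W: "\<phi> t x = 0 \<longleftrightarrow> f x \<notin> W t" if x: "x \<in> ?P" for t x
  proof (cases "Q t = {}")
    case True
    then show ?thesis using x by (auto simp: \<phi>_def Q_def)
  next
    case False
    have "openin (top_of_set ?P) {x \<in> ?P. f x \<in> W t}"
      using openin_continuous_map_preimage[OF fcont Wo] by simp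
    then have "closedin (top_of_set ?P) (Q t)"
      unfolding Q_def by (intro closedin_diff closedin_self)
    then obtain T where T: "closed T" "Q t = ?P \<inter> T" unfolding closedin_closed by blast
    have "x \<in> closure (Q t) \<longleftrightarrow> x \<in> Q t"
    proof
      assume "x \<in> closure (Q t)"
      moreover have "closure (Q t) \<subseteq> T" using T by (intro closure_minimal) auto
      ultimately show "x \<in> Q t" using T x by auto
    qed (use closure_subset in blast)
    then show ?thesis
      using in_closure_iff_infdist_zero[OF False, of x] x False by (auto simp: \<phi>_def Q_def)
  qed
  have pos: "0 < (\<Sum>t\<in>V. \<phi> t x)" if x: "x \<in> ?P" for x
  proof -
    obtain t where "t \<in> V" "f x \<in> W t" using Wcov[OF fM[OF x]] by blast
    then have "0 < \<phi> t x" using \<phi>W[OF x] \<phi>0[of t x] by (metis less_eq_real_def)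
    then show ?thesis using \<open>t \<in> V\<close> \<open>finite V\<close> \<phi>0 by (intro sum_pos2[of V t]) auto
  qed
  define w where "w t x = \<phi> t x / (\<Sum>s\<in>V. \<phi> s x)" for t x
  have w0: "w t x = 0 \<longleftrightarrow> f x \<notin> W t" if "x \<in> ?P" for t x
    using pos[OF that] \<phi>W[OF that] by (simp add: w_def)
  show False
  proof (rule no_face_avoiding_partition[OF k, of m w, folded V_def])
    have "(\<Sum>s\<in>V. \<phi> s x) \<noteq> 0" if "x \<in> ?P" for x using pos[OF that] by simp
    then show "continuous_on ?P (w t)" for t
      unfolding w_def using \<phi>cont by (intro continuous_intros) auto
    show "0 \<le> w t x" if "x \<in> ?P" for t x
      using pos[OF that] \<phi>0[of t x] by (simp add: w_def)
    show "(\<Sum>t\<in>V. w t x) = 1" if "x \<in> ?P" for x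
      using pos[OF that] by (simp add: w_def flip: sum_divide_distrib)
    show "w t x = 0" if "t \<in> V" and x: "x \<in> ?P" and i: "i < m" and "x (i, t i) = 0" for t x i
    proof -
      have "f x \<in> C i (t i)" using fC[OF x i Vk] that by blast
      then have "f x \<notin> U t" using i by (auto simp: U_def)
      then show ?thesis using WU w0[OF x] by blast
    qed
    show "card {t \<in> V. w t x \<noteq> 0} \<le> m * k" if "x \<in> ?P" for x
      using Wcard[OF fM[OF that]] w0[OF that] by simp
  qed
qed

end

section \<open>Fixed point sets of isometric actions\<close>

locale isometric_action = hadamard_space M d + group G
  for M :: "'a set" and d :: "'a \<Rightarrow> 'a \<Rightarrow> real" and G :: "('g, 'b) monoid_scheme" (structure) +
  fixes act :: "'g \<Rightarrow> 'a \<Rightarrow> 'a"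
  assumes act_closed: "\<And>g x. g \<in> carrier G \<Longrightarrow> x \<in> M \<Longrightarrow> act g x \<in> M"
    and act_mult: "\<And>g h x. g \<in> carrier G \<Longrightarrow> h \<in> carrier G \<Longrightarrow> x \<in> M \<Longrightarrow> act (g \<otimes> h) x = act g (act h x)"
    and act_one: "\<And>x. x \<in> M \<Longrightarrow> act \<one> x = x"
    and act_isometry: "\<And>g x y. g \<in> carrier G \<Longrightarrow> x \<in> M \<Longrightarrow> y \<in> M \<Longrightarrow> d (act g x) (act g y) = d x y"
begin

definition Fixed :: "'g set \<Rightarrow> 'a set"
  where "Fixed T = {x \<in> M. \<forall>g\<in>T. act g x = x}"

text \<open>An isometry fixing \<open>x\<close> and \<open>y\<close> preserves the distances of
  \<open>z\<close> to both, and \<open>z\<close> is the only point with these distances.\<close>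

lemma Fixed_convex:
  assumes "T \<subseteq> carrier G"
  shows "geodesically_convex (Fixed T)"
  unfolding geodesically_convex_def
proof (intro conjI ballI allI impI)
  fix x y t z assume xy: "x \<in> Fixed T" "y \<in> Fixed T" and t: "t \<in> {0..1::real}" and z: "between t x y z"
  then have M: "x \<in> M" "y \<in> M" "z \<in> M" by (auto simp: Fixed_def between_def)
  have "act g z = z" if g: "g \<in> T" for g
  proof -
    have gG: "g \<in> carrier G" using g assms by blast
    have "act g x = x" "act g y = y" using xy g by (auto simp: Fixed_def)
    then have "d x (act g z) = d x z" "d y (act g z) = d y z"
      using act_isometry[OF gG _ M(3)] M by metis+
    then show ?thesis
      using between_unique[OF M(1,2) _ _ z act_closed[OF gG M(3)]] between_dist[OF M(1,2) _ _ z] t by simp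
  qed
  then show "z \<in> Fixed T" using M by (simp add: Fixed_def)
qed (auto simp: Fixed_def)

lemma Fixed_closed:
  assumes "T \<subseteq> carrier G"
  shows "closedin mtopology (Fixed T)"
  unfolding metric_closedin_iff_sequentially_closed
proof (intro conjI allI impI)
  fix \<sigma> l assume \<sigma>: "range \<sigma> \<subseteq> Fixed T \<and> limitin mtopology \<sigma> l sequentially"
  then have l: "l \<in> M" by (auto simp: limitin_metric_dist_null)
  have "act g l = l" if g: "g \<in> T" for g
  proof -
    have gG: "g \<in> carrier G" using g assms by blast
    have "d (\<sigma> n) (act g l) = d (\<sigma> n) l" for n
    proof -
      have "\<sigma> n \<in> Fixed T" using \<sigma> by blast
      then show ?thesis
        using g act_isometry[OF gG _ l, of "\<sigma> n"] by (simp add: Fixed_def)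
    qed
    moreover have "(\<lambda>n. d (\<sigma> n) (act g l)) \<longlonglongrightarrow> d l (act g l)"
      using limitin_dist act_closed[OF gG l] \<sigma> by blast
    moreover have "(\<lambda>n. d (\<sigma> n) l) \<longlonglongrightarrow> d l l" using limitin_dist l \<sigma> by blast
    ultimately have "d l (act g l) = d l l" using LIMSEQ_unique by auto
    then show ?thesis using l act_closed[OF gG l] by simp
  qed
  then show "l \<in> Fixed T" using l by (simp add: Fixed_def)
qed (auto simp: Fixed_def)

text \<open>Multiplication by \<open>t\<close> permutes the finite set \<open>K\<close>, so the
  action of \<open>t\<close> permutes the points \<open>act g x\<close> with \<open>g\<close> in
  \<open>K\<close> and fixes their barycenter. Closure under \<open>T\<close> is enough for this;
  the subgroup generated by \<open>T\<close> never has to be formed.\<close>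

lemma Fixed_nonempty_finite_orbit:
  assumes T: "T \<subseteq> carrier G" and K: "finite K" "K \<noteq> {}" "K \<subseteq> carrier G"
    and TK: "\<And>t g. t \<in> T \<Longrightarrow> g \<in> K \<Longrightarrow> t \<otimes> g \<in> K"
  shows "Fixed T \<noteq> {}"
proof -
  obtain x where x: "x \<in> M" using nonempty by blast
  define p where "p g = act g x" for g
  have pM: "p g \<in> M" if "g \<in> K" for g using that K x act_closed by (auto simp: p_def)
  have mass: "mass_system K (\<lambda>_. 1 / real (card K)) p"
    using K pM by (auto simp: mass_system_def)
  define b where "b = barycenter K (\<lambda>_. 1 / real (card K)) p"
  have b: "b \<in> M" using barycenter(1)[OF mass] by (simp add: b_def)
  have "act t b = b" if t: "t \<in> T" for t
  proof -
    have tG: "t \<in> carrier G" using t T by blast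
    have inj: "inj_on ((\<otimes>) t) K" using tG K by (intro inj_onI) (metis Units_eq Units_l_cancel subsetD)
    then have img: "(\<otimes>) t ` K = K" using TK[OF t] K by (intro endo_inj_surj) auto
    have "energy K (\<lambda>_. 1 / real (card K)) p (act t b)
        = (\<Sum>g\<in>(\<otimes>) t ` K. 1 / real (card K) * (d (act t b) (p g))\<^sup>2)"
      unfolding img energy_def ..
    also have "\<dots> = (\<Sum>g\<in>K. 1 / real (card K) * (d (act t b) (p (t \<otimes> g)))\<^sup>2)"
      by (subst sum.reindex[OF inj]) simp
    also have "\<dots> = energy K (\<lambda>_. 1 / real (card K)) p b"
      unfolding energy_def
    proof (intro sum.cong refl)
      fix g assume g: "g \<in> K"
      then have "p (t \<otimes> g) = act t (p g)" using act_mult[OF tG _ x] K by (auto simp: p_def)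
      then show "1 / real (card K) * (d (act t b) (p (t \<otimes> g)))\<^sup>2 = 1 / real (card K) * (d b (p g))\<^sup>2"
        using act_isometry[OF tG b pM[OF g]] by simp
    qed
    finally show ?thesis
      using barycenter_unique[OF mass act_closed[OF tG b]] by (simp add: b_def)
  qed
  then show ?thesis using b by (auto simp: Fixed_def)
qed

text \<open>
  The hypothesis makes \<open>S\<close> normalize the group generated by \<open>T\<close>, so \<open>Fixed T\<close> is \<open>S\<close>-invariant and
  projecting a fixed point of \<open>S\<close> to it gives a common fixed point.
\<close>

lemma Fixed_nonempty_normalizing:
  assumes S: "S \<subseteq> carrier G" and T: "T \<subseteq> carrier G"
    and normal: "\<And>s t. s \<in> S \<Longrightarrow> t \<in> T \<Longrightarrow> t \<otimes> s = s \<otimes> t \<or> t \<otimes> s \<otimes> t = s"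
    and ne: "Fixed S \<noteq> {}" "Fixed T \<noteq> {}"
  shows "Fixed (S \<union> T) \<noteq> {}"
proof -
  have inv: "act s x \<in> Fixed T" if s: "s \<in> S" and x: "x \<in> Fixed T" for s x
  proof -
    have sG: "s \<in> carrier G" using s S by blast
    have xM: "x \<in> M" using x by (simp add: Fixed_def)
    have "act t (act s x) = act s x" if t: "t \<in> T" for t
    proof -
      have tG: "t \<in> carrier G" using t T by blast
      have tx: "act t x = x" using x t by (simp add: Fixed_def)
      from normal[OF s t] show ?thesis
      proof
        assume "t \<otimes> s = s \<otimes> t"
        then show ?thesis using act_mult[OF tG sG xM] act_mult[OF sG tG xM] tx by simp
      next
        assume "t \<otimes> s \<otimes> t = s"
        then show ?thesis using act_mult[of "t \<otimes> s" t x] act_mult[OF tG sG xM] tG sG xM tx by simp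
      qed
    qed
    then show ?thesis using act_closed[OF sG xM] by (simp add: Fixed_def)
  qed
  obtain p where p: "p \<in> Fixed S" using ne by blast
  then have pM: "p \<in> M" by (simp add: Fixed_def)
  obtain c where c: "c \<in> Fixed T" "\<And>x. x \<in> Fixed T \<Longrightarrow> (d c p)\<^sup>2 + (d c x)\<^sup>2 \<le> (d x p)\<^sup>2"
    using projection_exists[OF Fixed_closed[OF T] Fixed_convex[OF T] ne(2) pM] by blast
  have cM: "c \<in> M" using c by (simp add: Fixed_def)
  have "act s c = c" if s: "s \<in> S" for s
  proof -
    have sG: "s \<in> carrier G" using s S by blast
    have "d (act s c) p = d c p"
      using act_isometry[OF sG cM pM] p s by (simp add: Fixed_def)
    then have "(d c (act s c))\<^sup>2 \<le> 0" using c(2)[OF inv[OF s c(1)]] by simp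
    then show ?thesis using cM act_closed[OF sG cM] by simp
  qed
  then have "c \<in> Fixed (S \<union> T)" using c(1) cM by (auto simp: Fixed_def)
  then show ?thesis by blast
qed

text \<open>An application of \<open>helly_join\<close> to the sets \<open>Fixed {g i j}\<close>.
  Its hypothesis holds because distinct copies commute: fixed points of the \<open>m\<close> proper
  subsets are merged one copy at a time by \<open>Fixed_nonempty_normalizing\<close>.\<close>

theorem Fixed_nonempty_commuting_copies:
  fixes g :: "nat \<Rightarrow> nat \<Rightarrow> 'g"
  assumes k: "k \<ge> 1" and dim: "covering_dim_le mtopology dd" "dd < m * k"
    and g: "\<And>i j. i < m \<Longrightarrow> j \<le> k \<Longrightarrow> g i j \<in> carrier G"
    and comm: "\<And>i i' j j'. \<lbrakk>i < m; i' < m; i \<noteq> i'; j \<le> k; j' \<le> k\<rbrakk> \<Longrightarrow> g i j \<otimes> g i' j' = g i' j' \<otimes> g i j"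
    and proper: "\<And>i l. i < m \<Longrightarrow> l \<le> k \<Longrightarrow> Fixed (g i ` ({..k} - {l})) \<noteq> {}"
  shows "\<exists>i<m. Fixed (g i ` {..k}) \<noteq> {}"
proof -
  have "\<exists>i<m. \<exists>x\<in>M. \<forall>j\<le>k. x \<in> Fixed {g i j}"
  proof (rule helly_join[OF k dim])
    show "closedin mtopology (Fixed {g i j})" "geodesically_convex (Fixed {g i j})" if "i < m" "j \<le> k" for i j
      using g[OF that] by (auto intro: Fixed_closed Fixed_convex)
    fix t assume t: "t \<in> {..<m} \<rightarrow>\<^sub>E {..k}"
    have "Fixed (\<Union>i<l. g i ` ({..k} - {t i})) \<noteq> {}" if "l \<le> m" for l
      using that
    proof (induction l)
      case 0
      then show ?case using nonempty by (simp add: Fixed_def)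
    next
      case (Suc l)
      have "Fixed ((\<Union>i<l. g i ` ({..k} - {t i})) \<union> g l ` ({..k} - {t l})) \<noteq> {}"
      proof (rule Fixed_nonempty_normalizing)
        show "(\<Union>i<l. g i ` ({..k} - {t i})) \<subseteq> carrier G" "g l ` ({..k} - {t l}) \<subseteq> carrier G"
          using Suc.prems g by force+
        show "Fixed (\<Union>i<l. g i ` ({..k} - {t i})) \<noteq> {}" using Suc by simp
        show "Fixed (g l ` ({..k} - {t l})) \<noteq> {}" using Suc.prems t by (intro proper) (auto simp: PiE_iff)
        fix a b assume "a \<in> (\<Union>i<l. g i ` ({..k} - {t i}))" "b \<in> g l ` ({..k} - {t l})"
        then show "b \<otimes> a = a \<otimes> b \<or> b \<otimes> a \<otimes> b = a" using comm Suc.prems by force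
      qed
      moreover have "(\<Union>i<Suc l. g i ` ({..k} - {t i})) = (\<Union>i<l. g i ` ({..k} - {t i})) \<union> g l ` ({..k} - {t l})"
        by (simp add: lessThan_Suc Un_commute)
      ultimately show ?case by simp
    qed
    from this[OF order_refl] obtain x where "x \<in> Fixed (\<Union>i<m. g i ` ({..k} - {t i}))" by blast
    then show "\<exists>x\<in>M. \<forall>i<m. \<forall>j\<le>k. j \<noteq> t i \<longrightarrow> x \<in> Fixed {g i j}"
      by (intro bexI[of _ x]) (auto simp: Fixed_def)
  qed
  then show ?thesis by (fastforce simp: Fixed_def)
qed

lemma Fixed_antimono: "S \<subseteq> T \<Longrightarrow> Fixed T \<subseteq> Fixed S"
  by (auto simp: Fixed_def)

lemma Fixed_conj:
  assumes w: "w \<in> carrier G" and T: "T \<subseteq> carrier G"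
  shows "Fixed ((\<lambda>t. w \<otimes> t \<otimes> inv w) ` T) \<noteq> {} \<longleftrightarrow> Fixed T \<noteq> {}"
proof
  assume "Fixed T \<noteq> {}"
  then obtain x where x: "x \<in> M" "\<And>t. t \<in> T \<Longrightarrow> act t x = x" by (auto simp: Fixed_def)
  have "act (w \<otimes> t \<otimes> inv w) (act w x) = act w x" if t: "t \<in> T" for t
  proof -
    have tG: "t \<in> carrier G" using t T by blast
    have "act (w \<otimes> t \<otimes> inv w) (act w x) = act (w \<otimes> t \<otimes> inv w \<otimes> w) x"
      using w tG x by (subst act_mult[of "w \<otimes> t \<otimes> inv w" w]) auto
    also have "w \<otimes> t \<otimes> inv w \<otimes> w = w \<otimes> t" using w tG by (simp add: m_assoc)
    finally show ?thesis using act_mult[OF w tG x(1)] x(2)[OF t] by simp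
  qed
  then have "act w x \<in> Fixed ((\<lambda>t. w \<otimes> t \<otimes> inv w) ` T)"
    using act_closed[OF w x(1)] by (auto simp: Fixed_def)
  then show "Fixed ((\<lambda>t. w \<otimes> t \<otimes> inv w) ` T) \<noteq> {}" by blast
next
  assume "Fixed ((\<lambda>t. w \<otimes> t \<otimes> inv w) ` T) \<noteq> {}"
  then obtain z where z: "z \<in> M" "\<And>t. t \<in> T \<Longrightarrow> act (w \<otimes> t \<otimes> inv w) z = z" by (auto simp: Fixed_def)
  have "act t (act (inv w) z) = act (inv w) z" if t: "t \<in> T" for t
  proof -
    have tG: "t \<in> carrier G" using t T by blast
    have "act t (act (inv w) z) = act (t \<otimes> inv w) z" using act_mult[OF tG _ z(1), of "inv w"] w by simp
    also have "t \<otimes> inv w = inv w \<otimes> (w \<otimes> t \<otimes> inv w)" using w tG by (simp flip: m_assoc)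
    also have "act (inv w \<otimes> (w \<otimes> t \<otimes> inv w)) z = act (inv w) z"
      using act_mult[of "inv w" "w \<otimes> t \<otimes> inv w" z] z(2)[OF t] w tG z(1) by simp
    finally show ?thesis .
  qed
  then have "act (inv w) z \<in> Fixed T" using act_closed[of "inv w" z] w z by (simp add: Fixed_def)
  then show "Fixed T \<noteq> {}" by blast
qed

end

section \<open>Signed permutations, transvections and supports\<close>

section \<open>Automorphisms of free groups\<close>

definition winv :: "letter list \<Rightarrow> letter list"
  where "winv w = rev (map inv_letter w)"

text \<open>\<open>S\<close> lists the sources of the inverted letters, not their targets.\<close>

definition sperm :: "(nat \<Rightarrow> nat) \<Rightarrow> nat set \<Rightarrow> letter \<Rightarrow> letter"
  where "sperm \<pi> S x = (\<pi> (fst x), if fst x \<in> S then \<not> snd x else snd x)"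

abbreviation "swp \<equiv> Transposition.transpose"

lemma sperm_inv_letter: "sperm \<pi> S (inv_letter x) = inv_letter (sperm \<pi> S x)"
  by (simp add: sperm_def inv_letter_def)

lemma sperm_eq_iff: "inj \<pi> \<Longrightarrow> sperm \<pi> S x = sperm \<pi> S y \<longleftrightarrow> x = y"
  by (cases x; cases y) (auto simp: sperm_def dest: injD)

lemma winv_winv [simp]: "winv (winv w) = w"
  by (simp add: winv_def rev_map comp_def)

lemma set_winv: "fst ` set (winv w) = fst ` set w"
  by (auto simp: winv_def image_image)

lemma reduced_append_iff:
  "reduced (u @ v) \<longleftrightarrow> reduced u \<and> reduced v \<and> (u \<noteq> [] \<longrightarrow> v \<noteq> [] \<longrightarrow> hd v \<noteq> inv_letter (last u))"
  by (auto simp: reduced_def successively_append_iff)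

lemma reduced_winv: "reduced w \<Longrightarrow> reduced (winv w)"
  by (induction w) (auto simp: winv_def reduced_append_iff reduced_Cons hd_rev last_map hd_map last_rev)

lemma word_mult_reduced: "reduced (u @ v) \<Longrightarrow> word_mult u v = u @ v"
proof (induction u)
  case (Cons x u)
  then have "word_mult u v = u @ v" "reduced (x # (u @ v))" by (auto simp: reduced_Cons)
  then show ?case by (cases "u @ v") (auto simp: word_mult_def reduced_Cons)
qed (simp add: word_mult_def)

lemma reduced_map_sperm:
  assumes "inj \<pi>"
  shows "reduced (map (sperm \<pi> S) w) \<longleftrightarrow> reduced w"
proof (induction w)
  case (Cons x w)
  then show ?case
    by (cases w) (auto simp: reduced_Cons sperm_eq_iff[OF assms] simp flip: sperm_inv_letter)
qed simp

lemma map_sperm_word_mult: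
  assumes "inj \<pi>"
  shows "map (sperm \<pi> S) (word_mult u v) = word_mult (map (sperm \<pi> S) u) (map (sperm \<pi> S) v)"
proof (induction u)
  case (Cons x u)
  have "map (sperm \<pi> S) (letter_mult x w) = letter_mult (sperm \<pi> S x) (map (sperm \<pi> S) w)" for w
    by (cases w) (auto simp: sperm_eq_iff[OF assms] simp flip: sperm_inv_letter)
  then show ?case using Cons by (simp add: word_mult_def)
qed (simp add: word_mult_def)

locale aut_free =
  fixes n :: nat
begin

abbreviation "F \<equiv> free_group n"
abbreviation "A \<equiv> AutoGroup F"
abbreviation aut_mult (infixl "\<cdot>" 70) where "\<phi> \<cdot> \<psi> \<equiv> \<phi> \<otimes>\<^bsub>A\<^esub> \<psi>"

sublocale F: group F by (rule group_free_group)
sublocale A: group A by (rule group.AutoGroup[OF group_free_group])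

lemma carrier_F: "w \<in> carrier F \<longleftrightarrow> reduced w \<and> fst ` set w \<subseteq> {..<n}"
  by (simp add: free_group_def)

lemma mult_F [simp]: "u \<otimes>\<^bsub>F\<^esub> v = word_mult u v"
  by (simp add: free_group_def)

lemma one_F [simp]: "\<one>\<^bsub>F\<^esub> = []"
  by (simp add: free_group_def)

lemma winv_carrier: "w \<in> carrier F \<Longrightarrow> winv w \<in> carrier F"
  by (simp add: carrier_F reduced_winv set_winv)

lemma inv_F: "w \<in> carrier F \<Longrightarrow> inv\<^bsub>F\<^esub> w = winv w"
proof (rule F.inv_equality)
  assume w: "w \<in> carrier F"
  then have "word_mult (winv w) (word_mult w []) = []"
    unfolding winv_def by (intro word_mult_inverse) simp
  then show "winv w \<otimes>\<^bsub>F\<^esub> w = \<one>\<^bsub>F\<^esub>" using w by (simp add: word_mult_Nil carrier_F)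
qed (simp_all add: winv_carrier)

lemma letter_carrier [simp]: "[x] \<in> carrier F \<longleftrightarrow> fst x < n"
  by (simp add: carrier_F reduced_def)

lemma mult_carrier: "u \<in> carrier F \<Longrightarrow> v \<in> carrier F \<Longrightarrow> word_mult u v \<in> carrier F"
  using F.m_closed by simp

lemma Cons_carrier:
  assumes "x # w \<in> carrier F"
  shows "fst x < n" "w \<in> carrier F" "x # w = word_mult [x] w"
proof -
  show "fst x < n" "w \<in> carrier F" using assms by (auto simp: carrier_F reduced_Cons)
  show "x # w = word_mult [x] w" using word_mult_reduced[of "[x]" w] assms by (simp add: carrier_F)
qed

lemma carrier_A: "\<phi> \<in> carrier A \<longleftrightarrow> \<phi> \<in> hom F F \<and> \<phi> \<in> extensional (carrier F) \<and> bij_betw \<phi> (carrier F) (carrier F)"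
  by (auto simp: AutoGroup_def auto_def Bij_def)

lemma mult_A: "\<phi> \<in> carrier A \<Longrightarrow> \<psi> \<in> carrier A \<Longrightarrow> \<phi> \<cdot> \<psi> = compose (carrier F) \<phi> \<psi>"
  by (simp add: AutoGroup_def BijGroup_def auto_def)

lemma one_A: "\<one>\<^bsub>A\<^esub> = (\<lambda>w\<in>carrier F. w)"
  by (simp add: AutoGroup_def BijGroup_def)

lemma apply_mult_A:
  "\<phi> \<in> carrier A \<Longrightarrow> \<psi> \<in> carrier A \<Longrightarrow> w \<in> carrier F \<Longrightarrow> (\<phi> \<cdot> \<psi>) w = \<phi> (\<psi> w)"
  by (simp add: mult_A compose_def)

lemma A_closed: "\<phi> \<in> carrier A \<Longrightarrow> w \<in> carrier F \<Longrightarrow> \<phi> w \<in> carrier F"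
  by (auto simp: carrier_A bij_betw_def)

lemma A_word_mult:
  "\<phi> \<in> carrier A \<Longrightarrow> u \<in> carrier F \<Longrightarrow> v \<in> carrier F \<Longrightarrow> \<phi> (word_mult u v) = word_mult (\<phi> u) (\<phi> v)"
  using hom_mult[of \<phi> F F u v] by (simp add: carrier_A)

lemma A_winv:
  assumes "\<phi> \<in> carrier A" "w \<in> carrier F"
  shows "\<phi> (winv w) = winv (\<phi> w)"
proof -
  interpret h: group_hom F F \<phi>
    using assms by (intro group_hom.intro) (auto simp: group_hom_axioms_def carrier_A group_free_group)
  show ?thesis using h.hom_inv[OF assms(2)] assms by (simp add: inv_F A_closed)
qed

lemma A_Nil: "\<phi> \<in> carrier A \<Longrightarrow> \<phi> [] = []"
  using hom_one[OF _ group_free_group group_free_group, of \<phi> n n] by (simp add: carrier_A)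

lemma A_inj: "\<phi> \<in> carrier A \<Longrightarrow> u \<in> carrier F \<Longrightarrow> v \<in> carrier F \<Longrightarrow> \<phi> u = \<phi> v \<longleftrightarrow> u = v"
  by (auto simp: carrier_A bij_betw_def dest: inj_onD)

lemma A_eqI:
  assumes "\<phi> \<in> carrier A" "\<psi> \<in> carrier A" and "\<And>i. i < n \<Longrightarrow> \<phi> [(i, True)] = \<psi> [(i, True)]"
  shows "\<phi> = \<psi>"
proof
  fix w
  show "\<phi> w = \<psi> w"
  proof (cases "w \<in> carrier F")
    case True
    define f where "f i = \<psi> [(i, True)]" for i
    have f: "\<And>i. i < n \<Longrightarrow> f i \<in> carrier F" using assms A_closed by (simp add: f_def)
    have "\<phi> w = word_val F f w" "\<psi> w = word_val F f w"
      using assms True by (auto intro!: free_group_hom_unique[OF group_free_group f] simp: carrier_A f_def free_gen_def)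
    then show ?thesis by simp
  next
    case False
    then show ?thesis using assms by (simp add: carrier_A extensional_def)
  qed
qed

lemma A_letter_False: "\<phi> \<in> carrier A \<Longrightarrow> i < n \<Longrightarrow> \<phi> [(i, False)] = winv (\<phi> [(i, True)])"
  using A_winv[of \<phi> "[(i, True)]"] by (simp add: winv_def inv_letter_def)

lemma A_inv_letter: "\<phi> \<in> carrier A \<Longrightarrow> fst x < n \<Longrightarrow> \<phi> [inv_letter x] = winv (\<phi> [x])"
  using A_winv[of \<phi> "[x]"] by (simp add: winv_def)

lemma A_Cons:
  assumes "\<phi> \<in> carrier A" "x # w \<in> carrier F"
  shows "\<phi> (x # w) = word_mult (\<phi> [x]) (\<phi> w)"
  using A_word_mult[OF assms(1), of "[x]" w] Cons_carrier[OF assms(2)] by simp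

lemma A_fixes_word:
  assumes "\<phi> \<in> carrier A" "w \<in> carrier F" "\<And>i. i \<in> fst ` set w \<Longrightarrow> \<phi> [(i, True)] = [(i, True)]"
  shows "\<phi> w = w"
  using assms(2,3)
proof (induction w)
  case Nil
  then show ?case using A_Nil assms by blast
next
  case (Cons x w)
  note x = Cons_carrier[OF Cons.prems(1)]
  have "\<phi> [x] = [x]"
    using Cons.prems(2)[of "fst x"] A_letter_False[OF assms(1) x(1)]
    by (cases x; cases "snd x") (auto simp: winv_def inv_letter_def)
  moreover have "\<phi> w = w" using Cons x(2) by simp
  ultimately show ?case using A_Cons[OF assms(1) Cons.prems(1)] x(3) by metis
qed

definition sperm_aut :: "(nat \<Rightarrow> nat) \<Rightarrow> nat set \<Rightarrow> letter list \<Rightarrow> letter list"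
  where "sperm_aut \<pi> S = restrict (map (sperm \<pi> S)) (carrier F)"

text \<open>Injectivity is asked for on all natural numbers, so that \<open>sperm\<close> is
  injective on all letters and the lemmas on words need no bounds. Below \<open>n\<close>
  surjectivity follows by counting.\<close>

definition idx_perm :: "(nat \<Rightarrow> nat) \<Rightarrow> bool"
  where "idx_perm \<pi> \<longleftrightarrow> inj \<pi> \<and> (\<forall>i<n. \<pi> i < n)"

lemma sperm_aut_carrier:
  assumes "idx_perm \<pi>"
  shows "sperm_aut \<pi> S \<in> carrier A"
  unfolding carrier_A
proof (intro conjI)
  have inj: "inj \<pi>" and lt: "\<And>i. i < n \<Longrightarrow> \<pi> i < n" using assms by (auto simp: idx_perm_def)
  have cl: "map (sperm \<pi> S) w \<in> carrier F" if "w \<in> carrier F" for w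
    using that lt by (auto simp: carrier_F reduced_map_sperm[OF inj] sperm_def)
  show "sperm_aut \<pi> S \<in> hom F F"
    using mult_carrier by (intro homI) (auto simp: sperm_aut_def cl map_sperm_word_mult[OF inj])
  show "sperm_aut \<pi> S \<in> extensional (carrier F)" by (simp add: sperm_aut_def)
  have "\<pi> ` {..<n} = {..<n}"
    using lt inj by (intro endo_inj_surj) (auto intro: inj_on_subset)
  then have surj: "\<exists>i<n. \<pi> i = k" if "k < n" for k using that by (metis (no_types) imageE lessThan_iff)
  have "\<exists>v\<in>carrier F. map (sperm \<pi> S) v = w" if w: "w \<in> carrier F" for w
  proof -
    have "\<exists>y. fst y < n \<and> sperm \<pi> S y = x" if "x \<in> set w" for x
    proof -
      have "fst x < n" using w that by (auto simp: carrier_F)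
      then obtain i where i: "i < n" "\<pi> i = fst x" using surj by blast
      then show ?thesis
        by (intro exI[of _ "(i, if i \<in> S then \<not> snd x else snd x)"]) (auto simp: sperm_def prod_eq_iff)
    qed
    then have "\<forall>x. \<exists>y. x \<in> set w \<longrightarrow> fst y < n \<and> sperm \<pi> S y = x" by blast
    from choice[OF this] obtain q where q: "\<And>x. x \<in> set w \<Longrightarrow> fst (q x) < n \<and> sperm \<pi> S (q x) = x" by blast
    have "map (sperm \<pi> S) (map q w) = w" using q by (simp add: map_idI)
    moreover have "map q w \<in> carrier F"
      using q w calculation reduced_map_sperm[OF inj, of S "map q w"] by (auto simp: carrier_F)
    ultimately show ?thesis by blast
  qed
  then have "map (sperm \<pi> S) ` carrier F = carrier F" using cl by blast
  moreover have "inj_on (map (sperm \<pi> S)) (carrier F)"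
    using sperm_eq_iff[OF inj] by (intro inj_onI) (auto dest: map_injective simp: inj_def)
  ultimately show "bij_betw (sperm_aut \<pi> S) (carrier F) (carrier F)"
    by (simp add: sperm_aut_def bij_betw_def)
qed

lemma sperm_aut_letter [simp]: "fst x < n \<Longrightarrow> sperm_aut \<pi> S [x] = [sperm \<pi> S x]"
  by (simp add: sperm_aut_def)

lemma sperm_aut_word: "w \<in> carrier F \<Longrightarrow> sperm_aut \<pi> S w = map (sperm \<pi> S) w"
  by (simp add: sperm_aut_def)

lemma idx_perm_id [simp]: "idx_perm id" "idx_perm (\<lambda>x. x)"
  by (auto simp: idx_perm_def)

lemma idx_perm_swp: "i < n \<Longrightarrow> j < n \<Longrightarrow> idx_perm (swp i j)"
  unfolding idx_perm_def by (metis injI Transposition.transpose_def Transposition.transpose_involutory)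

definition flip :: "nat \<Rightarrow> letter list \<Rightarrow> letter list"
  where "flip i = sperm_aut id {i}"

definition swap :: "nat \<Rightarrow> nat \<Rightarrow> letter list \<Rightarrow> letter list"
  where "swap i j = sperm_aut (swp i j) {}"

lemma flip_carrier [simp]: "flip i \<in> carrier A"
  by (simp add: flip_def sperm_aut_carrier)

lemma swap_carrier: "i < n \<Longrightarrow> j < n \<Longrightarrow> swap i j \<in> carrier A"
  by (simp add: swap_def sperm_aut_carrier idx_perm_swp)

definition endo :: "(nat \<Rightarrow> letter list) \<Rightarrow> letter list \<Rightarrow> letter list"
  where "endo f = restrict (word_val F f) (carrier F)"

lemma endo_gen:
  assumes "\<And>i. i < n \<Longrightarrow> f i \<in> carrier F" "i < n"
  shows "endo f [(i, True)] = f i"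
  using word_val_gen[OF group_free_group assms(1) assms(2)] assms by (simp add: endo_def free_gen_def)

lemma endo_hom:
  assumes "\<And>i. i < n \<Longrightarrow> f i \<in> carrier F"
  shows "endo f \<in> hom F F"
proof -
  have h: "word_val F f \<in> hom F F" by (rule word_val_hom[OF group_free_group assms])
  show ?thesis
    using hom_mult[OF h] hom_in_carrier[OF h] mult_carrier by (intro homI) (auto simp: endo_def)
qed

text \<open>Invertibility can be tested on generators: both composites agree there with the
  identity, and a homomorphism on a free group is determined by these values.\<close>

lemma endo_carrier:
  assumes f: "\<And>i. i < n \<Longrightarrow> f i \<in> carrier F" and g: "\<And>i. i < n \<Longrightarrow> g i \<in> carrier F"
    and fg: "\<And>i. i < n \<Longrightarrow> endo f (g i) = [(i, True)]" "\<And>i. i < n \<Longrightarrow> endo g (f i) = [(i, True)]"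
  shows "endo f \<in> carrier A"
proof -
  have id: "endo f (endo g w) = w"
    if w: "w \<in> carrier F" and f: "\<And>i. i < n \<Longrightarrow> f i \<in> carrier F" and g: "\<And>i. i < n \<Longrightarrow> g i \<in> carrier F"
      and fg: "\<And>i. i < n \<Longrightarrow> endo f (g i) = [(i, True)]" for f g w
  proof -
    have hf: "endo f \<in> hom F F" and hg: "endo g \<in> hom F F" by (rule endo_hom; fact)+
    then have h1: "endo f \<circ> endo g \<in> hom F F" by (rule hom_compose[rotated])
    have h2: "id \<in> hom F F" by (auto intro!: homI mult_carrier)
    define e where "e i = [(i, True)]" for i :: nat
    have e: "\<And>i. i < n \<Longrightarrow> e i \<in> carrier F" by (simp add: e_def)
    have *: "(endo f \<circ> endo g) (free_gen i) = e i" if "i < n" for i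
      using endo_gen[OF g that] fg[OF that] by (simp add: free_gen_def e_def)
    have "(endo f \<circ> endo g) w = word_val F e w"
      by (rule free_group_hom_unique[OF group_free_group _ h1]) (use e * w in simp_all)
    moreover have "id w = word_val F e w"
      by (rule free_group_hom_unique[OF group_free_group _ h2])
        (use e w in \<open>simp_all add: free_gen_def e_def\<close>)
    ultimately show ?thesis by simp
  qed
  have hf: "endo f \<in> hom F F" and hg: "endo g \<in> hom F F" by (rule endo_hom; fact)+
  have "bij_betw (endo f) (carrier F) (carrier F)"
  proof (rule bij_betwI[where g = "endo g"])
    show "endo f \<in> carrier F \<rightarrow> carrier F" "endo g \<in> carrier F \<rightarrow> carrier F"
      using hf hg by (auto simp: hom_def)
    show "endo g (endo f w) = w" if "w \<in> carrier F" for w by (rule id[OF that g f fg(2)])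
    show "endo f (endo g w) = w" if "w \<in> carrier F" for w by (rule id[OF that f g fg(1)])
  qed
  then show ?thesis using hf by (simp add: carrier_A endo_def)
qed

text \<open>The Nielsen transvection that multiplies the letter \<open>b\<close> by \<open>a\<close>
  from the left. As \<open>b\<close> may be an inverse letter, multiplication of a generator from
  the right is included; this is why both signs are spelled out.\<close>

definition transv :: "letter \<Rightarrow> letter \<Rightarrow> letter list \<Rightarrow> letter list"
  where "transv a b = endo (\<lambda>i. if i = fst b then (if snd b then [a, b] else [inv_letter b, inv_letter a]) else [(i, True)])"

lemma transv:
  assumes a: "fst a < n" and b: "fst b < n" and ab: "fst a \<noteq> fst b"
  shows transv_carrier: "transv a b \<in> carrier A"
    and transv_self: "transv a b [b] = [a, b]"
    and transv_other: "fst x < n \<Longrightarrow> fst x \<noteq> fst b \<Longrightarrow> transv a b [x] = [x]"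
proof -
  define f where "f a i = (if i = fst b then (if snd b then [a, b] else [inv_letter b, inv_letter a]) else [(i, True)])"
    for a i
  have tf: "transv a b = endo (f a)" for a by (simp add: transv_def f_def[abs_def])
  have fc: "f a i \<in> carrier F" if "i < n" "fst a < n" "fst a \<noteq> fst b" for a i
    using that b by (auto simp: f_def carrier_F reduced_def)
  have val: "endo (f a) (f (inv_letter a) i) = [(i, True)]" if i: "i < n" and a: "fst a < n" "fst a \<noteq> fst b" for a i
  proof -
    have fi: "f (inv_letter a) i \<in> carrier F" using fc[OF i] a by simp
    have fa: "f a (fst a) = [(fst a, True)]" using a by (simp add: f_def)
    have inv: "inv\<^bsub>F\<^esub> f a j = winv (f a j)" if "j < n" for j using inv_F fc[OF that a] by blast
    have "endo (f a) (f (inv_letter a) i) = word_val F (f a) (f (inv_letter a) i)"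
      using fi by (simp add: endo_def)
    also have "\<dots> = [(i, True)]"
      using a b ab i inv[of "fst a"] inv[of "fst b"] fa
      by (cases a; cases b; cases "snd a"; cases "snd b")
        (auto simp: f_def word_val_def letter_val_def word_mult_def winv_def inv_letter_def inv_F)
    finally show ?thesis .
  qed
  show tc: "transv a b \<in> carrier A"
    unfolding tf using fc a ab val[of _ a] val[of _ "inv_letter a"]
    by (intro endo_carrier[of "f a" "f (inv_letter a)"]) auto
  have gen: "transv a b [(i, True)] = f a i" if "i < n" for i
    unfolding tf using fc a ab that by (intro endo_gen) auto
  show "transv a b [b] = [a, b]"
    using gen[OF b] A_letter_False[OF tc b] by (cases b; cases "snd b") (auto simp: f_def winv_def inv_letter_def)
  show "transv a b [x] = [x]" if "fst x < n" "fst x \<noteq> fst b" for x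
    using gen[OF that(1)] A_letter_False[OF tc that(1)] that(2) by (cases x; cases "snd x") (auto simp: f_def winv_def inv_letter_def)
qed

lemma transv_inv:
  assumes a: "fst a < n" and b: "fst b < n" and ab: "fst a \<noteq> fst b"
  shows "transv a b [inv_letter b] = [inv_letter b, inv_letter a]"
  using A_inv_letter[OF transv_carrier[OF assms] b] by (simp add: transv_self[OF assms] winv_def)

definition supported :: "(letter list \<Rightarrow> letter list) \<Rightarrow> nat set \<Rightarrow> bool"
  where "supported \<phi> L \<longleftrightarrow> \<phi> \<in> carrier A \<and>
    (\<forall>i<n. if i \<in> L then fst ` set (\<phi> [(i, True)]) \<subseteq> L else \<phi> [(i, True)] = [(i, True)])"

lemma supportedD:
  assumes "supported \<phi> L"
  shows "\<phi> \<in> carrier A" "i < n \<Longrightarrow> i \<notin> L \<Longrightarrow> \<phi> [(i, True)] = [(i, True)]"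
    "i < n \<Longrightarrow> i \<in> L \<Longrightarrow> fst ` set (\<phi> [(i, True)]) \<subseteq> L"
  using assms by (auto simp: supported_def)

lemma supported_word:
  assumes "supported \<phi> L" "w \<in> carrier F" "fst ` set w \<subseteq> L"
  shows "fst ` set (\<phi> w) \<subseteq> L"
  using assms(2,3)
proof (induction w)
  case Nil
  then show ?case using A_Nil[OF supportedD(1)[OF assms(1)]] by simp
next
  case (Cons x w)
  note x = Cons_carrier[OF Cons.prems(1)]
  have \<phi>: "\<phi> \<in> carrier A" using assms by (simp add: supported_def)
  have "fst ` set (\<phi> [(fst x, True)]) \<subseteq> L"
    using supportedD(3)[OF assms(1) x(1)] Cons.prems by simp
  then have "fst ` set (\<phi> [x]) \<subseteq> L"
    using A_letter_False[OF \<phi> x(1)] set_winv by (cases x; cases "snd x") auto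
  moreover have "fst ` set (\<phi> w) \<subseteq> L" using Cons.IH[OF x(2)] Cons.prems(2) by simp
  ultimately show ?case
    using set_word_mult[of "\<phi> [x]" "\<phi> w"] unfolding A_Cons[OF \<phi> Cons.prems(1)] by blast
qed

lemma supported_mono:
  assumes "supported \<phi> L" "L \<subseteq> L'"
  shows "supported \<phi> L'"
  unfolding supported_def
proof (intro conjI allI impI)
  fix i assume "i < n"
  then show "if i \<in> L' then fst ` set (\<phi> [(i, True)]) \<subseteq> L' else \<phi> [(i, True)] = [(i, True)]"
    using supportedD(2,3)[OF assms(1), of i] assms(2) by (cases "i \<in> L"; cases "i \<in> L'") auto
qed (rule supportedD(1)[OF assms(1)])

lemma supported_commute:
  assumes \<phi>: "supported \<phi> L" and \<psi>: "supported \<psi> L'" and disj: "L \<inter> L' = {}"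
  shows "\<phi> \<cdot> \<psi> = \<psi> \<cdot> \<phi>"
proof -
  have A: "\<phi> \<in> carrier A" "\<psi> \<in> carrier A" using assms by (auto simp: supported_def)
  have fix1: "\<psi> (\<phi> [(i, True)]) = \<phi> [(i, True)]"
    if "i < n" "i \<in> L" and \<phi>: "supported \<phi> L" and \<psi>: "supported \<psi> L'" and "L \<inter> L' = {}" for i \<phi> \<psi> L L'
  proof (rule A_fixes_word)
    show "\<psi> \<in> carrier A" "\<phi> [(i, True)] \<in> carrier F" using \<phi> \<psi> \<open>i < n\<close> by (auto simp: supported_def A_closed)
    have sub: "fst ` set (\<phi> [(i, True)]) \<subseteq> L" using \<phi> that by (auto simp: supported_def)
    moreover have "fst ` set (\<phi> [(i, True)]) \<subseteq> {..<n}"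
      using \<open>\<phi> [(i, True)] \<in> carrier F\<close> by (simp add: carrier_F)
    ultimately show "\<psi> [(j, True)] = [(j, True)]" if "j \<in> fst ` set (\<phi> [(i, True)])" for j
      using \<psi> that \<open>L \<inter> L' = {}\<close> unfolding supported_def by (metis disjoint_iff lessThan_iff subsetD)
  qed
  show ?thesis
  proof (rule A_eqI)
    fix i assume i: "i < n"
    have "\<phi> (\<psi> [(i, True)]) = \<psi> (\<phi> [(i, True)])"
    proof (cases "i \<in> L")
      case True
      then have "\<psi> [(i, True)] = [(i, True)]" using supportedD(2)[OF \<psi> i] disj by blast
      then show ?thesis using fix1[OF i True \<phi> \<psi> disj] by simp
    next
      case False
      then have f: "\<phi> [(i, True)] = [(i, True)]" using \<phi> i by (auto simp: supported_def)
      show ?thesis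
      proof (cases "i \<in> L'")
        case True
        then show ?thesis using f fix1[OF i True \<psi> \<phi>] disj by (simp add: Int_commute)
      next
        case False
        then have "\<psi> [(i, True)] = [(i, True)]" using \<psi> i by (auto simp: supported_def)
        then show ?thesis using f by simp
      qed
    qed
    then show "(\<phi> \<cdot> \<psi>) [(i, True)] = (\<psi> \<cdot> \<phi>) [(i, True)]"
      using A i by (simp add: apply_mult_A)
  qed (use A in auto)
qed

lemma supported_mult:
  assumes "supported \<phi> L" "supported \<psi> L"
  shows "supported (\<phi> \<cdot> \<psi>) L"
  unfolding supported_def
proof (intro conjI allI impI)
  have A: "\<phi> \<in> carrier A" "\<psi> \<in> carrier A" using assms by (auto simp: supported_def)
  then show "\<phi> \<cdot> \<psi> \<in> carrier A" by simp
  fix i assume i: "i < n"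
  then have c: "\<psi> [(i, True)] \<in> carrier F" using A A_closed by simp
  show "if i \<in> L then fst ` set ((\<phi> \<cdot> \<psi>) [(i, True)]) \<subseteq> L else (\<phi> \<cdot> \<psi>) [(i, True)] = [(i, True)]"
    using i A assms supported_word[OF assms(1) c] by (auto simp: apply_mult_A supported_def)
qed

lemma supported_sperm:
  assumes \<pi>: "idx_perm \<pi>" and "S \<subseteq> L" "\<And>i. i \<notin> L \<Longrightarrow> \<pi> i = i" "\<And>i. i \<in> L \<Longrightarrow> \<pi> i \<in> L"
  shows "supported (sperm_aut \<pi> S) L"
  using assms sperm_aut_carrier[OF \<pi>] by (auto simp: supported_def sperm_def)

lemma supported_transv:
  assumes a: "fst a < n" and b: "fst b < n" and ab: "fst a \<noteq> fst b" and L: "fst a \<in> L" "fst b \<in> L"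
  shows "supported (transv a b) L"
  unfolding supported_def
proof (intro conjI allI impI)
  fix i assume i: "i < n"
  show "if i \<in> L then fst ` set (transv a b [(i, True)]) \<subseteq> L else transv a b [(i, True)] = [(i, True)]"
  proof (cases "i = fst b")
    case True
    then have iL: "i \<in> L" using L by simp
    consider "(i, True) = b" | "(i, True) = inv_letter b" using True by (cases b) (auto simp: inv_letter_def)
    then show ?thesis
    proof cases
      case 1
      have "transv a b [(i, True)] = [a, b]" unfolding 1 by (rule transv_self[OF a b ab])
      then show ?thesis using iL L by simp
    next
      case 2
      have "transv a b [(i, True)] = [inv_letter b, inv_letter a]" unfolding 2 by (rule transv_inv[OF a b ab])
      then show ?thesis using iL L by simp
    qed
  next
    case False
    then show ?thesis using transv_other[OF a b ab, of "(i, True)"] i by simp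
  qed
qed (rule transv_carrier[OF a b ab])

lemma conj_apply:
  assumes g: "g \<in> carrier A" and A: "\<phi> \<in> carrier A" and w: "w \<in> carrier F"
  shows "(g \<cdot> \<phi> \<cdot> inv\<^bsub>A\<^esub> g) (g w) = g (\<phi> w)"
proof -
  define c where "c = g \<cdot> \<phi> \<cdot> inv\<^bsub>A\<^esub> g"
  have c: "c \<in> carrier A" using g A by (simp add: c_def)
  have "c \<cdot> g = g \<cdot> \<phi>"
    using g A by (simp add: c_def A.m_assoc)
  then have "c (g w) = g (\<phi> w)"
    using apply_mult_A[OF c g w] apply_mult_A[OF g A w] by metis
  then show ?thesis by (simp only: c_def)
qed

lemma supported_conj:
  assumes \<phi>: "supported \<phi> L" and \<pi>: "idx_perm \<pi>"
  shows "supported (sperm_aut \<pi> S \<cdot> \<phi> \<cdot> inv\<^bsub>A\<^esub> (sperm_aut \<pi> S)) (\<pi> ` L)"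
proof -
  define g where "g = sperm_aut \<pi> S"
  have g: "g \<in> carrier A" using sperm_aut_carrier[OF \<pi>] by (simp add: g_def)
  have A: "\<phi> \<in> carrier A" using \<phi> by (rule supportedD)
  define c where "c = g \<cdot> \<phi> \<cdot> inv\<^bsub>A\<^esub> g"
  have c: "c \<in> carrier A" using g A by (simp add: c_def)
  have inj: "inj \<pi>" and lt: "\<And>i. i < n \<Longrightarrow> \<pi> i < n" using \<pi> by (auto simp: idx_perm_def)
  have onto: "\<pi> ` {..<n} = {..<n}" using lt inj by (intro endo_inj_surj) (auto intro: inj_on_subset)
  have "supported c (\<pi> ` L)"
    unfolding supported_def
  proof (intro conjI allI impI)
    show "c \<in> carrier A" by (rule c)
    fix i assume "i < n"
    then have "i \<in> \<pi> ` {..<n}" using onto by simp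
    then obtain j where j: "j < n" "i = \<pi> j" by blast
    define s where "s = (j \<notin> S)"
    have js: "[(j, s)] \<in> carrier F" using j by simp
    have gj: "g [(j, s)] = [(i, True)]" using j by (simp add: g_def sperm_def s_def)
    have "c (g [(j, s)]) = g (\<phi> [(j, s)])" unfolding c_def by (rule conj_apply[OF g A js])
    also have "\<dots> = map (sperm \<pi> S) (\<phi> [(j, s)])"
      unfolding g_def by (rule sperm_aut_word[OF A_closed[OF A js]])
    finally have val: "c [(i, True)] = map (sperm \<pi> S) (\<phi> [(j, s)])" by (simp only: gj)
    have iL: "i \<in> \<pi> ` L \<longleftrightarrow> j \<in> L" using j inj by (simp add: inj_image_mem_iff)
    show "if i \<in> \<pi> ` L then fst ` set (c [(i, True)]) \<subseteq> \<pi> ` L else c [(i, True)] = [(i, True)]"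
    proof (cases "j \<in> L")
      case True
      then have "fst ` set (\<phi> [(j, s)]) \<subseteq> L" using supported_word[OF \<phi> js] by simp
      moreover have "fst ` set (map (sperm \<pi> S) w) = \<pi> ` fst ` set w" for w
        by (simp add: image_image sperm_def)
      ultimately show ?thesis using True iL val by (metis image_mono)
    next
      case False
      have \<phi>j: "\<phi> [(j, s)] = [(j, s)]"
        by (rule A_fixes_word[OF A js]) (use supportedD(2)[OF \<phi> j(1) False] in simp)
      have "g [(j, s)] = map (sperm \<pi> S) [(j, s)]"
        unfolding g_def by (rule sperm_aut_word[OF js])
      then have "c [(i, True)] = [(i, True)]" unfolding val \<phi>j by (simp only: gj)
      then show ?thesis using False iL by simp
    qed
  qed
  then show ?thesis by (simp only: c_def g_def)
qed

end

section \<open>Cancellation in products of reduced words\<close>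

section \<open>Nielsen reduction\<close>

text \<open>For reduced words, \<open>lcp (winv u) v\<close> is the number of letters that cancel
  from each factor of the product of \<open>u\<close> and \<open>v\<close>.\<close>

fun lcp :: "'b list \<Rightarrow> 'b list \<Rightarrow> nat" where
  "lcp (x # xs) (y # ys) = (if x = y then Suc (lcp xs ys) else 0)"
| "lcp _ _ = 0"

lemma le_lcp_iff: "k \<le> lcp u v \<longleftrightarrow> k \<le> length u \<and> k \<le> length v \<and> take k u = take k v"
proof (induction u v arbitrary: k rule: lcp.induct)
  case (1 x xs y ys)
  then show ?case by (cases k) auto
qed auto

lemma lcp_le: "lcp u v \<le> length u" "lcp u v \<le> length v" "take (lcp u v) u = take (lcp u v) v"
  using le_lcp_iff[of "lcp u v" u v] by auto

lemma lcp_commute: "lcp u v = lcp v u"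
  by (induction u v rule: lcp.induct) auto

lemma lcp_same [simp]: "lcp u u = length u"
  by (induction u) auto

lemma lcp_append: "lcp (u @ v) (u @ w) = length u + lcp v w"
  by (induction u) auto

text \<open>Words are branches of a tree: if \<open>u\<close> leaves \<open>v\<close> later than
  \<open>w\<close> does, then \<open>u\<close> and \<open>w\<close> part where \<open>v\<close> and
  \<open>w\<close> part.\<close>

lemma lcp_ultrametric:
  assumes "lcp v w < lcp u v"
  shows "lcp u w = lcp v w"
proof (rule antisym)
  have "take (lcp v w) u = take (lcp v w) w"
    using le_lcp_iff[of "lcp v w" u v] assms lcp_le(3)[of v w] by simp
  then show "lcp v w \<le> lcp u w"
    using lcp_le[of v w] lcp_le(1)[of u v] assms by (simp add: le_lcp_iff)
  show "lcp u w \<le> lcp v w"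
  proof (rule ccontr)
    assume "\<not> ?thesis"
    then have "Suc (lcp v w) \<le> lcp u w" "Suc (lcp v w) \<le> lcp u v" using assms by simp_all
    then have "Suc (lcp v w) \<le> lcp v w" unfolding le_lcp_iff by metis
    then show False by simp
  qed
qed

lemma length_winv [simp]: "length (winv w) = length w"
  by (simp add: winv_def)

lemma winv_append: "winv (u @ v) = winv v @ winv u"
  by (simp add: winv_def)

lemma word_mult_append: "word_mult (u @ v) w = word_mult u (word_mult v w)"
  by (simp add: word_mult_def)

lemma word_mult_cancellation:
  assumes u: "reduced u" and v: "reduced v"
  shows "word_mult u v = take (length u - lcp (winv u) v) u @ drop (lcp (winv u) v) v"
proof -
  define c where "c = lcp (winv u) v"
  define p where "p = take c v"
  define a where "a = drop c (winv u)"
  define b where "b = drop c v"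
  have wu: "winv u = p @ a" unfolding p_def a_def c_def lcp_le(3)[of "winv u" v, symmetric] by simp
  have vb: "v = p @ b" by (simp add: p_def b_def)
  have len: "length p = c" using lcp_le(2)[of "winv u" v] by (simp add: p_def c_def)
  have uu: "u = winv a @ winv p" using arg_cong[OF wu, of winv] by (simp add: winv_append)
  have "lcp a b = 0" using lcp_append[of p a b] wu vb len by (simp add: c_def)
  then have ab: "a \<noteq> [] \<Longrightarrow> b \<noteq> [] \<Longrightarrow> hd a \<noteq> hd b" by (cases a; cases b) auto
  have ra: "reduced (winv a)" and rb: "reduced b" using u v unfolding uu vb by (auto simp: reduced_append_iff)
  have "inv_letter (last (winv a)) = hd a" if "a \<noteq> []"
    using that by (simp add: winv_def last_rev hd_map)
  then have red: "reduced (winv a @ b)"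
    using ra rb ab by (auto simp: reduced_append_iff winv_def)
  have "word_mult u v = word_mult (winv a) (word_mult (winv p) (word_mult p b))"
    using v unfolding uu vb word_mult_append by (simp add: word_mult_reduced)
  also have "\<dots> = winv a @ b"
    using word_mult_inverse[OF rb, of p] word_mult_reduced[OF red] by (simp add: winv_def)
  finally have "word_mult u v = winv a @ b" .
  moreover have "take (length u - c) u = winv a" unfolding uu using len by simp
  ultimately show ?thesis unfolding c_def[symmetric] b_def by simp
qed

lemma length_word_mult:
  assumes "reduced u" "reduced v"
  shows "length (word_mult u v) + 2 * lcp (winv u) v = length u + length v"
  using word_mult_cancellation[OF assms] lcp_le(1,2)[of "winv u" v] by simp

text \<open>In a word equal to its inverse, the two middle letters would be inverse to each other,
  or the single middle letter would be its own inverse.\<close>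

lemma winv_neq_self:
  assumes w: "reduced w" "w \<noteq> []"
  shows "winv w \<noteq> w"
proof
  assume eq: "winv w = w"
  have nth: "w ! i = inv_letter (w ! (length w - 1 - i))" if "i < length w" for i
  proof -
    have "winv w ! i = inv_letter (w ! (length w - 1 - i))"
      using that by (simp add: winv_def rev_nth)
    then show ?thesis using eq by simp
  qed
  define i where "i = length w div 2"
  show False
  proof (cases "even (length w)")
    case True
    then obtain l where l: "length w = 2 * l" by (elim evenE)
    have "l \<noteq> 0" using l w(2) by (metis length_0_conv mult_0_right)
    then have i: "0 < i" "i < length w" "length w - 1 - i = i - 1" using l by (auto simp: i_def)
    have "w ! i \<noteq> inv_letter (w ! (i - 1))"
      using w(1) i successively_conv_nth[of "\<lambda>x y. y \<noteq> inv_letter x" w]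
      by (simp add: reduced_def) (metis Suc_pred)
    then show False using nth[OF i(2)] i(3) by simp
  next
    case False
    then have "i < length w" "length w - 1 - i = i" using w by (auto simp: i_def elim!: oddE)
    then show False using nth[of i] by (metis inv_letter_simps(2))
  qed
qed

text \<open>If more than half of \<open>v\<close> cancelled in its square, the cancelled suffix and
  the cancelled prefix would overlap in a nonempty word equal to its own inverse.\<close>

lemma lcp_winv_self:
  assumes "reduced v"
  shows "2 * lcp (winv v) v \<le> length v"
proof (rule ccontr)
  assume "\<not> ?thesis"
  define c where "c = lcp (winv v) v"
  have c: "length v < 2 * c" "c \<le> length v" using \<open>\<not> _\<close> lcp_le(2)[of "winv v" v] by (auto simp: c_def)
  define l where "l = length v - c"
  define w where "w = drop l (take c v)"
  have "take c v = take l v @ w"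
  proof -
    have "l \<le> c" using c by (simp add: l_def)
    then have "take l (take c v) = take l v" by (simp add: min_def)
    then show ?thesis unfolding w_def by (metis append_take_drop_id)
  qed
  then have v1: "v = take l v @ w @ drop c v"
    by (metis append_assoc append_take_drop_id)
  have "take c (winv v) = take c v" using lcp_le(3)[of "winv v" v] by (simp add: c_def)
  moreover have "winv v = winv (drop c v) @ winv w @ winv (take l v)"
    using arg_cong[OF v1, of winv] by (simp add: winv_append)
  moreover have "length (winv (drop c v)) = l" "length (winv w) = c - l" using c by (auto simp: l_def w_def)
  ultimately have "take c (winv (drop c v) @ winv w @ winv (take l v)) = take c (take l v @ w @ drop c v)"
    using v1 by simp
  then have "winv (drop c v) @ winv w = take l v @ w"
    using c by (simp add: l_def w_def)
  then have "winv w = w" using c by (simp add: l_def)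
  moreover have "w \<noteq> []" using c by (simp add: w_def l_def)
  moreover have "reduced w" using assms v1 by (metis reduced_append_iff)
  ultimately show False using winv_neq_self by blast
qed

section \<open>Nielsen descent\<close>

context aut_free
begin

text \<open>The word read as a number in base \<open>2 * n\<close>, so that words of equal length
  are compared lexicographically.\<close>

definition code :: "letter list \<Rightarrow> nat"
  where "code = foldl (\<lambda>a x. a * (2 * n) + (2 * fst x + (if snd x then 1 else 0))) 0"

lemma code_append: "code (u @ v) = code u * (2 * n) ^ length v + code v"
proof (induction v rule: rev_induct)
  case (snoc x v)
  have "code (u @ v @ [x]) = code (u @ v) * (2 * n) + (2 * fst x + (if snd x then 1 else 0))"
    and "code (v @ [x]) = code v * (2 * n) + (2 * fst x + (if snd x then 1 else 0))"
    by (simp_all add: code_def)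
  then show ?case using snoc by (simp add: algebra_simps)
qed (simp add: code_def)

lemma code_inject:
  assumes "length u = length v" "fst ` set u \<subseteq> {..<n}" "fst ` set v \<subseteq> {..<n}" "code u = code v"
  shows "u = v"
  using assms
proof (induction u arbitrary: v rule: rev_induct)
  case (snoc x u)
  then obtain y w where v: "v = w @ [y]" by (cases v rule: rev_cases) auto
  define e where "e x = 2 * fst x + (if snd x then 1 else 0)" for x :: letter
  have c: "code (u @ [x]) = code u * (2 * n) + e x" "code (w @ [y]) = code w * (2 * n) + e y"
    by (simp_all add: code_def e_def)
  have lt: "e x < 2 * n" "e y < 2 * n" using snoc.prems by (auto simp: v e_def)
  have eq: "code u * (2 * n) + e x = code w * (2 * n) + e y" using snoc.prems c by (simp add: v)
  have "(code u * (2 * n) + e x) div (2 * n) = code u" "(code w * (2 * n) + e y) div (2 * n) = code w"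
    using lt by simp_all
  then have "code u = code w" using eq by simp
  then have "e x = e y" using eq by simp
  then have "x = y" by (cases x; cases y) (auto simp: e_def split: if_splits; presburger)
  moreover have "u = w" using snoc.IH[of w] snoc.prems \<open>code u = code w\<close> by (auto simp: v)
  ultimately show ?case by (simp add: v)
qed auto

text \<open>Nielsen's tie-breaker between words of the same length, which compares initial halves.\<close>

definition half_code :: "letter list \<Rightarrow> nat"
  where "half_code w = code (take ((length w + 1) div 2) w) + code (take ((length w + 1) div 2) (winv w))"

lemma half_code_winv: "half_code (winv w) = half_code w"
  by (simp add: half_code_def)

text \<open>The local minima of the descent in \<open>nielsen_generation\<close>: composing with a
  transvection on the right replaces the image of \<open>b\<close> by the product that occurs
  here.\<close>

definition irreducible_aut :: "(letter list \<Rightarrow> letter list) \<Rightarrow> bool"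
  where "irreducible_aut \<phi> \<longleftrightarrow> (\<forall>a b. fst a < n \<longrightarrow> fst b < n \<longrightarrow> fst a \<noteq> fst b \<longrightarrow>
    length (\<phi> [b]) \<le> length (word_mult (\<phi> [a]) (\<phi> [b])) \<and>
    (length (word_mult (\<phi> [a]) (\<phi> [b])) = length (\<phi> [b]) \<longrightarrow>
      half_code (\<phi> [b]) \<le> half_code (word_mult (\<phi> [a]) (\<phi> [b]))))"

lemma irreducible_autD:
  assumes "irreducible_aut \<phi>" "fst a < n" "fst b < n" "fst a \<noteq> fst b"
  shows "length (\<phi> [b]) \<le> length (word_mult (\<phi> [a]) (\<phi> [b]))"
    and "length (word_mult (\<phi> [a]) (\<phi> [b])) = length (\<phi> [b]) \<Longrightarrow>
      half_code (\<phi> [b]) \<le> half_code (word_mult (\<phi> [a]) (\<phi> [b]))"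
  using assms unfolding irreducible_aut_def by blast+

context
  fixes \<phi> :: "letter list \<Rightarrow> letter list"
  assumes \<phi>: "\<phi> \<in> carrier A"
begin

definition cancel :: "letter \<Rightarrow> letter \<Rightarrow> nat"
  where "cancel x y = lcp (\<phi> [inv_letter x]) (\<phi> [y])"

lemma red: "w \<in> carrier F \<Longrightarrow> reduced (\<phi> w)"
  using A_closed[OF \<phi>] carrier_F by blast

lemma cancel_winv: "fst x < n \<Longrightarrow> cancel x y = lcp (winv (\<phi> [x])) (\<phi> [y])"
  using A_inv_letter[OF \<phi>] by (simp add: cancel_def)

lemma cancel_inv: "cancel (inv_letter y) (inv_letter x) = cancel x y"
  by (simp add: cancel_def lcp_commute)

lemma length_inv: "fst x < n \<Longrightarrow> length (\<phi> [inv_letter x]) = length (\<phi> [x])"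
  using A_inv_letter[OF \<phi>] by simp

lemma nonempty_image: "fst x < n \<Longrightarrow> \<phi> [x] \<noteq> []"
  using A_inj[OF \<phi>, of "[x]" "[]"] A_Nil[OF \<phi>] F.one_closed by simp

text \<open>For letters of different index, cancelling more than half of \<open>\<phi> [x]\<close>
  would make the product shorter than \<open>\<phi> [y]\<close>; for \<open>y = x\<close> the reason
  is \<open>lcp_winv_self\<close>.\<close>

lemma cancel_half:
  assumes irr: "irreducible_aut \<phi>" and x: "fst x < n" and y: "fst y < n" and xy: "y \<noteq> inv_letter x"
  shows "2 * cancel x y \<le> length (\<phi> [x])"
proof (cases "fst x = fst y")
  case True
  then have "y = x" using xy by (cases x; cases y) (auto simp: inv_letter_def)
  then show ?thesis using lcp_winv_self[OF red, of "[x]"] x by (simp add: cancel_winv)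
next
  case False
  then have "length (\<phi> [y]) \<le> length (word_mult (\<phi> [x]) (\<phi> [y]))"
    by (rule irreducible_autD(1)[OF irr x y])
  moreover have "length (word_mult (\<phi> [x]) (\<phi> [y])) + 2 * cancel x y = length (\<phi> [x]) + length (\<phi> [y])"
    using length_word_mult[OF red red, of "[x]" "[y]"] x y by (simp add: cancel_winv)
  ultimately show ?thesis by linarith
qed

text \<open>Here \<open>\<phi> [y]\<close> is \<open>p\<close> followed by the inverse of
  \<open>q\<close>, and \<open>\<phi> [z]\<close> is \<open>q\<close> followed by \<open>r\<close>.
  The product, \<open>p\<close> followed by \<open>r\<close>, has the same length as
  \<open>\<phi> [z]\<close>, so the tie-breaker forbids that \<open>p\<close> precedes
  \<open>q\<close>.\<close>

lemma half_cancellation_order: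
  assumes irr: "irreducible_aut \<phi>" and y: "fst y < n" and z: "fst z < n" and yz: "z \<noteq> inv_letter y"
    and h: "cancel y z = h" "length (\<phi> [y]) = 2 * h" "2 * h \<le> length (\<phi> [z])"
  shows "code (take h (\<phi> [inv_letter y])) \<le> code (take h (\<phi> [y]))"
proof (rule ccontr)
  define p q where "p = take h (\<phi> [y])" and "q = take h (\<phi> [inv_letter y])"
  assume "\<not> ?thesis"
  then have pq: "code p < code q" by (simp add: p_def q_def)
  have qz: "q = take h (\<phi> [z])"
    using lcp_le(3)[of "\<phi> [inv_letter y]" "\<phi> [z]"] h by (simp add: q_def cancel_def)
  have "fst y \<noteq> fst z"
  proof
    assume "fst y = fst z"
    then have "z = y" using yz by (cases z; cases y) (auto simp: inv_letter_def)
    then show False using pq qz by (simp add: p_def)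
  qed
  define r where "r = drop h (\<phi> [z])"
  have prod: "word_mult (\<phi> [y]) (\<phi> [z]) = p @ r"
    using word_mult_cancellation[OF red red, of "[y]" "[z]"] y z h by (simp add: cancel_winv p_def r_def)
  have zq: "\<phi> [z] = q @ r" by (simp add: qz r_def)
  have len: "length p = h" "length q = h" using h length_inv[OF y] by (auto simp: p_def q_def)
  define m where "m = (length (\<phi> [z]) + 1) div 2"
  \<comment> \<open>The initial half contains the whole exchanged prefix, and the initial half of
    the inverse word stays inside the inverse of \<open>r\<close>. So only one summand of
    \<open>half_code\<close> changes.\<close>
  have m: "h \<le> m" "m \<le> length r" using h len by (auto simp: m_def zq)
  have "length (word_mult (\<phi> [y]) (\<phi> [z])) = length (\<phi> [z])" unfolding prod unfolding zq by (simp add: len)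
  from irreducible_autD(2)[OF irr y z \<open>fst y \<noteq> fst z\<close> this]
  have "half_code (q @ r) \<le> half_code (p @ r)" unfolding prod unfolding zq .
  moreover have "half_code (p @ r) < half_code (q @ r)"
  proof -
    have hc: "half_code (u @ r) = code (u @ take (m - h) r) + code (take m (winv r))" if "length u = h" for u
    proof -
      have "(length (u @ r) + 1) div 2 = m" using that len by (simp add: m_def zq)
      then show ?thesis using m that by (simp add: half_code_def winv_append)
    qed
    have "code p * (2 * n) ^ length (take (m - h) r) < code q * (2 * n) ^ length (take (m - h) r)"
      using pq y by simp
    then show ?thesis using len by (simp add: hc code_append)
  qed
  ultimately show False by simp
qed

text \<open>By \<open>cancel_half\<close> the image of \<open>y\<close> can only be used up if each
  neighbour cancels exactly half of it. Then \<open>half_cancellation_order\<close>, applied from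
  both sides, makes the initial halves of \<open>\<phi> [y]\<close> and of its inverse equal, and
  \<open>\<phi> [y]\<close> would be its own inverse.\<close>

lemma nielsen_reduced:
  assumes irr: "irreducible_aut \<phi>" and x: "fst x < n" and y: "fst y < n" and z: "fst z < n"
    and xy: "y \<noteq> inv_letter x" and yz: "z \<noteq> inv_letter y"
  shows "cancel x y + cancel y z < length (\<phi> [y])"
proof (rule ccontr)
  assume big: "\<not> ?thesis"
  have xy': "inv_letter x \<noteq> inv_letter (inv_letter y)" "y \<noteq> inv_letter x" and yz': "inv_letter y \<noteq> inv_letter (inv_letter z)"
    using xy yz by (metis inv_letter_simps(1))+
  have i: "fst (inv_letter x) < n" "fst (inv_letter y) < n" "fst (inv_letter z) < n" using x y z by auto
  have "2 * cancel x y \<le> length (\<phi> [y])"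
    using cancel_half[OF irr i(2,1) xy'(1)] cancel_inv[of y x] length_inv[OF y] by simp
  moreover have "2 * cancel y z \<le> length (\<phi> [y])" using cancel_half[OF irr y z yz] .
  ultimately have "cancel x y = cancel y z" "length (\<phi> [y]) = 2 * cancel y z" using big by linarith+
  then obtain h where h: "cancel x y = h" "cancel y z = h" "length (\<phi> [y]) = 2 * h" by blast
  have hx: "2 * h \<le> length (\<phi> [inv_letter x])" "2 * h \<le> length (\<phi> [z])"
    using cancel_half[OF irr x y xy] h(1) length_inv[OF x]
      cancel_half[OF irr i(3,2) yz'] cancel_inv[of z y] h(2) length_inv[OF z] by simp_all
  have "code (take h (\<phi> [inv_letter y])) \<le> code (take h (\<phi> [y]))"
    by (rule half_cancellation_order[OF irr y z yz h(2,3) hx(2)])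
  moreover have "code (take h (\<phi> [inv_letter (inv_letter y)])) \<le> code (take h (\<phi> [inv_letter y]))"
    using half_cancellation_order[OF irr i(2,1) xy'(1) _ _ hx(1)] h cancel_inv[of y x] length_inv[OF y] by simp
  ultimately have ceq: "code (take h (\<phi> [y])) = code (take h (\<phi> [inv_letter y]))" by simp
  have cF: "\<phi> [y] \<in> carrier F" "\<phi> [inv_letter y] \<in> carrier F" using A_closed[OF \<phi>] y by auto
  have "take h (\<phi> [y]) = take h (\<phi> [inv_letter y])"
  proof (rule code_inject[OF _ _ _ ceq])
    show "fst ` set (take h (\<phi> [y])) \<subseteq> {..<n}" "fst ` set (take h (\<phi> [inv_letter y])) \<subseteq> {..<n}"
      using cF set_take_subset unfolding carrier_F by (meson image_mono order_trans)+
    show "length (take h (\<phi> [y])) = length (take h (\<phi> [inv_letter y]))" using length_inv[OF y] by simp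
  qed
  then have "h \<le> lcp (winv (\<phi> [y])) (\<phi> [y])"
    using h A_inv_letter[OF \<phi> y] by (simp add: le_lcp_iff)
  then have "take (2 * h - h) (\<phi> [y]) = take h (winv (\<phi> [y]))"
    using lcp_le(3) by (simp add: le_lcp_iff)
  moreover have "drop h (\<phi> [y]) = winv (take h (winv (\<phi> [y])))"
    using h by (simp add: winv_def take_rev take_map rev_map map_idI comp_def drop_map)
  ultimately have "winv (\<phi> [y]) = \<phi> [y]"
    by (metis append_take_drop_id add_diff_cancel_left' mult_2 winv_append winv_winv)
  then show False using winv_neq_self[OF red nonempty_image] y by simp
qed

text \<open>The second conjunct carries the induction: the image still ends in more letters of
  \<open>\<phi> [x]\<close> than \<open>\<phi> [y]\<close> can cancel, so by
  \<open>lcp_ultrametric\<close> appending \<open>y\<close> cancels exactly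
  \<open>cancel x y\<close> letters. The summand \<open>cancel x y\<close> in the first conjunct
  pays for this loss in advance.\<close>

lemma nielsen_length_aux:
  assumes irr: "irreducible_aut \<phi>"
  shows "w @ [x] \<in> carrier F \<Longrightarrow> fst y < n \<Longrightarrow> y \<noteq> inv_letter x \<Longrightarrow>
    length (w @ [x]) + cancel x y \<le> length (\<phi> (w @ [x])) \<and>
    cancel x y < lcp (winv (\<phi> (w @ [x]))) (\<phi> [inv_letter x])"
proof (induction w arbitrary: x y rule: rev_induct)
  case Nil
  then have x: "fst x < n" by simp
  have "cancel x x + cancel x y < length (\<phi> [x])"
    using nielsen_reduced[OF irr x x Nil(2) _ Nil(3)] by simp
  then show ?case using A_inv_letter[OF \<phi> x] by simp
next
  case (snoc z w x y)
  have wF: "w @ [z] \<in> carrier F" and x: "fst x < n" and xz: "x \<noteq> inv_letter z" and z: "fst z < n"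
    using snoc.prems(1) by (auto simp: carrier_F reduced_append_iff reduced_Cons)
  define c where "c = cancel z x"
  let ?u = "\<phi> (w @ [z])"
  have IH: "length (w @ [z]) + c \<le> length ?u" "c < lcp (winv ?u) (\<phi> [inv_letter z])"
    using snoc.IH[OF wF x xz] by (auto simp: c_def)
  have lc: "lcp (winv ?u) (\<phi> [x]) = c"
    using lcp_ultrametric[of "\<phi> [inv_letter z]" "\<phi> [x]" "winv ?u"] IH(2) by (simp add: c_def cancel_def)
  have xF: "[x] \<in> carrier F" using x by simp
  have "(w @ [z]) @ [x] = word_mult (w @ [z]) [x]"
    using word_mult_reduced[of "w @ [z]" "[x]"] snoc.prems(1) by (simp add: carrier_F)
  then have val: "\<phi> ((w @ [z]) @ [x]) = word_mult ?u (\<phi> [x])"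
    using A_word_mult[OF \<phi> wF xF] by simp
  have N: "c + cancel x y < length (\<phi> [x])"
    using nielsen_reduced[OF irr z x snoc.prems(2) xz snoc.prems(3)] by (simp add: c_def)
  have len: "length (word_mult ?u (\<phi> [x])) + 2 * c = length ?u + length (\<phi> [x])"
    using length_word_mult[OF red[OF wF] red[OF xF]] lc by simp
  have "word_mult ?u (\<phi> [x]) = take (length ?u - c) ?u @ drop c (\<phi> [x])"
    using word_mult_cancellation[OF red[OF wF] red[OF xF]] lc by simp
  then have w1: "winv (word_mult ?u (\<phi> [x])) = winv (drop c (\<phi> [x])) @ winv (take (length ?u - c) ?u)"
    by (simp add: winv_append)
  have "\<phi> [inv_letter x] = winv (take c (\<phi> [x]) @ drop c (\<phi> [x]))"
    using A_inv_letter[OF \<phi> x] by simp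
  then have w2: "\<phi> [inv_letter x] = winv (drop c (\<phi> [x])) @ winv (take c (\<phi> [x]))"
    unfolding winv_append .
  have "length (\<phi> [x]) - c \<le> lcp (winv (word_mult ?u (\<phi> [x]))) (\<phi> [inv_letter x])"
    unfolding w1 w2 lcp_append by simp
  then show ?case unfolding val using N IH(1) len by simp
qed

lemma nielsen_length:
  assumes irr: "irreducible_aut \<phi>" and w: "w \<in> carrier F"
  shows "length w \<le> length (\<phi> w)"
proof (cases w rule: rev_cases)
  case (snoc v x)
  then have "fst x < n" using w by (auto simp: carrier_F)
  then show ?thesis using nielsen_length_aux[OF irr, of v x x] w snoc by simp
qed simp

end

text \<open>An irreducible automorphism does not shorten words, so its inverse must send each
  generator to a word of length 1.\<close>

lemma irreducible_aut_sperm: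
  assumes \<phi>: "\<phi> \<in> carrier A" and irr: "irreducible_aut \<phi>"
  shows "\<exists>\<pi> S. idx_perm \<pi> \<and> inv\<^bsub>A\<^esub> \<phi> = sperm_aut \<pi> S"
proof -
  define \<psi> where "\<psi> = inv\<^bsub>A\<^esub> \<phi>"
  have \<psi>: "\<psi> \<in> carrier A" using \<phi> by (simp add: \<psi>_def)
  have \<phi>\<psi>: "\<phi> (\<psi> w) = w" if "w \<in> carrier F" for w
    using apply_mult_A[OF \<phi> \<psi> that] \<phi> that by (simp add: \<psi>_def one_A)
  have "\<exists>y. \<psi> [(i, True)] = [y]" if i: "i < n" for i
  proof -
    have g: "[(i, True)] \<in> carrier F" using i by simp
    have "length (\<psi> [(i, True)]) \<le> 1"
      using nielsen_length[OF \<phi> irr A_closed[OF \<psi> g]] \<phi>\<psi>[OF g] by simp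
    moreover have "\<psi> [(i, True)] \<noteq> []" using nonempty_image[OF \<psi>] i by simp
    ultimately show ?thesis by (cases "\<psi> [(i, True)]") auto
  qed
  then have "\<forall>i. \<exists>y. i < n \<longrightarrow> \<psi> [(i, True)] = [y]" by blast
  from choice[OF this] obtain f where f: "\<And>i. i < n \<Longrightarrow> \<psi> [(i, True)] = [f i]" by blast
  define \<pi> where "\<pi> i = (if i < n then fst (f i) else i)" for i
  have lt: "\<pi> i < n" if "i < n" for i
    using A_closed[OF \<psi>, of "[(i, True)]"] f[OF that] that by (simp add: \<pi>_def)
  have inj: "i = j" if ij: "i < n" "j < n" and eq: "\<pi> i = \<pi> j" for i j
  proof -
    have "\<psi> [(i, True)] = \<psi> [(j, True)] \<or> \<psi> [(i, True)] = \<psi> [(j, False)]"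
      using f[OF ij(1)] f[OF ij(2)] eq ij A_letter_False[OF \<psi> ij(2)]
      by (cases "f i"; cases "f j") (auto simp: \<pi>_def winv_def inv_letter_def)
    then show ?thesis using A_inj[OF \<psi>, of "[(i, True)]"] ij by auto
  qed
  have "idx_perm \<pi>"
    unfolding idx_perm_def
  proof (intro conjI allI impI injI)
    fix i j assume eq: "\<pi> i = \<pi> j"
    show "i = j"
    proof (cases "i < n"; cases "j < n")
      assume "i < n" "j < n"
      then show ?thesis using inj eq by blast
    next
      assume "i < n" "\<not> j < n"
      then show ?thesis using lt[of i] eq by (simp add: \<pi>_def split: if_splits)
    next
      assume "\<not> i < n" "j < n"
      then show ?thesis using lt[of j] eq by (simp add: \<pi>_def split: if_splits)
    qed (use eq in \<open>simp add: \<pi>_def\<close>)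
  qed (rule lt)
  moreover have "\<psi> = sperm_aut \<pi> {i. \<not> snd (f i)}"
    using f by (intro A_eqI[OF \<psi> sperm_aut_carrier[OF \<open>idx_perm \<pi>\<close>]]) (auto simp: sperm_def \<pi>_def prod_eq_iff)
  ultimately show ?thesis by (auto simp: \<psi>_def)
qed

text \<open>Descent on total length and then total \<open>half_code\<close> of the images of the
  generators. A transvection composed on the right changes only one image, and some transvection
  lowers the measure until the automorphism is irreducible.\<close>

theorem nielsen_generation:
  assumes \<Gamma>: "subgroup \<Gamma> A"
    and sperm: "\<And>\<pi> S. idx_perm \<pi> \<Longrightarrow> sperm_aut \<pi> S \<in> \<Gamma>"
    and transv: "\<And>a b. fst a < n \<Longrightarrow> fst b < n \<Longrightarrow> fst a \<noteq> fst b \<Longrightarrow> transv a b \<in> \<Gamma>"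
    and \<phi>: "\<phi> \<in> carrier A"
  shows "\<phi> \<in> \<Gamma>"
proof -
  define L where "L \<phi> = (\<Sum>i<n. length (\<phi> [(i, True)]))" for \<phi> :: "letter list \<Rightarrow> letter list"
  define E where "E \<phi> = (\<Sum>i<n. half_code (\<phi> [(i, True)]))" for \<phi>
  have "wf (measures [L, E])" by (rule wf_measures)
  then show ?thesis
    using \<phi>
  proof (induction \<phi> rule: wf_induct_rule)
    case (less \<phi>)
    show ?case
    proof (cases "irreducible_aut \<phi>")
      case True
      then have "inv\<^bsub>A\<^esub> \<phi> \<in> \<Gamma>" using irreducible_aut_sperm[OF less.prems] sperm by metis
      from subgroup.m_inv_closed[OF \<Gamma> this] have "inv\<^bsub>A\<^esub> (inv\<^bsub>A\<^esub> \<phi>) \<in> \<Gamma>" .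
      then show ?thesis using less.prems by simp
    next
      case False
      then obtain a b where a: "fst a < n" and b: "fst b < n" and ab: "fst a \<noteq> fst b"
        and small: "length (word_mult (\<phi> [a]) (\<phi> [b])) < length (\<phi> [b]) \<or>
          length (word_mult (\<phi> [a]) (\<phi> [b])) = length (\<phi> [b]) \<and> half_code (word_mult (\<phi> [a]) (\<phi> [b])) < half_code (\<phi> [b])"
        unfolding irreducible_aut_def by (metis linorder_not_less linorder_le_less_linear)
      let ?t = "transv a b"
      have t: "?t \<in> carrier A" by (rule transv_carrier[OF a b ab])
      define \<psi> where "\<psi> = \<phi> \<cdot> ?t"
      have \<psi>: "\<psi> \<in> carrier A" using less.prems t by (simp add: \<psi>_def)
      have other: "\<psi> [(i, True)] = \<phi> [(i, True)]" if "i < n" "i \<noteq> fst b" for i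
        using apply_mult_A[OF less.prems t, of "[(i, True)]"] transv_other[OF a b ab, of "(i, True)"] that
        by (simp add: \<psi>_def)
      have "[b] \<in> carrier F" "[a] \<in> carrier F" using a b by simp_all
      then have b': "\<psi> [b] = word_mult (\<phi> [a]) (\<phi> [b])"
      proof -
        have "\<psi> [b] = \<phi> [a, b]"
          using apply_mult_A[OF less.prems t \<open>[b] \<in> carrier F\<close>] transv_self[OF a b ab] by (simp add: \<psi>_def)
        moreover have "[a, b] \<in> carrier F" using a b ab by (auto simp: carrier_F reduced_Cons)
        ultimately show ?thesis using A_Cons[OF less.prems, of a "[b]"] by simp
      qed
      define i where "i = fst b"
      have li: "length (\<eta> [(i, True)]) = length (\<eta> [b])" "half_code (\<eta> [(i, True)]) = half_code (\<eta> [b])"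
        if "\<eta> \<in> carrier A" for \<eta>
      proof -
        have "\<eta> [b] = \<eta> [(i, True)] \<or> \<eta> [b] = winv (\<eta> [(i, True)])"
          using A_letter_False[OF that b] by (cases b; cases "snd b") (auto simp: i_def)
        then show "length (\<eta> [(i, True)]) = length (\<eta> [b])" "half_code (\<eta> [(i, True)]) = half_code (\<eta> [b])"
          using half_code_winv by auto
      qed
      have sum: "(\<Sum>l<n. f (\<eta> [(l, True)])) = f (\<eta> [(i, True)]) + (\<Sum>l\<in>{..<n} - {i}. f (\<eta> [(l, True)]))"
        for f :: "letter list \<Rightarrow> nat" and \<eta>
        using b by (intro sum.remove) (auto simp: i_def)
      have eq: "(\<Sum>l\<in>{..<n} - {i}. f (\<psi> [(l, True)])) = (\<Sum>l\<in>{..<n} - {i}. f (\<phi> [(l, True)]))"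
        for f :: "letter list \<Rightarrow> nat"
        using other by (intro sum.cong) (auto simp: i_def)
      have "(\<psi>, \<phi>) \<in> measures [L, E]"
        using small unfolding L_def E_def in_measures sum[of _ \<psi>] sum[of _ \<phi>] eq li[OF \<psi>] li[OF less.prems] b'
        by auto
      then have "\<psi> \<in> \<Gamma>" using less.IH \<psi> by blast
      moreover have "inv\<^bsub>A\<^esub> ?t \<in> \<Gamma>" using subgroup.m_inv_closed[OF \<Gamma> transv[OF a b ab]] .
      ultimately have "\<psi> \<cdot> inv\<^bsub>A\<^esub> ?t \<in> \<Gamma>" using subgroup.m_closed[OF \<Gamma>] by blast
      then show ?thesis using less.prems t by (simp add: \<psi>_def A.m_assoc)
    qed
  qed
qed

end

section \<open>Determinants and their correction by an inversion\<close>

section \<open>Generators of finite order\<close>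

context aut_free
begin

definition D :: "(letter list \<Rightarrow> letter list) \<Rightarrow> int"
  where "D \<phi> = Determinant.det (induced_mat n \<phi>)"

lemma D_mult: "\<phi> \<in> carrier A \<Longrightarrow> \<psi> \<in> carrier A \<Longrightarrow> D (\<phi> \<cdot> \<psi>) = D \<phi> * D \<psi>"
  by (simp add: D_def mult_A carrier_A induced_mat_compose
      Determinant.det_mult[OF induced_mat_carrier induced_mat_carrier])

lemma D_one: "D \<one>\<^bsub>A\<^esub> = 1"
  by (simp add: D_def one_A induced_mat_id)

lemma D_unit:
  assumes "\<phi> \<in> carrier A"
  shows "D \<phi> = 1 \<or> D \<phi> = - 1"
proof -
  have "D \<phi> * D (inv\<^bsub>A\<^esub> \<phi>) = 1"
    using D_mult[OF assms, of "inv\<^bsub>A\<^esub> \<phi>"] assms D_one by simp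
  then show ?thesis by (simp add: zmult_eq_1_iff) blast
qed

lemma D_flip:
  assumes "i < n"
  shows "D (flip i) = - 1"
proof -
  have "induced_mat n (flip i) = multrow_mat n i (- 1)"
    using assms
    by (intro eq_matI)
      (auto simp: induced_mat_def mat_of_cols_index abelianization_def flip_def free_gen_def sperm_def exponent_sum_def multrow_mat_def)
  then show ?thesis using det_multrow_mat[OF assms] by (simp add: D_def)
qed

lemma D_swap:
  assumes "i < n" "j < n" "i \<noteq> j"
  shows "D (swap i j) = - 1"
proof -
  have "induced_mat n (swap i j) = swaprows_mat n i j"
    using assms
    by (intro eq_matI)
      (auto simp: induced_mat_def mat_of_cols_index abelianization_def swap_def free_gen_def sperm_def exponent_sum_def swaprows_mat_def Transposition.transpose_def)
  then show ?thesis using det_swaprows_mat[OF assms] by (simp add: D_def)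
qed

lemma carrier_SAut: "\<phi> \<in> carrier (SAut n) \<longleftrightarrow> \<phi> \<in> carrier A \<and> D \<phi> = 1"
  by (auto simp: SAut_def SL_int_def D_def induced_mat_carrier)

lemma mult_SAut [simp]: "\<phi> \<otimes>\<^bsub>SAut n\<^esub> \<psi> = \<phi> \<cdot> \<psi>"
  by (simp add: SAut_def)

lemma one_SAut [simp]: "\<one>\<^bsub>SAut n\<^esub> = \<one>\<^bsub>A\<^esub>"
  by (simp add: SAut_def)

lemma inv_SAut: "\<phi> \<in> carrier (SAut n) \<Longrightarrow> inv\<^bsub>SAut n\<^esub> \<phi> = inv\<^bsub>A\<^esub> \<phi>"
proof -
  assume \<phi>: "\<phi> \<in> carrier (SAut n)"
  interpret S: group "SAut n" by (rule group_SAut)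
  have "inv\<^bsub>SAut n\<^esub> \<phi> \<cdot> \<phi> = \<one>\<^bsub>A\<^esub>" using S.l_inv[OF \<phi>] by simp
  moreover have "inv\<^bsub>SAut n\<^esub> \<phi> \<in> carrier A" "\<phi> \<in> carrier A"
    using S.inv_closed[OF \<phi>] \<phi> by (auto simp: carrier_SAut)
  ultimately show ?thesis using A.inv_equality by metis
qed

lemma sperm_aut_mult:
  assumes "idx_perm \<pi>" "idx_perm \<rho>"
  shows "sperm_aut \<pi> S \<cdot> sperm_aut \<rho> T = sperm_aut (\<pi> \<circ> \<rho>) {i. (i \<in> T) \<noteq> (\<rho> i \<in> S)}"
proof (rule A_eqI)
  have "idx_perm (\<pi> \<circ> \<rho>)" using assms by (auto simp: idx_perm_def intro: inj_compose)
  then show "sperm_aut (\<pi> \<circ> \<rho>) {i. (i \<in> T) \<noteq> (\<rho> i \<in> S)} \<in> carrier A" by (rule sperm_aut_carrier)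
  show "sperm_aut \<pi> S \<cdot> sperm_aut \<rho> T \<in> carrier A"
    using sperm_aut_carrier assms by simp
  fix i assume i: "i < n"
  have "\<rho> i < n" using assms i by (simp add: idx_perm_def)
  then show "(sperm_aut \<pi> S \<cdot> sperm_aut \<rho> T) [(i, True)] = sperm_aut (\<pi> \<circ> \<rho>) {i. (i \<in> T) \<noteq> (\<rho> i \<in> S)} [(i, True)]"
    using i assms by (simp add: apply_mult_A sperm_aut_carrier sperm_def)
qed

lemma sperm_aut_cong:
  assumes "idx_perm \<pi>" "idx_perm \<rho>" "\<And>i. i < n \<Longrightarrow> \<pi> i = \<rho> i \<and> (i \<in> S \<longleftrightarrow> i \<in> T)"
  shows "sperm_aut \<pi> S = sperm_aut \<rho> T"
  using assms by (intro A_eqI sperm_aut_carrier) (auto simp: sperm_def)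

lemma sperm_aut_id: "sperm_aut id {} = \<one>\<^bsub>A\<^esub>"
  by (intro A_eqI sperm_aut_carrier A.one_closed idx_perm_id) (simp add: one_A sperm_def)

lemma flip_flip: "flip i \<cdot> flip i = \<one>\<^bsub>A\<^esub>"
  unfolding flip_def sperm_aut_id[symmetric] by (subst sperm_aut_mult) (auto intro!: sperm_aut_cong)

lemma swap_swap: "i < n \<Longrightarrow> j < n \<Longrightarrow> swap i j \<cdot> swap i j = \<one>\<^bsub>A\<^esub>"
  unfolding swap_def sperm_aut_id[symmetric]
  by (subst sperm_aut_mult) (auto simp: idx_perm_swp o_def id_def intro!: sperm_aut_cong)

abbreviation "e0 \<equiv> flip 0"

lemma e0_supported: "supported e0 {0}"
  unfolding flip_def by (rule supported_sperm) auto

text \<open>The correction of the determinant to 1. For automorphisms supported away from the letter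
  0 the factor \<open>e0\<close> is central, so commutation survives the correction.\<close>

definition twisted :: "(letter list \<Rightarrow> letter list) \<Rightarrow> letter list \<Rightarrow> letter list"
  where "twisted \<phi> = (if D \<phi> = 1 then \<phi> else \<phi> \<cdot> e0)"

lemma twisted_carrier: "\<phi> \<in> carrier A \<Longrightarrow> twisted \<phi> \<in> carrier A"
  by (simp add: twisted_def)

lemma twisted_SAut: "0 < n \<Longrightarrow> \<phi> \<in> carrier A \<Longrightarrow> twisted \<phi> \<in> carrier (SAut n)"
  using D_unit[of \<phi>] by (auto simp: twisted_def carrier_SAut D_mult D_flip)

lemma commute_mult:
  assumes "a \<in> carrier A" "b \<in> carrier A" "c \<in> carrier A"
    and "a \<cdot> c = c \<cdot> a" "b \<cdot> c = c \<cdot> b"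
  shows "(a \<cdot> b) \<cdot> c = c \<cdot> (a \<cdot> b)"
  using assms by (metis A.m_assoc)

lemma twisted_commute:
  assumes "\<phi> \<in> carrier A" "\<psi> \<in> carrier A" "\<phi> \<cdot> \<psi> = \<psi> \<cdot> \<phi>" "e0 \<cdot> \<psi> = \<psi> \<cdot> e0"
  shows "twisted \<phi> \<cdot> \<psi> = \<psi> \<cdot> twisted \<phi>"
  using assms commute_mult[of \<phi> e0 \<psi>] by (simp add: twisted_def)

lemma twisted_commute_twisted:
  assumes "supported \<phi> L" "supported \<psi> L'" "L \<inter> L' = {}" "0 \<notin> L" "0 \<notin> L'"
  shows "twisted \<phi> \<cdot> twisted \<psi> = twisted \<psi> \<cdot> twisted \<phi>"
proof -
  have c: "\<phi> \<in> carrier A" "\<psi> \<in> carrier A" using assms by (auto dest: supportedD)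
  have e\<phi>: "\<phi> \<cdot> e0 = e0 \<cdot> \<phi>" and e\<psi>: "\<psi> \<cdot> e0 = e0 \<cdot> \<psi>"
    using supported_commute[OF _ e0_supported] assms by auto
  have "twisted \<psi> \<cdot> \<phi> = \<phi> \<cdot> twisted \<psi>"
    using twisted_commute[OF c(2,1)] supported_commute[OF assms(1,2,3)] e\<phi> by simp
  moreover have "twisted \<psi> \<cdot> e0 = e0 \<cdot> twisted \<psi>"
    using twisted_commute[OF c(2), of e0] e\<psi> by simp
  ultimately show ?thesis
    using twisted_commute[OF c(1) twisted_carrier[OF c(2)]] by simp
qed

text \<open>An automorphism is determined by the images of the generators, so only finitely many map
  the finite set \<open>Q\<close> into itself. They form the set needed in
  \<open>Fixed_nonempty_finite_orbit\<close>.\<close>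

lemma finite_invariant_words:
  assumes Q: "finite Q" "Q \<subseteq> carrier F" "\<And>i. i < n \<Longrightarrow> [(i, True)] \<in> Q"
    and T: "T \<subseteq> carrier (SAut n)" "\<And>t w. t \<in> T \<Longrightarrow> w \<in> Q \<Longrightarrow> t w \<in> Q"
  shows "\<exists>K. finite K \<and> K \<noteq> {} \<and> K \<subseteq> carrier (SAut n) \<and> (\<forall>t\<in>T. \<forall>g\<in>K. t \<otimes>\<^bsub>SAut n\<^esub> g \<in> K)"
proof (intro exI conjI ballI)
  interpret S: group "SAut n" by (rule group_SAut)
  define K where "K = {\<phi> \<in> carrier (SAut n). \<forall>w\<in>Q. \<phi> w \<in> Q}"
  show "K \<subseteq> carrier (SAut n)" by (auto simp: K_def)
  have "\<one>\<^bsub>A\<^esub> w \<in> Q" if "w \<in> Q" for w using that Q by (auto simp: one_A)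
  then have "\<one>\<^bsub>SAut n\<^esub> \<in> K" using S.one_closed by (simp add: K_def)
  then show "K \<noteq> {}" by blast
  define r where "r \<phi> = (\<lambda>i\<in>{..<n}. \<phi> [(i, True)])" for \<phi> :: "letter list \<Rightarrow> letter list"
  have "inj_on r K"
  proof (rule inj_onI)
    fix \<phi> \<psi> assume "\<phi> \<in> K" "\<psi> \<in> K" and eq: "r \<phi> = r \<psi>"
    have "\<phi> [(i, True)] = \<psi> [(i, True)]" if "i < n" for i
      using fun_cong[OF eq, of i] that by (simp add: r_def)
    then show "\<phi> = \<psi>" using \<open>\<phi> \<in> K\<close> \<open>\<psi> \<in> K\<close> by (intro A_eqI) (auto simp: K_def carrier_SAut)
  qed
  moreover have "r \<phi> \<in> PiE {..<n} (\<lambda>_. Q)" if "\<phi> \<in> K" for \<phi>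
    using that Q(3) by (simp add: r_def K_def)
  then have "r ` K \<subseteq> PiE {..<n} (\<lambda>_. Q)" by blast
  then have "finite (r ` K)" using Q(1) finite_PiE[of "{..<n}" "\<lambda>_. Q"] finite_subset by blast
  ultimately show "finite K" by (simp add: finite_image_iff)
  fix t g assume t: "t \<in> T" and g: "g \<in> K"
  then have "t \<in> carrier (SAut n)" "g \<in> carrier (SAut n)" using T by (auto simp: K_def)
  then have "t \<otimes>\<^bsub>SAut n\<^esub> g \<in> carrier (SAut n)" by (rule S.m_closed)
  moreover have "(t \<cdot> g) w \<in> Q" if "w \<in> Q" for w
  proof -
    have "t \<in> carrier A" "g \<in> carrier A" "w \<in> carrier F" using t g T Q that by (auto simp: K_def carrier_SAut)
    then show ?thesis using T(2)[OF t] g that by (simp add: apply_mult_A K_def)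
  qed
  ultimately show "t \<otimes>\<^bsub>SAut n\<^esub> g \<in> K" by (simp add: K_def)
qed

lemma invariant_winv:
  assumes "\<phi> \<in> carrier A" "H \<subseteq> carrier F" "\<And>w. w \<in> H \<Longrightarrow> \<phi> w \<in> H \<union> winv ` H" "w \<in> H \<union> winv ` H"
  shows "\<phi> w \<in> H \<union> winv ` H"
  using assms(4)
proof
  assume "w \<in> winv ` H"
  then obtain v where v: "v \<in> H" "w = winv v" by blast
  then have "\<phi> w = winv (\<phi> v)" using A_winv[OF assms(1), of v] assms(2) by auto
  then show ?thesis using assms(3)[OF v(1)] by auto
qed (use assms in blast)

lemma invariant_twisted:
  assumes \<phi>: "\<phi> \<in> carrier A" "Q \<subseteq> carrier F"
    and "\<And>w. w \<in> Q \<Longrightarrow> \<phi> w \<in> Q" "\<And>w. w \<in> Q \<Longrightarrow> e0 w \<in> Q" and w: "w \<in> Q"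
  shows "twisted \<phi> w \<in> Q"
  using assms by (auto simp: twisted_def apply_mult_A subsetD)

end

section \<open>The generators, their finite subgroups and their commuting conjugates\<close>

locale saut_generators = aut_free +
  assumes n5: "n \<ge> 5"
begin

text \<open>
  The letter \<open>0\<close> is reserved for correcting determinants. \<open>tau 0\<close> maps \<open>x\<^sub>1\<close> to \<open>x\<^sub>1 x\<^sub>2\<close> and
  inverts \<open>x\<^sub>2\<close>. The sign in \<open>tau 2\<close> makes \<open>tau 0\<close> and its conjugate by \<open>tau 2\<close> multiply \<open>x\<^sub>1\<close>
  from different sides, so that they commute and generate a finite group.
\<close>

definition tau :: "nat \<Rightarrow> letter list \<Rightarrow> letter list"
  where "tau j = (if j = 0 then transv (2, False) (1, False) \<cdot> flip 2
    else if j = 1 then sperm_aut (swp 1 2) {1, 2}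
    else if j = 2 then sperm_aut (swp 2 3) {1}
    else swap j (j + 1))"

text \<open>The last generator alone mixes the letter 0 with another one; its factor
  \<open>e0\<close> gives it determinant 1.\<close>

definition sigma :: "nat \<Rightarrow> letter list \<Rightarrow> letter list"
  where "sigma j = (if j = n - 1 then swap 0 (n - 1) \<cdot> e0 else twisted (tau j))"

lemma tau_supported:
  assumes "j \<le> n - 2"
  shows "supported (tau j) {1..max 2 (j + 1)}"
proof -
  consider "j = 0" | "j = 1" | "j = 2" | "j \<ge> 3" by linarith
  then show ?thesis
  proof cases
    case 1
    have "supported (flip 2) {1..2}" unfolding flip_def by (rule supported_sperm) auto
    then show ?thesis
      using 1 n5 supported_mult[OF supported_transv[of "(2, False)" "(1, False)" "{1..2}"]]
      by (simp add: tau_def numeral_2_eq_2)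
  next
    case 2
    have "supported (sperm_aut (swp 1 2) {1, 2}) {1..2}"
      using n5 by (intro supported_sperm idx_perm_swp) (auto simp: Transposition.transpose_def)
    then show ?thesis using 2 by (simp add: tau_def numeral_2_eq_2)
  next
    case 3
    have "supported (sperm_aut (swp 2 3) {1}) {1..3}"
      using n5 by (intro supported_sperm idx_perm_swp) (auto simp: Transposition.transpose_def)
    then show ?thesis using 3 by (simp add: tau_def)
  next
    case 4
    then have "supported (sperm_aut (swp j (j + 1)) {}) {1..j + 1}"
      using n5 assms by (intro supported_sperm idx_perm_swp) (auto simp: Transposition.transpose_def)
    then show ?thesis using 4 by (simp add: tau_def swap_def)
  qed
qed

lemma tau_supported_high:
  assumes "3 \<le> j" "j \<le> n - 2"
  shows "supported (tau j) {j..j + 1}"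
proof -
  have "supported (sperm_aut (swp j (j + 1)) {}) {j..j + 1}"
    using n5 assms by (intro supported_sperm idx_perm_swp) (auto simp: Transposition.transpose_def)
  then show ?thesis using assms by (simp add: tau_def swap_def)
qed

lemma tau_carrier: "j \<le> n - 2 \<Longrightarrow> tau j \<in> carrier A"
  using tau_supported supportedD(1) by blast

lemma sigma_SAut: "j < n \<Longrightarrow> sigma j \<in> carrier (SAut n)"
proof -
  assume j: "j < n"
  show ?thesis
  proof (cases "j = n - 1")
    case True
    have "swap 0 (n - 1) \<in> carrier A" "D (swap 0 (n - 1)) = - 1" "D e0 = - 1"
      using n5 by (auto simp: swap_carrier D_swap D_flip)
    then show ?thesis using True by (simp add: sigma_def carrier_SAut D_mult)
  next
    case False
    then show ?thesis using j n5 by (simp add: sigma_def twisted_SAut tau_carrier)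
  qed
qed

lemma tau0_gen:
  assumes "i < n"
  shows "tau 0 [(i, True)] = (if i = 1 then [(1, True), (2, True)] else if i = 2 then [(2, False)] else [(i, True)])"
proof -
  let ?t = "transv (2, False) (1, False)"
  have c: "?t \<in> carrier A" using n5 by (intro transv_carrier) auto
  have t1: "?t [(1, True)] = [(1, True), (2, True)]"
    using transv_inv[of "(2, False)" "(1, False)"] n5 by (simp add: inv_letter_def)
  have to: "?t [x] = [x]" if "fst x < n" "fst x \<noteq> 1" for x
    using transv_other[of "(2, False)" "(1, False)" x] that n5 by simp
  have "tau 0 [(i, True)] = ?t (flip 2 [(i, True)])"
    using apply_mult_A[OF c flip_carrier, of "[(i, True)]" 2] assms by (simp add: tau_def)
  then show ?thesis
    using t1 to[of "(2, False)"] to[of "(i, True)"] assms n5 by (auto simp: flip_def sperm_def)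
qed

lemma tau_sperm:
  assumes "1 \<le> j"
  shows "tau j = sperm_aut (swp j (j + 1)) (if j = 1 then {1, 2} else if j = 2 then {1} else {})"
  using assms by (simp add: tau_def swap_def numeral_2_eq_2 numeral_3_eq_3)

lemma tau_letter:
  assumes "1 \<le> j" "j \<le> n - 2" "fst x < n"
  shows "\<exists>y. fst y < n \<and> tau j [x] = [y]"
proof -
  have "idx_perm (swp j (j + 1))" using assms n5 by (intro idx_perm_swp) auto
  then show ?thesis using assms by (auto simp: tau_sperm sperm_def idx_perm_def)
qed

lemma sigma_letter:
  assumes "1 \<le> j" "j < n" "fst x < n"
  shows "\<exists>y. fst y < n \<and> sigma j [x] = [y]"
proof -
  have e0: "\<exists>y. fst y < n \<and> e0 [x] = [y]" if "fst x < n" for x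
    using that by (auto simp: flip_def sperm_def)
  show ?thesis
  proof (cases "j = n - 1")
    case True
    then have "sigma j [x] = swap 0 (n - 1) (e0 [x])"
      using assms n5 by (simp add: sigma_def apply_mult_A swap_carrier)
    then show ?thesis using e0[OF assms(3)] n5 by (auto simp: swap_def sperm_def Transposition.transpose_def)
  next
    case False
    then have j: "j \<le> n - 2" using assms n5 by linarith
    have "sigma j [x] = tau j [x] \<or> sigma j [x] = tau j (e0 [x])"
      using False assms tau_carrier[OF j] by (simp add: sigma_def twisted_def apply_mult_A)
    then show ?thesis using e0[OF assms(3)] tau_letter[OF assms(1) j] assms by metis
  qed
qed

text \<open>All generators other than \<open>sigma 0\<close> are signed permutations, so they
  preserve the set of words of length 1.\<close>

lemma finite_invariant_signed:
  "\<exists>K. finite K \<and> K \<noteq> {} \<and> K \<subseteq> carrier (SAut n) \<and> (\<forall>t\<in>sigma ` {1..<n}. \<forall>g\<in>K. t \<otimes>\<^bsub>SAut n\<^esub> g \<in> K)"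
proof -
  define Q where "Q = (\<lambda>x. [x]) ` ({..<n} \<times> (UNIV :: bool set))"
  have "finite Q" "Q \<subseteq> carrier F" "\<And>i. i < n \<Longrightarrow> [(i, True)] \<in> Q" by (auto simp: Q_def)
  moreover have "sigma ` {1..<n} \<subseteq> carrier (SAut n)" using sigma_SAut by auto
  moreover have "t w \<in> Q" if "t \<in> sigma ` {1..<n}" "w \<in> Q" for t w
  proof -
    obtain j x where jx: "1 \<le> j" "j < n" "t = sigma j" "w = [x]" "fst x < n" using \<open>t \<in> _\<close> \<open>w \<in> Q\<close> by (auto simp: Q_def)
    obtain y where "fst y < n" "sigma j [x] = [y]" using sigma_letter[OF jx(1,2,5)] by blast
    then show ?thesis using jx by (cases y) (auto simp: Q_def)
  qed
  ultimately show ?thesis by (intro finite_invariant_words)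
qed

text \<open>Together with their inverses, these words are permuted by both \<open>tau 0\<close> and \<open>tau j\<close>.\<close>

definition invariant_words :: "nat \<Rightarrow> letter list set"
  where "invariant_words j = (\<lambda>i. [(i, True)]) ` {..<n} \<union> insert [(1, True), (2, True)]
    (if j = 1 then {} else {[(3, False), (1, True)], [(3, False), (1, True), (2, True)]})"

text \<open>This excludes minimal sets with at most two generators: such a set contains 0, and a
  second index above 2 would bring in the index 2 as well.\<close>

lemma finite_invariant_pair:
  assumes j: "j = 1 \<or> j = 2"
  shows "\<exists>K. finite K \<and> K \<noteq> {} \<and> K \<subseteq> carrier (SAut n) \<and> (\<forall>t\<in>sigma ` {0, j}. \<forall>g\<in>K. t \<otimes>\<^bsub>SAut n\<^esub> g \<in> K)"
proof -
  note One_nat_def [simp del]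
  define H where "H = invariant_words j"
  define Q where "Q = H \<union> winv ` H"
  have letter: "[(i, b)] \<in> Q" if "i < n" for i b
  proof (cases b)
    case False
    have "[(i, False)] = winv [(i, True)]" by (simp add: winv_def inv_letter_def)
    then show ?thesis using that False by (auto simp: Q_def H_def invariant_words_def)
  qed (use that in \<open>auto simp: Q_def H_def invariant_words_def\<close>)
  have HF: "H \<subseteq> carrier F"
    using n5 by (auto simp: H_def invariant_words_def carrier_F reduced_Cons inv_letter_def split: if_splits)
  then have QF: "Q \<subseteq> carrier F" using winv_carrier by (auto simp: Q_def)
  have "finite Q" by (simp add: Q_def H_def invariant_words_def)
  have w12: "[(1, True), (2, True)] \<in> carrier F" and w31: "[(3, False), (1, True)] \<in> carrier F"
    and w312: "[(3, False), (1, True), (2, True)] \<in> carrier F"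
    using n5 by (auto simp: carrier_F reduced_Cons inv_letter_def)
  have ev: "\<phi> [(1, True), (2, True)] = word_mult (\<phi> [(1, True)]) (\<phi> [(2, True)])"
    "\<phi> [(3, False), (1, True)] = word_mult (winv (\<phi> [(3, True)])) (\<phi> [(1, True)])"
    "\<phi> [(3, False), (1, True), (2, True)]
      = word_mult (winv (\<phi> [(3, True)])) (word_mult (\<phi> [(1, True)]) (\<phi> [(2, True)]))"
    if "\<phi> \<in> carrier A" for \<phi>
    using A_Cons[OF that w12] A_Cons[OF that w31] A_Cons[OF that w312] A_letter_False[OF that, of 3] n5 by auto
  have inv: "\<phi> w \<in> Q"
    if \<phi>: "\<phi> \<in> carrier A" and q1: "\<And>i. i < n \<Longrightarrow> \<phi> [(i, True)] \<in> Q" and q2: "\<phi> [(1, True), (2, True)] \<in> Q"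
      and q3: "j = 2 \<Longrightarrow> \<phi> [(3, False), (1, True)] \<in> Q \<and> \<phi> [(3, False), (1, True), (2, True)] \<in> Q"
      and w: "w \<in> Q" for \<phi> w
    unfolding Q_def
  proof (rule invariant_winv[OF \<phi> HF])
    show "w \<in> H \<union> winv ` H" using w by (simp only: Q_def)
    fix v assume "v \<in> H"
    then consider i where "i < n" "v = [(i, True)]" | "v = [(1, True), (2, True)]"
      | "j = 2" "v = [(3, False), (1, True)]" | "j = 2" "v = [(3, False), (1, True), (2, True)]"
      using j by (auto simp: H_def invariant_words_def)
    then have "\<phi> v \<in> Q" using q1 q2 q3 by cases simp_all
    then show "\<phi> v \<in> H \<union> winv ` H" by (simp only: Q_def)
  qed
  have hw: "w \<in> Q" "winv w \<in> Q" if "w \<in> H" for w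
    using that by (simp_all add: Q_def)
  have h12: "[(1, True), (2, True)] \<in> Q" "[(2, False), (1, False)] \<in> Q"
    using hw[of "[(1, True), (2, True)]"] by (simp_all add: H_def invariant_words_def winv_def inv_letter_def)
  have h31: "[(3, False), (1, True)] \<in> Q" "[(1, False), (3, True)] \<in> Q"
    "[(3, False), (1, True), (2, True)] \<in> Q" "[(2, False), (1, False), (3, True)] \<in> Q" if "j = 2"
    using hw[of "[(3, False), (1, True)]"] hw[of "[(3, False), (1, True), (2, True)]"] that
    by (simp_all add: H_def invariant_words_def winv_def inv_letter_def)
  have e0: "e0 w \<in> Q" if "w \<in> Q" for w
  proof (rule inv[OF flip_carrier _ _ _ that])
    have g: "e0 [(i, True)] = (if i = 0 then [(0, False)] else [(i, True)])" if "i < n" for i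
      using that by (auto simp: flip_def sperm_def)
    show "e0 [(i, True)] \<in> Q" if "i < n" for i using g[OF that] letter that by simp
    have "e0 [(1, True)] = [(1, True)]" "e0 [(2, True)] = [(2, True)]" "e0 [(3, True)] = [(3, True)]"
      using g n5 by auto
    then show "e0 [(1, True), (2, True)] \<in> Q"
      using h12 ev[OF flip_carrier[of 0]] by (simp add: word_mult_def inv_letter_def)
    from \<open>e0 [(1, True)] = _\<close> \<open>e0 [(2, True)] = _\<close> \<open>e0 [(3, True)] = _\<close>
    show "e0 [(3, False), (1, True)] \<in> Q \<and> e0 [(3, False), (1, True), (2, True)] \<in> Q" if "j = 2"
      using h31[OF that] ev[OF flip_carrier[of 0]] by (simp add: word_mult_def winv_def inv_letter_def)
  qed
  have t0: "tau 0 w \<in> Q" if "w \<in> Q" for w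
  proof (rule inv[OF tau_carrier _ _ _ that])
    show "tau 0 [(i, True)] \<in> Q" if "i < n" for i
      using tau0_gen[OF that] letter h12 that by auto
    have g: "tau 0 [(1, True)] = [(1, True), (2, True)]" "tau 0 [(2, True)] = [(2, False)]"
      "tau 0 [(3, True)] = [(3, True)]"
      using tau0_gen n5 by auto
    have c: "tau 0 \<in> carrier A" using tau_carrier by simp
    show "tau 0 [(1, True), (2, True)] \<in> Q"
      using letter[of 1] n5 by (simp add: ev[OF c] g word_mult_def inv_letter_def)
    show "tau 0 [(3, False), (1, True)] \<in> Q \<and> tau 0 [(3, False), (1, True), (2, True)] \<in> Q" if "j = 2"
      using h31[OF that] by (simp add: ev[OF c] g word_mult_def inv_letter_def winv_def)
  qed simp
  have tj: "tau j w \<in> Q" if "w \<in> Q" for w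
  proof (rule inv[OF tau_carrier _ _ _ that])
    show jn: "j \<le> n - 2" using j n5 by auto
    have c: "tau j \<in> carrier A" using tau_carrier[OF jn] .
    show "tau j [(i, True)] \<in> Q" if i: "i < n" for i
      using tau_letter[of j "(i, True)"] i jn j letter by fastforce
    show "tau j [(1, True), (2, True)] \<in> Q"
    proof (cases "j = 1")
      case True
      then have "tau j [(1, True)] = [(2, False)]" "tau j [(2, True)] = [(1, False)]"
        using n5 by (auto simp: tau_def sperm_def Transposition.transpose_def)
      then show ?thesis using h12 by (simp add: ev[OF c] word_mult_def inv_letter_def)
    next
      case False
      then have "tau j [(1, True)] = [(1, False)]" "tau j [(2, True)] = [(3, True)]"
        using j n5 by (auto simp: tau_def sperm_def Transposition.transpose_def)
      then show ?thesis using h31 j False ev(1)[OF c] by (simp add: word_mult_def inv_letter_def)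
    qed
    show "tau j [(3, False), (1, True)] \<in> Q \<and> tau j [(3, False), (1, True), (2, True)] \<in> Q" if "j = 2"
    proof -
      have "tau j [(1, True)] = [(1, False)]" "tau j [(2, True)] = [(3, True)]" "tau j [(3, True)] = [(2, True)]"
        using that n5 by (auto simp: tau_def sperm_def Transposition.transpose_def)
      then show ?thesis using h31 h12 that ev(2,3)[OF c] by (simp add: word_mult_def winv_def inv_letter_def)
    qed
  qed
  have "t w \<in> Q" if t: "t \<in> sigma ` {0, j}" and w: "w \<in> Q" for t w
  proof -
    obtain l where l: "l = 0 \<or> l = j" "t = sigma l" using t by blast
    then have l2: "l \<le> n - 2" "l \<noteq> n - 1" using j n5 by auto
    have "tau l v \<in> Q" if "v \<in> Q" for v using l(1) t0[OF that] tj[OF that] by metis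
    then have "twisted (tau l) w \<in> Q" by (rule invariant_twisted[OF tau_carrier[OF l2(1)] QF _ e0 w])
    then show ?thesis using l(2) l2(2) by (simp add: sigma_def)
  qed
  moreover have "0 < n" "j < n" using j n5 by auto
  then have "sigma ` {0, j} \<subseteq> carrier (SAut n)" using sigma_SAut by blast
  ultimately show ?thesis
    by (intro finite_invariant_words[OF \<open>finite Q\<close> QF letter])
qed

text \<open>The involution exchanging the first block of \<open>K\<close> letters with block number
  \<open>i\<close>, counted from 0. The letter 0 belongs to no block and stays fixed, which is why
  the shifts commute with \<open>e0\<close>.\<close>

definition block_shift :: "nat \<Rightarrow> nat \<Rightarrow> nat \<Rightarrow> nat"
  where "block_shift K i x = (if 1 \<le> x \<and> x \<le> K then x + i * K
    else if i * K + 1 \<le> x \<and> x \<le> i * K + K then x - i * K else x)"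

lemma block_shift_involutive: "block_shift K i (block_shift K i x) = x"
proof -
  define m where "m = i * K"
  have "m = 0 \<or> K \<le> m" by (cases i) (auto simp: m_def)
  then show ?thesis unfolding block_shift_def m_def[symmetric] by auto
qed

lemma idx_perm_block_shift:
  assumes "i * K + K < n"
  shows "idx_perm (block_shift K i)"
  unfolding idx_perm_def
  using assms block_shift_involutive by (auto intro!: inj_on_inverseI[of _ "block_shift K i"] simp: block_shift_def)

lemma block_shift_image: "block_shift K i ` {1..K} \<subseteq> {i * K + 1..i * K + K}"
  by (auto simp: block_shift_def)

definition mover :: "nat \<Rightarrow> nat \<Rightarrow> letter list \<Rightarrow> letter list"
  where "mover K i = twisted (sperm_aut (block_shift K i) {})"

lemma
  assumes i: "i * K + K < n"
  shows mover_SAut: "mover K i \<in> carrier (SAut n)"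
    and mover_sperm: "\<exists>S. mover K i = sperm_aut (block_shift K i) S"
    and mover_e0: "mover K i \<cdot> e0 = e0 \<cdot> mover K i"
proof -
  note \<pi> = idx_perm_block_shift[OF i]
  let ?g = "sperm_aut (block_shift K i) {}"
  have g: "?g \<in> carrier A" using \<pi> by (rule sperm_aut_carrier)
  show "mover K i \<in> carrier (SAut n)" using n5 g by (simp add: mover_def twisted_SAut)
  have ge: "?g \<cdot> e0 = sperm_aut (block_shift K i) {0}"
    unfolding flip_def sperm_aut_mult[OF \<pi> idx_perm_id(1)] by (simp add: o_def)
  then show "\<exists>S. mover K i = sperm_aut (block_shift K i) S"
    by (simp add: mover_def twisted_def) blast
  have "block_shift K i x = 0 \<longleftrightarrow> x = 0" for x
    by (auto simp: block_shift_def)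
  then have "e0 \<cdot> ?g = sperm_aut (block_shift K i) {0}"
    unfolding flip_def sperm_aut_mult[OF idx_perm_id(1) \<pi>] by simp
  then have "?g \<cdot> e0 = e0 \<cdot> ?g" using ge by simp
  then show "mover K i \<cdot> e0 = e0 \<cdot> mover K i"
    unfolding mover_def by (intro twisted_commute[OF g]) simp_all
qed

text \<open>Conjugation keeps the determinant, and \<open>w\<close> commutes with \<open>e0\<close>.
  So the conjugates of the corrected generators are corrections of automorphisms supported on a
  single block, although \<open>e0\<close> itself lies outside all blocks.\<close>

lemma conj_twisted:
  assumes w: "w \<in> carrier (SAut n)" "w \<cdot> e0 = e0 \<cdot> w" and \<phi>: "\<phi> \<in> carrier A"
  shows "w \<cdot> twisted \<phi> \<cdot> inv\<^bsub>A\<^esub> w = twisted (w \<cdot> \<phi> \<cdot> inv\<^bsub>A\<^esub> w)"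
proof -
  have wA: "w \<in> carrier A" and Dw: "D w = 1" using w by (auto simp: carrier_SAut)
  have "D w * D (inv\<^bsub>A\<^esub> w) = 1" using D_mult[OF wA A.inv_closed[OF wA]] wA D_one by simp
  then have D: "D (w \<cdot> \<phi> \<cdot> inv\<^bsub>A\<^esub> w) = D \<phi>"
    using wA \<phi> Dw by (simp add: D_mult)
  have "e0 \<cdot> inv\<^bsub>A\<^esub> w = inv\<^bsub>A\<^esub> w \<cdot> (w \<cdot> e0) \<cdot> inv\<^bsub>A\<^esub> w"
    using wA by (simp flip: A.m_assoc)
  also have "\<dots> = inv\<^bsub>A\<^esub> w \<cdot> e0" unfolding w(2) using wA by (simp add: A.m_assoc)
  finally have "e0 \<cdot> inv\<^bsub>A\<^esub> w = inv\<^bsub>A\<^esub> w \<cdot> e0" .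
  then have "w \<cdot> (\<phi> \<cdot> e0) \<cdot> inv\<^bsub>A\<^esub> w = w \<cdot> \<phi> \<cdot> inv\<^bsub>A\<^esub> w \<cdot> e0"
    using wA \<phi> by (simp add: A.m_assoc)
  then show ?thesis using D by (simp add: twisted_def)
qed

text \<open>
  \<open>sigma (n - 1)\<close> does not commute with a twisted automorphism of smaller index, but it is inverted
  by the twist.
\<close>

lemma sigma_normalizes:
  assumes j: "2 \<le> j" and a: "a < j" and b: "j < b" "b < n"
  shows "sigma b \<cdot> sigma a = sigma a \<cdot> sigma b \<or> sigma b \<cdot> sigma a \<cdot> sigma b = sigma a"
proof -
  have an: "a \<le> n - 2" and sa: "sigma a = twisted (tau a)" using assms n5 by (auto simp: sigma_def)
  have supa: "supported (tau a) {1..j}"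
    using tau_supported[OF an] assms by (rule_tac supported_mono) auto
  show ?thesis
  proof (cases "b = n - 1")
    case False
    then have bn: "3 \<le> b" "b \<le> n - 2" and sb: "sigma b = twisted (tau b)" using assms n5 by (auto simp: sigma_def)
    have "twisted (tau b) \<cdot> twisted (tau a) = twisted (tau a) \<cdot> twisted (tau b)"
      using bn b by (intro twisted_commute_twisted[OF tau_supported_high[OF bn] supa]) auto
    then show ?thesis by (simp add: sa sb)
  next
    case True
    let ?P = "swap 0 (n - 1)" and ?t = "tau a"
    have P: "?P \<in> carrier A" using n5 by (intro swap_carrier) auto
    have t: "?t \<in> carrier A" using tau_carrier[OF an] .
    have supP: "supported ?P {0, n - 1}"
      unfolding swap_def using n5 by (intro supported_sperm idx_perm_swp) (auto simp: Transposition.transpose_def)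
    have tP: "?t \<cdot> ?P = ?P \<cdot> ?t" using True b by (intro supported_commute[OF supa supP]) auto
    have te: "?t \<cdot> e0 = e0 \<cdot> ?t" by (intro supported_commute[OF supa e0_supported]) auto
    have sb: "sigma b = ?P \<cdot> e0" using True by (simp add: sigma_def)
    have comm: "?P \<cdot> e0 \<cdot> ?t = ?t \<cdot> (?P \<cdot> e0)"
      by (rule commute_mult[OF P flip_carrier t tP[symmetric] te[symmetric]])
    show ?thesis
    proof (cases "D ?t = 1")
      case True
      then show ?thesis using comm by (simp add: sa sb twisted_def)
    next
      case False
      have PP: "?P \<cdot> (?P \<cdot> x) = x" and ee: "e0 \<cdot> (e0 \<cdot> x) = x" if "x \<in> carrier A" for x
      proof -
        have "?P \<cdot> ?P = \<one>\<^bsub>A\<^esub>" using n5 by (intro swap_swap) auto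
        then show "?P \<cdot> (?P \<cdot> x) = x" using P that by (simp flip: A.m_assoc)
        show "e0 \<cdot> (e0 \<cdot> x) = x" using flip_flip[of 0] that by (simp flip: A.m_assoc)
      qed
      have "(?P \<cdot> e0) \<cdot> (?t \<cdot> e0) \<cdot> (?P \<cdot> e0)
          = (?P \<cdot> e0 \<cdot> ?t) \<cdot> (e0 \<cdot> (?P \<cdot> e0))"
        using P t by (simp add: A.m_assoc)
      also have "\<dots> = ?t \<cdot> (?P \<cdot> (e0 \<cdot> (e0 \<cdot> (?P \<cdot> e0))))"
        unfolding comm using P t by (simp add: A.m_assoc)
      also have "\<dots> = ?t \<cdot> e0"
        by (simp only: ee[OF A.m_closed[OF P flip_carrier]] PP[OF flip_carrier])
      finally show ?thesis using False by (simp add: sa sb twisted_def)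
    qed
  qed
qed

section \<open>Generation of the full automorphism group\<close>

lemma sperm_aut_eq:
  assumes "idx_perm \<pi>" "idx_perm \<rho>" "idx_perm \<tau>"
    and "\<And>i. i < n \<Longrightarrow> \<tau> i = \<pi> (\<rho> i) \<and> (i \<in> U \<longleftrightarrow> (i \<in> T) \<noteq> (\<rho> i \<in> S))"
  shows "sperm_aut \<pi> S \<cdot> sperm_aut \<rho> T = sperm_aut \<tau> U"
proof -
  have "idx_perm (\<pi> \<circ> \<rho>)" using assms by (auto simp: idx_perm_def intro: inj_compose)
  then show ?thesis
    unfolding sperm_aut_mult[OF assms(1,2)] using assms by (intro sperm_aut_cong) auto
qed

text \<open>Under these hypotheses the signed permutation is its own inverse, so the left-hand side
  is a conjugate of \<open>flip i\<close>.\<close>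

lemma sperm_aut_conj_flip:
  assumes "idx_perm \<pi>" "i < n" "\<And>x. x < n \<Longrightarrow> \<pi> (\<pi> x) = x" "\<And>x. x < n \<Longrightarrow> x \<in> S \<longleftrightarrow> \<pi> x \<in> S"
  shows "sperm_aut \<pi> S \<cdot> flip i \<cdot> sperm_aut \<pi> S = flip (\<pi> i)"
proof -
  have "sperm_aut \<pi> S \<cdot> flip i = sperm_aut \<pi> {x. (x = i) \<noteq> (x \<in> S)}"
    unfolding flip_def using assms by (intro sperm_aut_eq) auto
  moreover have "sperm_aut \<pi> {x. (x = i) \<noteq> (x \<in> S)} \<cdot> sperm_aut \<pi> S = flip (\<pi> i)"
    unfolding flip_def
  proof (rule sperm_aut_eq[OF assms(1) assms(1) idx_perm_id(1)])
    fix x assume x: "x < n"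
    have "x = \<pi> i \<longleftrightarrow> \<pi> x = i" using assms(2,3) x by metis
    moreover have "x \<in> S \<longleftrightarrow> \<pi> x \<in> S" by (rule assms(4)[OF x])
    ultimately show "id x = \<pi> (\<pi> x) \<and> (x \<in> {\<pi> i} \<longleftrightarrow> (x \<in> S) \<noteq> (\<pi> x \<in> {x. (x = i) \<noteq> (x \<in> S)}))"
      using assms(3)[OF x] by auto
  qed
  ultimately show ?thesis by simp
qed

lemma swap_conj_swap:
  assumes "i < n" "j < n" "k < n" "i \<noteq> j" "i \<noteq> k" "j \<noteq> k"
  shows "swap j k \<cdot> swap i j \<cdot> swap j k = swap i k"
proof -
  have p: "idx_perm (swp a b)" if "a \<in> {i, j, k}" "b \<in> {i, j, k}" for a b
    using that assms by (auto intro: idx_perm_swp)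
  then have c: "idx_perm (swp j k \<circ> swp i j)"
    by (auto simp: idx_perm_def intro: inj_compose)
  have "swap j k \<cdot> swap i j = sperm_aut (swp j k \<circ> swp i j) {}"
    unfolding swap_def by (rule sperm_aut_eq[OF p p c]) auto
  moreover have "sperm_aut (swp j k \<circ> swp i j) {} \<cdot> swap j k = swap i k"
    unfolding swap_def by (rule sperm_aut_eq[OF c p p]) (use assms in \<open>auto simp: Transposition.transpose_def\<close>)
  ultimately show ?thesis by simp
qed

lemma transv_conj:
  assumes a: "fst a < n" and b: "fst b < n" and ab: "fst a \<noteq> fst b" and \<pi>: "idx_perm \<pi>"
  shows "sperm_aut \<pi> S \<cdot> transv a b \<cdot> inv\<^bsub>A\<^esub> (sperm_aut \<pi> S) = transv (sperm \<pi> S a) (sperm \<pi> S b)"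
proof -
  define g where "g = sperm_aut \<pi> S"
  define t where "t = transv a b"
  define c where "c = g \<cdot> t \<cdot> inv\<^bsub>A\<^esub> g"
  define t' where "t' = transv (sperm \<pi> S a) (sperm \<pi> S b)"
  have inj: "inj \<pi>" and lt: "\<And>i. i < n \<Longrightarrow> \<pi> i < n" using \<pi> by (auto simp: idx_perm_def)
  have onto: "\<pi> ` {..<n} = {..<n}" using lt inj by (intro endo_inj_surj) (auto intro: inj_on_subset)
  have a': "fst (sperm \<pi> S a) < n" and b': "fst (sperm \<pi> S b) < n" and ab': "fst (sperm \<pi> S a) \<noteq> fst (sperm \<pi> S b)"
    using a b ab lt inj by (auto simp: sperm_def dest: injD)
  have g: "g \<in> carrier A" unfolding g_def by (rule sperm_aut_carrier[OF \<pi>])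
  have t: "t \<in> carrier A" unfolding t_def by (rule transv_carrier[OF a b ab])
  have t': "t' \<in> carrier A" unfolding t'_def by (rule transv_carrier[OF a' b' ab'])
  have c: "c \<in> carrier A" using g t by (simp add: c_def)
  have cg: "c (g w) = g (t w)" if "w \<in> carrier F" for w
    unfolding c_def by (rule conj_apply[OF g t that])
  have g1: "g [x] = [sperm \<pi> S x]" if "fst x < n" for x using that by (simp add: g_def)
  have agree: "c [sperm \<pi> S x] = t' [sperm \<pi> S x]" if x: "fst x < n" "x = b \<or> fst x \<noteq> fst b" for x
  proof (cases "x = b")
    case True
    have "[a, b] \<in> carrier F" using a b ab by (auto simp: carrier_F reduced_Cons)
    then have "g [a, b] = [sperm \<pi> S a, sperm \<pi> S b]" by (simp add: g_def sperm_aut_word)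
    moreover have "c (g [b]) = g (t [b])" using b by (intro cg) simp
    ultimately show ?thesis
      using transv_self[OF a b ab] transv_self[OF a' b' ab'] b by (simp add: True g1 t_def t'_def)
  next
    case False
    then have xb: "fst x \<noteq> fst b" using x by simp
    then have "fst (sperm \<pi> S x) \<noteq> fst (sperm \<pi> S b)" "fst (sperm \<pi> S x) < n"
      using inj lt x by (auto simp: sperm_def dest: injD)
    then have "t' [sperm \<pi> S x] = [sperm \<pi> S x]"
      unfolding t'_def by (intro transv_other[OF a' b' ab'])
    moreover have "t [x] = [x]" unfolding t_def by (rule transv_other[OF a b ab x(1) xb])
    moreover have "c (g [x]) = g (t [x])" using x by (intro cg) simp
    ultimately show ?thesis by (simp add: g1 x)
  qed
  have "c = t'"
  proof (rule A_eqI[OF c t'])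
    fix i assume i: "i < n"
    then have "i \<in> \<pi> ` {..<n}" using onto by simp
    then obtain j where j: "j < n" "i = \<pi> j" by blast
    \<comment> \<open>For the index moved by the transvection the letter \<open>b\<close> itself is
      tested, so that \<open>transv_self\<close> applies; a wrong sign is repaired afterwards by
      passing to inverses.\<close>
    define x where "x = (if j = fst b then b else (j, True))"
    have x: "fst x < n" "x = b \<or> fst x \<noteq> fst b" "fst (sperm \<pi> S x) = i"
      using j b by (auto simp: x_def sperm_def)
    note eq = agree[OF x(1,2)]
    show "c [(i, True)] = t' [(i, True)]"
    proof (cases "snd (sperm \<pi> S x)")
      case True
      then have "sperm \<pi> S x = (i, True)" using x(3) by (simp add: prod_eq_iff)
      then show ?thesis using eq by simp
    next
      case False
      then have "sperm \<pi> S x = (i, False)" using x(3) by (simp add: prod_eq_iff)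
      then have "winv (c [(i, True)]) = winv (t' [(i, True)])"
        using eq A_letter_False[OF c i] A_letter_False[OF t' i] by simp
      then show ?thesis by (metis winv_winv)
    qed
  qed
  then show ?thesis by (simp add: c_def g_def t_def t'_def)
qed

text \<open>Conjugation carries the inversion \<open>e0\<close> from the letter 0 to the letter
  \<open>n - 1\<close> and down the line to the letter 1. With all inversions at hand the signs of
  \<open>tau 1\<close> and \<open>tau 2\<close> can be removed, adjacent transpositions give all
  permutations, and these together with the inversions conjugate the transvection inside
  \<open>tau 0\<close> to every other one.\<close>

lemma subgroup_containing_generators:
  assumes \<Gamma>: "subgroup \<Gamma> A" and e0: "e0 \<in> \<Gamma>" and tau: "\<And>j. j \<le> n - 2 \<Longrightarrow> tau j \<in> \<Gamma>"
    and P: "swap 0 (n - 1) \<in> \<Gamma>" and \<phi>: "\<phi> \<in> carrier A"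
  shows "\<phi> \<in> \<Gamma>"
proof -
  have mult: "a \<cdot> b \<in> \<Gamma>" if "a \<in> \<Gamma>" "b \<in> \<Gamma>" for a b
    using subgroup.m_closed[OF \<Gamma> that] .
  have one: "\<one>\<^bsub>A\<^esub> \<in> \<Gamma>" by (rule subgroup.one_closed[OF \<Gamma>])
  have adj: "swap j (j + 1) \<in> \<Gamma>" if "3 \<le> j" "j \<le> n - 2" for j
    using tau[OF that(2)] that by (simp add: tau_def)
  have conj_flip: "flip (\<pi> i) \<in> \<Gamma>" if "flip i \<in> \<Gamma>" "sperm_aut \<pi> S \<in> \<Gamma>" "idx_perm \<pi>" "i < n"
    "\<And>x. x < n \<Longrightarrow> \<pi> (\<pi> x) = x" "\<And>x. x < n \<Longrightarrow> x \<in> S \<longleftrightarrow> \<pi> x \<in> S" for i \<pi> S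
    using sperm_aut_conj_flip[OF that(3,4), of S] that mult by metis
  have "flip (swp 0 (n - 1) 0) \<in> \<Gamma>"
    by (rule conj_flip[OF e0 P[unfolded swap_def] idx_perm_swp]) (use n5 in auto)
  then have flipn: "flip (n - 1) \<in> \<Gamma>" by (simp add: Transposition.transpose_def)
  have flip3: "flip j \<in> \<Gamma>" if "3 \<le> j" "j \<le> n - 1" for j
    using that(2,1)
  proof (induction j rule: inc_induct)
    case base
    show ?case by (rule flipn)
  next
    case (step j)
    have "flip (swp j (j + 1) (j + 1)) \<in> \<Gamma>"
    proof (rule conj_flip[where S = "{}" and \<pi> = "swp j (j + 1)" and i = "j + 1"])
      show "flip (j + 1) \<in> \<Gamma>" using step by simp
      show "sperm_aut (swp j (j + 1)) {} \<in> \<Gamma>" using adj[of j] step by (simp add: swap_def)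
    qed (use step in \<open>auto intro: idx_perm_swp\<close>)
    then show ?case by (simp add: Transposition.transpose_def)
  qed
  have t2: "sperm_aut (swp 2 3) {1} \<in> \<Gamma>" using tau[of 2] n5 by (simp add: tau_def)
  have t1: "sperm_aut (swp 1 2) {1, 2} \<in> \<Gamma>" using tau[of 1] n5 by (simp add: tau_def)
  have "flip (swp 2 3 3) \<in> \<Gamma>"
    by (rule conj_flip[OF flip3 t2 idx_perm_swp]) (use n5 in \<open>auto simp: Transposition.transpose_def\<close>)
  then have flip2: "flip 2 \<in> \<Gamma>" by (simp add: Transposition.transpose_def)
  have "flip (swp 1 2 2) \<in> \<Gamma>"
    by (rule conj_flip[OF flip2 t1 idx_perm_swp]) (use n5 in \<open>auto simp: Transposition.transpose_def\<close>)
  then have flip1: "flip 1 \<in> \<Gamma>" by (simp add: Transposition.transpose_def)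
  have flips: "flip j \<in> \<Gamma>" if "j < n" for j
  proof -
    consider "j = 0" | "j = 1" | "j = 2" | "3 \<le> j" by linarith
    then show ?thesis using e0 flip1 flip2 flip3[of j] that by cases auto
  qed
  have signs: "sperm_aut id S \<in> \<Gamma>" for S
  proof -
    have "sperm_aut id S \<in> \<Gamma>" if "finite S" "S \<subseteq> {..<n}" for S
      using that
    proof (induction S)
      case empty
      show ?case unfolding sperm_aut_id by (rule one)
    next
      case (insert i S)
      have "flip i \<cdot> sperm_aut id S = sperm_aut id (insert i S)"
        unfolding flip_def using insert.hyps by (intro sperm_aut_eq) auto
      then show ?case using mult[OF flips[of i]] insert by (metis insert_subset lessThan_iff)
    qed
    then have "sperm_aut id (S \<inter> {..<n}) \<in> \<Gamma>" by simp
    moreover have "sperm_aut id S = sperm_aut id (S \<inter> {..<n})" by (intro sperm_aut_cong) simp_all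
    ultimately show ?thesis by simp
  qed
  have unsign: "sperm_aut \<pi> T \<in> \<Gamma>" if "sperm_aut \<pi> S \<in> \<Gamma>" "idx_perm \<pi>" for \<pi> S T
  proof -
    have "sperm_aut \<pi> S \<cdot> sperm_aut id {i. (i \<in> S) \<noteq> (i \<in> T)} = sperm_aut \<pi> T"
      using that(2) by (intro sperm_aut_eq) auto
    then show ?thesis using mult[OF that(1) signs] by metis
  qed
  have "swap 1 2 \<in> \<Gamma>" "swap 2 3 \<in> \<Gamma>"
    unfolding swap_def using unsign[OF t1] unsign[OF t2] n5 idx_perm_swp by auto
  then have adj': "swap j (j + 1) \<in> \<Gamma>" if "1 \<le> j" "j \<le> n - 2" for j
  proof -
    assume "swap 1 2 \<in> \<Gamma>" "swap 2 3 \<in> \<Gamma>"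
    consider "j = 1" | "j = 2" | "3 \<le> j" using \<open>1 \<le> j\<close> by linarith
    then show ?thesis
      using \<open>swap 1 2 \<in> \<Gamma>\<close> \<open>swap 2 3 \<in> \<Gamma>\<close> adj that by cases (auto simp: numeral_2_eq_2 numeral_3_eq_3)
  qed
  have swap_sym: "swap i j = swap j i" for i j
  proof -
    have "swp i j = swp j i" by (auto simp: Transposition.transpose_def fun_eq_iff)
    then show ?thesis by (simp add: swap_def)
  qed
  have up: "swap i j \<in> \<Gamma>" if "1 \<le> i" "i < j" "j \<le> n - 1" for i j
    using that(2,3)
  proof (induction j)
    case (Suc j)
    show ?case
    proof (cases "i = j")
      case True
      then show ?thesis using adj'[of j] that Suc.prems by simp
    next
      case False
      then have "swap i j \<in> \<Gamma>" "swap j (Suc j) \<in> \<Gamma>" using Suc adj'[of j] that by auto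
      moreover have "swap j (Suc j) \<cdot> swap i j \<cdot> swap j (Suc j) = swap i (Suc j)"
        using False Suc.prems that n5 by (intro swap_conj_swap) auto
      ultimately show ?thesis using mult by metis
    qed
  qed simp
  have zero: "swap 0 j \<in> \<Gamma>" if "1 \<le> j" "j \<le> n - 1" for j
  proof (cases "j = n - 1")
    case False
    then have "swap (n - 1) j \<in> \<Gamma>" using up[of j "n - 1"] that swap_sym by auto
    moreover have "swap (n - 1) j \<cdot> swap 0 (n - 1) \<cdot> swap (n - 1) j = swap 0 j"
      using False that n5 by (intro swap_conj_swap) auto
    ultimately show ?thesis using mult P by metis
  qed (use P in simp)
  have swaps: "swap i j \<in> \<Gamma>" if "i < n" "j < n" for i j
  proof -
    have le: "swap i j \<in> \<Gamma>" if "i < j" "j < n" for i j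
      using that up[of i j] zero[of j] by (cases "i = 0") auto
    consider "i < j" | "i = j" | "j < i" by linarith
    then show ?thesis
    proof cases
      case 2
      have "swp i i = id" by (auto simp: Transposition.transpose_def)
      then have "swap i j = \<one>\<^bsub>A\<^esub>" using 2 sperm_aut_id by (simp add: swap_def)
      then show ?thesis using one by simp
    qed (use le that swap_sym in metis)+
  qed
  have perms: "sperm_aut \<pi> {} \<in> \<Gamma>" if "idx_perm \<pi>" for \<pi>
  proof -
    have "sperm_aut \<pi> {} \<in> \<Gamma>" if "m \<le> n" "idx_perm \<pi>" "\<And>i. m \<le> i \<Longrightarrow> i < n \<Longrightarrow> \<pi> i = i" for m \<pi>
      using that
    proof (induction m arbitrary: \<pi>)
      case 0
      then have "sperm_aut \<pi> {} = sperm_aut id {}" by (intro sperm_aut_cong) auto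
      then show ?case using one by (simp add: sperm_aut_id)
    next
      case (Suc m)
      have m: "m < n" using Suc.prems by simp
      define r where "r = \<pi> m"
      have r: "r < n" using Suc.prems m by (simp add: r_def idx_perm_def)
      have "r \<le> m"
      proof (rule ccontr)
        assume "\<not> r \<le> m"
        then have "\<pi> r = r" using Suc.prems(3)[of r] r by simp
        then have "r = m" using Suc.prems(2) by (auto simp: r_def idx_perm_def dest: injD)
        then show False using \<open>\<not> r \<le> m\<close> by simp
      qed
      have \<rho>: "idx_perm (swp m r \<circ> \<pi>)"
        using Suc.prems(2) idx_perm_swp[OF m r] by (auto simp: idx_perm_def intro: inj_compose)
      have "sperm_aut (swp m r \<circ> \<pi>) {} \<in> \<Gamma>"
      proof (rule Suc.IH[OF _ \<rho>])
        fix i assume i: "m \<le> i" "i < n"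
        show "(swp m r \<circ> \<pi>) i = i"
        proof (cases "i = m")
          case True
          then show ?thesis by (simp add: r_def Transposition.transpose_def)
        next
          case False
          then show ?thesis using i Suc.prems(3)[of i] \<open>r \<le> m\<close> by (simp add: Transposition.transpose_def)
        qed
      qed (use m in simp)
      moreover have "swap m r \<cdot> sperm_aut (swp m r \<circ> \<pi>) {} = sperm_aut \<pi> {}"
        unfolding swap_def by (rule sperm_aut_eq[OF idx_perm_swp[OF m r] \<rho> Suc.prems(2)]) simp
      ultimately show ?case using mult[OF swaps[OF m r]] by metis
    qed
    then show ?thesis using that by (metis leD le_refl)
  qed
  have sperms: "sperm_aut \<pi> S \<in> \<Gamma>" if "idx_perm \<pi>" for \<pi> S
    using unsign[OF perms[OF that] that] .
  have t0: "transv (2, False) (1, False) \<in> \<Gamma>"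
  proof -
    have t: "transv (2, False) (1, False) \<in> carrier A" using n5 by (intro transv_carrier) auto
    have "tau 0 \<cdot> flip 2 = transv (2, False) (1, False)"
      using t flip_flip[of 2] by (simp add: tau_def A.m_assoc)
    then show ?thesis using mult[OF tau[of 0] flip2] by simp
  qed
  have transvs: "transv a b \<in> \<Gamma>" if a: "fst a < n" and b: "fst b < n" and ab: "fst a \<noteq> fst b" for a b
  proof -
    \<comment> \<open>The permutation has to send 2 to \<open>fst a\<close> and 1 to
      \<open>fst b\<close>. Its outer factor exchanges 2 with \<open>fst a\<close>, and
      \<open>b'\<close> is the index which that factor sends to \<open>fst b\<close>.\<close>
    define b' where "b' = swp 2 (fst a) (fst b)"
    define \<pi> where "\<pi> = swp 2 (fst a) \<circ> swp 1 b'"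
    define S where "S = (if snd a then {2} else {}) \<union> (if snd b then {1::nat} else {})"
    have b': "b' < n" "b' \<noteq> 2" using a b ab n5 by (auto simp: b'_def Transposition.transpose_def)
    have "idx_perm (swp 2 (fst a))" "idx_perm (swp 1 b')" using a b' n5 by (auto intro!: idx_perm_swp)
    then have \<pi>: "idx_perm \<pi>" by (auto simp: \<pi>_def idx_perm_def intro: inj_compose)
    have "swp 1 b' 2 = 2" using b'(2) by (simp add: Transposition.transpose_def)
    moreover have "swp 1 b' 1 = b'" "swp 2 (fst a) 2 = fst a" by (simp_all add: Transposition.transpose_def)
    moreover have "swp 2 (fst a) b' = fst b" by (simp add: b'_def)
    ultimately have "\<pi> 2 = fst a" "\<pi> 1 = fst b" by (simp_all add: \<pi>_def)
    then have "sperm \<pi> S (2, False) = a" "sperm \<pi> S (1, False) = b"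
      by (auto simp: sperm_def S_def prod_eq_iff)
    then have "sperm_aut \<pi> S \<cdot> transv (2, False) (1, False) \<cdot> inv\<^bsub>A\<^esub> (sperm_aut \<pi> S) = transv a b"
      using transv_conj[of "(2, False)" "(1, False)" \<pi> S] \<pi> n5 by simp
    then show ?thesis
      using mult[OF mult[OF sperms[OF \<pi>] t0] subgroup.m_inv_closed[OF \<Gamma> sperms[OF \<pi>]]] by metis
  qed
  show ?thesis by (rule nielsen_generation[OF \<Gamma> sperms transvs \<phi>])
qed

end

section \<open>A minimal set of generators without a fixed point\<close>

section \<open>Global fixed points\<close>

locale saut_action = saut_generators n + isometric_action M d "SAut n" act
  for n :: nat and M :: "'a set" and d act
begin

theorem Fixed_sigma_nonempty:
  assumes dim: "covering_dim_le mtopology dd"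
    and bound: "\<And>k. 2 \<le> k \<Longrightarrow> k \<le> dd + 1 \<Longrightarrow> dd < k * ((n - 1) div (k + 2))"
  shows "Fixed (sigma ` {..<n}) \<noteq> {}"
proof (rule ccontr)
  assume "\<not> ?thesis"
  then have ex: "{..<n} \<subseteq> {..<n} \<and> Fixed (sigma ` {..<n}) = {}" by simp
  obtain T where T: "T \<subseteq> {..<n} \<and> Fixed (sigma ` T) = {}"
    and least: "\<And>S. S \<subseteq> {..<n} \<and> Fixed (sigma ` S) = {} \<Longrightarrow> card T \<le> card S"
    using ex_has_least_nat[where P = "\<lambda>T. T \<subseteq> {..<n} \<and> Fixed (sigma ` T) = {}" and m = card, OF ex] by blast
  have finT: "finite T" using T finite_subset by blast
  have sc: "sigma ` S \<subseteq> carrier (SAut n)" if "S \<subseteq> {..<n}" for S using sigma_SAut that by blast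
  have proper: "Fixed (sigma ` S) \<noteq> {}" if "S \<subset> T" for S
    using least[of S] psubset_card_mono[OF finT that] T that by force
  have sub: "\<not> T \<subseteq> S" if "Fixed (sigma ` S) \<noteq> {}" for S
    using that T Fixed_antimono[OF image_mono, of T S sigma] by blast
  \<comment> \<open>Without the index 0 only signed permutations remain, and these have a common
    fixed point.\<close>
  have T0: "0 \<in> T"
  proof (rule ccontr)
    assume "0 \<notin> T"
    have sub1: "T \<subseteq> {1..<n}"
    proof
      fix x assume "x \<in> T"
      then show "x \<in> {1..<n}" using T \<open>0 \<notin> T\<close> by (cases "x = 0") auto
    qed
    obtain K where K: "finite K" "K \<noteq> {}" "K \<subseteq> carrier (SAut n)"
      "\<And>t g. t \<in> sigma ` {1..<n} \<Longrightarrow> g \<in> K \<Longrightarrow> t \<otimes>\<^bsub>SAut n\<^esub> g \<in> K"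
      using finite_invariant_signed by blast
    have "{1..<n} \<subseteq> {..<n}" by auto
    then have "Fixed (sigma ` {1..<n}) \<noteq> {}" by (intro Fixed_nonempty_finite_orbit[OF sc K])
    from sub[OF this] sub1 show False by contradiction
  qed
  have pair: "\<not> T \<subseteq> {0, j}" if pj: "j = 1 \<or> j = 2" for j
  proof -
    obtain K where K: "finite K" "K \<noteq> {}" "K \<subseteq> carrier (SAut n)"
      "\<And>t g. t \<in> sigma ` {0, j} \<Longrightarrow> g \<in> K \<Longrightarrow> t \<otimes>\<^bsub>SAut n\<^esub> g \<in> K"
      using finite_invariant_pair[OF pj] by blast
    have "{0, j} \<subseteq> {..<n}" using pj n5 by auto
    then have "Fixed (sigma ` {0, j}) \<noteq> {}"
      by (intro Fixed_nonempty_finite_orbit[OF sc K])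
    then show ?thesis by (rule sub)
  qed
  \<comment> \<open>At a gap, \<open>T\<close> splits into two proper subsets, each with a fixed
    point, and the lower one normalizes the group generated by the upper one. The index 1 is exempt
    because \<open>tau 0\<close> and \<open>tau 2\<close> share the letters 1 and 2.\<close>
  have connected: "j \<in> T" if j: "2 \<le> j" and i: "i \<in> T" "j < i" for i j
  proof (rule ccontr)
    assume jT: "j \<notin> T"
    define T1 where "T1 = {a \<in> T. a < j}"
    define T2 where "T2 = {a \<in> T. j < a}"
    have "x < j \<or> j < x" if "x \<in> T" for x using that jT by (cases x j rule: linorder_cases) auto
    then have TT: "T = T1 \<union> T2" unfolding T1_def T2_def by blast
    have "T1 \<subseteq> T" "T2 \<subseteq> T" "i \<notin> T1" "0 \<notin> T2" using i by (auto simp: T1_def T2_def)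
    then have "T1 \<subset> T" "T2 \<subset> T" using i(1) T0 by blast+
    then have ne: "Fixed (sigma ` T1) \<noteq> {}" "Fixed (sigma ` T2) \<noteq> {}" using proper by auto
    have "Fixed (sigma ` T1 \<union> sigma ` T2) \<noteq> {}"
    proof (rule Fixed_nonempty_normalizing[OF _ _ _ ne])
      show "sigma ` T1 \<subseteq> carrier (SAut n)" "sigma ` T2 \<subseteq> carrier (SAut n)"
        using T by (auto simp: T1_def T2_def intro!: sigma_SAut)
      fix s t assume "s \<in> sigma ` T1" "t \<in> sigma ` T2"
      then obtain a b where ab: "s = sigma a" "t = sigma b" "a < j" "j < b" "b < n"
        using T by (auto simp: T1_def T2_def)
      show "t \<otimes>\<^bsub>SAut n\<^esub> s = s \<otimes>\<^bsub>SAut n\<^esub> t \<or> t \<otimes>\<^bsub>SAut n\<^esub> s \<otimes>\<^bsub>SAut n\<^esub> t = s"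
        unfolding mult_SAut ab(1,2) by (rule sigma_normalizes[OF j ab(3-5)])
    qed
    then show False using T TT by (simp add: image_Un)
  qed
  define k where "k = card T - 1"
  have "card T \<ge> 3"
  proof (rule ccontr)
    assume "\<not> card T \<ge> 3"
    have "\<exists>x. T - {0} \<subseteq> {x}"
    proof -
      have "card (T - {0}) \<le> 1" using \<open>\<not> card T \<ge> 3\<close> T0 finT by simp
      then have "\<forall>x\<in>T - {0}. \<forall>y\<in>T - {0}. x = y" using finT by (subst (asm) card_le_Suc0_iff_eq[unfolded One_nat_def[symmetric]]) auto
      then show ?thesis by blast
    qed
    then obtain x where x: "T \<subseteq> {0, x}" by blast
    have "x \<in> T" "x \<noteq> 1" "x \<noteq> 2" "x \<noteq> 0" using x pair[of 1] pair[of 2] by auto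
    then have "2 \<in> T" using connected[of 2 x] by simp
    then show False using x \<open>x \<noteq> 2\<close> by auto
  qed
  then have k2: "2 \<le> k" and cardT: "card T = k + 1" by (auto simp: k_def)
  have "card {..k} = card T" using cardT by simp
  then obtain h where h: "bij_betw h {..k} T" using finT by (metis bij_betw_iff_card finite_atMost)
  have hT: "h ` {..k} = T" using h by (simp add: bij_betw_def)
  have hproper: "h ` ({..k} - {l}) \<subset> T" if "l \<le> k" for l
  proof -
    have "h ` ({..k} - {l}) = T - {h l}"
      using h that by (auto simp: bij_betw_def inj_on_def)
    moreover have "h l \<in> T" using hT that by blast
    ultimately show ?thesis by blast
  qed
  have hn: "h j < n" if "j \<le> k" for j using hT T that by blast
  \<comment> \<open>For larger \<open>k\<close> a single copy of \<open>T\<close> is enough: this is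
    the case \<open>m = 1\<close>, the theorem of Helly itself.\<close>
  have "k \<le> dd"
  proof (rule ccontr)
    assume "\<not> k \<le> dd"
    then have dk: "dd < 1 * k" by simp
    have img: "(\<lambda>j. sigma (h j)) ` J = sigma ` h ` J" for J by (simp add: image_image)
    have "\<exists>i<1::nat. Fixed ((\<lambda>j. sigma (h j)) ` {..k}) \<noteq> {}"
    proof (rule Fixed_nonempty_commuting_copies[OF _ dim dk, where g = "\<lambda>_ j. sigma (h j)"])
      show "1 \<le> k" using k2 by simp
      show "sigma (h j) \<in> carrier (SAut n)" if "j \<le> k" for j using sigma_SAut hn[OF that] .
      show "Fixed ((\<lambda>j. sigma (h j)) ` ({..k} - {l})) \<noteq> {}" if "l \<le> k" for l
        unfolding img by (rule proper[OF hproper[OF that]])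
    qed simp
    then show False using T unfolding img hT by blast
  qed
  define K where "K = k + 2"
  define q where "q = (n - 1) div K"
  have dq: "dd < q * k" using bound[OF k2] \<open>k \<le> dd\<close> by (simp add: q_def K_def mult.commute)
  then have "0 < q" by (cases q) auto
  have qK: "q * K \<le> n - 1" by (simp add: q_def)
  have Kn: "i * K + K < n" if "i < q" for i
  proof -
    have "(i + 1) * K \<le> q * K" using that by (intro mult_le_mono1) simp
    then show ?thesis using qK n5 by (simp add: algebra_simps)
  qed
  \<comment> \<open>The indices 0 and 2, ..., \<open>x\<close> all belong to \<open>T\<close> and
    number exactly \<open>x\<close>, so \<open>x\<close> is at most \<open>k + 1\<close>. As
    \<open>tau (k + 1)\<close> reaches the letter \<open>k + 2\<close>, blocks of \<open>K\<close>
    letters are needed.\<close>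
  have Tk: "x \<le> k + 1" if "x \<in> T" for x
  proof (rule ccontr)
    assume "\<not> x \<le> k + 1"
    have "insert 0 {2..x} \<subseteq> T"
    proof
      fix j assume "j \<in> insert 0 {2..x}"
      then show "j \<in> T" using connected[of j x] that T0 by (cases "j = x") auto
    qed
    then have "card (insert 0 {2..x}) \<le> card T" by (intro card_mono finT)
    then show False using cardT \<open>\<not> x \<le> k + 1\<close> by simp
  qed
  have kn: "k + 1 \<le> n - 2" using Kn[OF \<open>0 < q\<close>] by (simp add: K_def)
  have sig: "sigma (h j) = twisted (tau (h j))" and supp: "supported (tau (h j)) {1..K}"
    and tc: "tau (h j) \<in> carrier A" if "j \<le> k" for j
  proof -
    have "h j \<le> k + 1" using Tk hT that by blast
    then have hj: "h j \<le> n - 2" "max 2 (h j + 1) \<le> K" using kn by (auto simp: K_def)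
    then show "sigma (h j) = twisted (tau (h j))" using n5 by (auto simp: sigma_def)
    show "supported (tau (h j)) {1..K}"
      using tau_supported[OF hj(1)] hj(2) by (rule_tac supported_mono) auto
    then show "tau (h j) \<in> carrier A" by (rule supportedD)
  qed
  define g where "g i j = mover K i \<otimes>\<^bsub>SAut n\<^esub> sigma (h j) \<otimes>\<^bsub>SAut n\<^esub> inv\<^bsub>SAut n\<^esub> mover K i" for i j
  have gimg: "g i ` J = (\<lambda>t. mover K i \<otimes>\<^bsub>SAut n\<^esub> t \<otimes>\<^bsub>SAut n\<^esub> inv\<^bsub>SAut n\<^esub> mover K i) ` (sigma ` h ` J)" for i J
    unfolding image_image g_def ..
  have Fg: "Fixed (g i ` J) \<noteq> {} \<longleftrightarrow> Fixed (sigma ` h ` J) \<noteq> {}" if "i < q" "J \<subseteq> {..k}" for i J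
    unfolding gimg
  proof (rule Fixed_conj[OF mover_SAut[OF Kn[OF that(1)]] sc])
    show "h ` J \<subseteq> {..<n}" using hn that by auto
  qed
  define c where "c i j = mover K i \<cdot> tau (h j) \<cdot> inv\<^bsub>A\<^esub> mover K i" for i j
  have gc: "g i j = twisted (c i j)" and csupp: "supported (c i j) {i * K + 1..i * K + K}"
    if i: "i < q" and j: "j \<le> k" for i j
  proof -
    note w = mover_SAut[OF Kn[OF i]]
    show "g i j = twisted (c i j)"
      unfolding g_def c_def mult_SAut inv_SAut[OF w] sig[OF j]
      by (rule conj_twisted[OF w mover_e0[OF Kn[OF i]] tc[OF j]])
    obtain S where "mover K i = sperm_aut (block_shift K i) S" using mover_sperm[OF Kn[OF i]] by blast
    then have "supported (c i j) (block_shift K i ` {1..K})"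
      unfolding c_def using supported_conj[OF supp[OF j] idx_perm_block_shift[OF Kn[OF i]]] by metis
    then show "supported (c i j) {i * K + 1..i * K + K}"
      using block_shift_image by (rule supported_mono)
  qed
  have "\<exists>i<q. Fixed (g i ` {..k}) \<noteq> {}"
  proof (rule Fixed_nonempty_commuting_copies[OF _ dim dq])
    show "1 \<le> k" using k2 by simp
    show "g i j \<in> carrier (SAut n)" if "i < q" "j \<le> k" for i j
    proof -
      have "0 < n" "c i j \<in> carrier A" using n5 csupp[OF that] by (auto dest: supportedD)
      then show ?thesis unfolding gc[OF that] by (rule twisted_SAut)
    qed
    show "g i j \<otimes>\<^bsub>SAut n\<^esub> g i' j' = g i' j' \<otimes>\<^bsub>SAut n\<^esub> g i j"
      if ii: "i < q" "i' < q" "i \<noteq> i'" and jj: "j \<le> k" "j' \<le> k" for i i' j j'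
      unfolding mult_SAut gc[OF ii(1) jj(1)] gc[OF ii(2) jj(2)]
    proof (rule twisted_commute_twisted[OF csupp[OF ii(1) jj(1)] csupp[OF ii(2) jj(2)]])
      have "(a + 1) * K \<le> b * K" if "a < b" for a b using that by (intro mult_le_mono1) simp
      then have "i * K + K \<le> i' * K \<or> i' * K + K \<le> i * K"
        using ii(3) by (metis add.commute mult_Suc nat_neq_iff Suc_eq_plus1)
      then show "{i * K + 1..i * K + K} \<inter> {i' * K + 1..i' * K + K} = {}" by auto
    qed auto
    show "Fixed (g i ` ({..k} - {l})) \<noteq> {}" if "i < q" "l \<le> k" for i l
      using Fg[OF that(1), of "{..k} - {l}"] proper[OF hproper[OF that(2)]] by blast
  qed
  then obtain i where "i < q" "Fixed (g i ` {..k}) \<noteq> {}" by blast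
  then have "Fixed (sigma ` T) \<noteq> {}" using Fg[of i "{..k}"] hT by simp
  then show False using T by simp
qed

text \<open>
  The stabilizer of \<open>x\<close> is cut down to its part \<open>H\<close> invariant under conjugation by \<open>e0\<close>, so that
  \<open>H \<union> H e0\<close> is a subgroup of the full automorphism group.
\<close>

lemma Fixed_sigma_subset:
  assumes x: "x \<in> Fixed (sigma ` {..<n})"
  shows "x \<in> Fixed (carrier (SAut n))"
proof -
  have xM: "x \<in> M" and fix_sigma: "\<And>j. j < n \<Longrightarrow> act (sigma j) x = x" using x by (auto simp: Fixed_def)
  define \<kappa> where "\<kappa> \<phi> = e0 \<cdot> \<phi> \<cdot> e0" for \<phi>
  have e: "e0 \<in> carrier A" "D e0 = - 1" using n5 by (simp_all add: D_flip)
  have ee: "e0 \<cdot> (e0 \<cdot> \<phi>) = \<phi>" if "\<phi> \<in> carrier A" for \<phi>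
    using flip_flip[of 0] that by (simp flip: A.m_assoc)
  have \<kappa>c: "\<kappa> \<phi> \<in> carrier (SAut n)" if "\<phi> \<in> carrier (SAut n)" for \<phi>
    using that e by (simp add: \<kappa>_def carrier_SAut D_mult)
  have \<kappa>\<kappa>: "\<kappa> (\<kappa> \<phi>) = \<phi>" if "\<phi> \<in> carrier A" for \<phi>
    using that by (simp add: \<kappa>_def A.m_assoc ee flip_flip)
  have \<kappa>m: "\<kappa> (\<phi> \<cdot> \<psi>) = \<kappa> \<phi> \<cdot> \<kappa> \<psi>" if "\<phi> \<in> carrier A" "\<psi> \<in> carrier A" for \<phi> \<psi>
    using that by (simp add: \<kappa>_def A.m_assoc ee)
  define H where "H = {\<phi> \<in> carrier (SAut n). act \<phi> x = x \<and> act (\<kappa> \<phi>) x = x}"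
  have HS: "\<phi> \<in> carrier (SAut n)" "\<phi> \<in> carrier A" if "\<phi> \<in> H" for \<phi>
    using that by (auto simp: H_def carrier_SAut)
  have Hm: "\<phi> \<cdot> \<psi> \<in> H" if "\<phi> \<in> H" "\<psi> \<in> H" for \<phi> \<psi>
  proof -
    have c: "\<phi> \<in> carrier (SAut n)" "\<psi> \<in> carrier (SAut n)" "\<kappa> \<phi> \<in> carrier (SAut n)" "\<kappa> \<psi> \<in> carrier (SAut n)"
      using that HS \<kappa>c by auto
    then have "\<phi> \<cdot> \<psi> \<in> carrier (SAut n)" using m_closed[OF c(1,2)] by simp
    moreover have "act (\<phi> \<cdot> \<psi>) x = x" "act (\<kappa> \<phi> \<cdot> \<kappa> \<psi>) x = x"
      using act_mult[OF c(1,2) xM] act_mult[OF c(3,4) xM] that by (simp_all add: H_def)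
    ultimately show ?thesis using \<kappa>m[OF HS(2)[OF that(1)] HS(2)[OF that(2)]] by (simp add: H_def)
  qed
  have \<kappa>H: "\<kappa> \<phi> \<in> H" if "\<phi> \<in> H" for \<phi>
    using that \<kappa>c[OF HS(1)[OF that]] \<kappa>\<kappa>[OF HS(2)[OF that]] by (simp add: H_def)
  have fix_inv: "act (inv\<^bsub>A\<^esub> \<phi>) x = x" if "\<phi> \<in> carrier (SAut n)" "act \<phi> x = x" for \<phi>
  proof -
    have "act (inv\<^bsub>SAut n\<^esub> \<phi>) (act \<phi> x) = act (inv\<^bsub>SAut n\<^esub> \<phi> \<otimes>\<^bsub>SAut n\<^esub> \<phi>) x"
      using act_mult[OF inv_closed[OF that(1)] that(1) xM] by metis
    also have "\<dots> = x" using l_inv[OF that(1)] act_one[OF xM] by metis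
    finally show ?thesis using that inv_SAut[OF that(1)] by simp
  qed
  have Hi: "inv\<^bsub>A\<^esub> \<phi> \<in> H" if "\<phi> \<in> H" for \<phi>
  proof -
    have "inv\<^bsub>A\<^esub> \<phi> \<in> carrier (SAut n)" using inv_closed[OF HS(1)[OF that]] inv_SAut[OF HS(1)[OF that]] by simp
    moreover have "\<kappa> (inv\<^bsub>A\<^esub> \<phi>) = inv\<^bsub>A\<^esub> (\<kappa> \<phi>)"
    proof -
      have "inv\<^bsub>A\<^esub> e0 = e0" using A.inv_equality[OF flip_flip[of 0]] by simp
      then show ?thesis using HS(2)[OF that] by (simp add: \<kappa>_def A.inv_mult_group A.m_assoc)
    qed
    ultimately show ?thesis
      using fix_inv[OF HS(1)[OF that]] fix_inv[OF \<kappa>c[OF HS(1)[OF that]]] that by (simp add: H_def)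
  qed
  have H1: "\<one>\<^bsub>A\<^esub> \<in> H"
    using act_one[OF xM] one_closed flip_flip[of 0] by (simp add: H_def \<kappa>_def)
  define \<Gamma> where "\<Gamma> = {\<phi> \<in> carrier A. \<phi> \<in> H \<or> \<phi> \<cdot> e0 \<in> H}"
  have "subgroup \<Gamma> A"
  proof (rule A.subgroupI)
    show "\<Gamma> \<subseteq> carrier A" by (auto simp: \<Gamma>_def)
    show "\<Gamma> \<noteq> {}" using H1 by (auto simp: \<Gamma>_def)
  next
    fix \<phi> assume "\<phi> \<in> \<Gamma>"
    then have c: "\<phi> \<in> carrier A" and "\<phi> \<in> H \<or> \<phi> \<cdot> e0 \<in> H" by (auto simp: \<Gamma>_def)
    then show "inv\<^bsub>A\<^esub> \<phi> \<in> \<Gamma>"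
    proof (elim disjE)
      assume "\<phi> \<cdot> e0 \<in> H"
      then have "\<kappa> (inv\<^bsub>A\<^esub> (\<phi> \<cdot> e0)) \<in> H" using \<kappa>H Hi by blast
      moreover have "\<kappa> (inv\<^bsub>A\<^esub> (\<phi> \<cdot> e0)) = inv\<^bsub>A\<^esub> \<phi> \<cdot> e0"
      proof -
        have "inv\<^bsub>A\<^esub> e0 = e0" using A.inv_equality[OF flip_flip[of 0]] by simp
        then show ?thesis using c by (simp add: \<kappa>_def A.inv_mult_group A.m_assoc ee)
      qed
      ultimately show ?thesis using c by (simp add: \<Gamma>_def)
    qed (use Hi in \<open>simp add: \<Gamma>_def\<close>)
  next
    fix \<phi> \<psi> assume "\<phi> \<in> \<Gamma>" "\<psi> \<in> \<Gamma>"
    then have c: "\<phi> \<in> carrier A" "\<psi> \<in> carrier A" by (auto simp: \<Gamma>_def)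
    consider "\<phi> \<in> H" "\<psi> \<in> H" | "\<phi> \<in> H" "\<psi> \<cdot> e0 \<in> H" | "\<phi> \<cdot> e0 \<in> H" "\<psi> \<in> H"
      | "\<phi> \<cdot> e0 \<in> H" "\<psi> \<cdot> e0 \<in> H"
      using \<open>\<phi> \<in> \<Gamma>\<close> \<open>\<psi> \<in> \<Gamma>\<close> by (auto simp: \<Gamma>_def)
    then have "\<phi> \<cdot> \<psi> \<in> H \<or> \<phi> \<cdot> \<psi> \<cdot> e0 \<in> H"
    proof cases
      case 1
      then show ?thesis using Hm by blast
    next
      case 2
      then show ?thesis using Hm[OF 2] c by (simp add: A.m_assoc)
    next
      case 3
      have "(\<phi> \<cdot> e0) \<cdot> \<kappa> \<psi> = \<phi> \<cdot> \<psi> \<cdot> e0" using c by (simp add: \<kappa>_def A.m_assoc ee)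
      then show ?thesis using Hm[OF 3(1) \<kappa>H[OF 3(2)]] by simp
    next
      case 4
      have "(\<phi> \<cdot> e0) \<cdot> \<kappa> (\<psi> \<cdot> e0) = \<phi> \<cdot> \<psi>"
        using c flip_flip[of 0] by (simp add: \<kappa>_def A.m_assoc ee)
      then show ?thesis using Hm[OF 4(1) \<kappa>H[OF 4(2)]] by simp
    qed
    then show "\<phi> \<cdot> \<psi> \<in> \<Gamma>" using c by (simp add: \<Gamma>_def)
  qed
  moreover have "e0 \<in> \<Gamma>" using H1 by (simp add: \<Gamma>_def flip_flip)
  moreover have "tau j \<in> \<Gamma>" if j: "j \<le> n - 2" for j
  proof -
    have jn: "j < n" and sj: "sigma j = twisted (tau j)" using j n5 by (auto simp: sigma_def)
    note sc = sigma_SAut[OF jn]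
    have sA: "sigma j \<in> carrier A" using sc by (simp add: carrier_SAut)
    have "tau j \<cdot> e0 = e0 \<cdot> tau j"
      by (intro supported_commute[OF tau_supported[OF j] e0_supported]) auto
    then have "sigma j \<cdot> e0 = e0 \<cdot> sigma j"
      unfolding sj by (intro twisted_commute tau_carrier[OF j]) simp_all
    then have "\<kappa> (sigma j) = sigma j" using sA by (simp add: \<kappa>_def A.m_assoc ee)
    then have "sigma j \<in> H" using sc fix_sigma[OF jn] by (simp add: H_def)
    then show ?thesis using tau_carrier[OF j] by (auto simp: \<Gamma>_def sj twisted_def split: if_splits)
  qed
  moreover have "swap 0 (n - 1) \<in> \<Gamma>"
  proof -
    let ?P = "swap 0 (n - 1)"
    have P: "?P \<in> carrier A" using n5 by (intro swap_carrier) auto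
    have n1: "n - 1 < n" using n5 by simp
    note sc = sigma_SAut[OF n1]
    have s: "sigma (n - 1) = ?P \<cdot> e0" by (simp add: sigma_def)
    have "inv\<^bsub>A\<^esub> e0 = e0" using A.inv_equality[OF flip_flip[of 0]] by simp
    moreover have "inv\<^bsub>A\<^esub> ?P = ?P" using A.inv_equality[OF swap_swap[of 0 "n - 1"]] P n5 by simp
    \<comment> \<open>Conjugation by \<open>e0\<close> does not fix the last generator, but turns it
      into its inverse, which fixes \<open>x\<close> too.\<close>
    ultimately have "\<kappa> (sigma (n - 1)) = inv\<^bsub>A\<^esub> (sigma (n - 1))"
      unfolding s using P flip_flip[of 0] by (simp add: \<kappa>_def A.inv_mult_group A.m_assoc)
    then have "sigma (n - 1) \<in> H"
      using sc fix_sigma[OF n1] fix_inv[OF sc] by (simp add: H_def)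
    then show ?thesis using P unfolding \<Gamma>_def s by blast
  qed
  ultimately have all: "\<phi> \<in> \<Gamma>" if "\<phi> \<in> carrier A" for \<phi>
    using subgroup_containing_generators that by blast
  have "act \<phi> x = x" if \<phi>: "\<phi> \<in> carrier (SAut n)" for \<phi>
  proof -
    have c: "\<phi> \<in> carrier A" "D \<phi> = 1" using \<phi> by (auto simp: carrier_SAut)
    have "\<phi> \<cdot> e0 \<notin> H"
      using D_mult[OF c(1) e(1)] c e HS(1)[of "\<phi> \<cdot> e0"] by (auto simp: carrier_SAut)
    then have "\<phi> \<in> H" using all[OF c(1)] by (simp add: \<Gamma>_def)
    then show ?thesis by (simp add: H_def)
  qed
  then show ?thesis using xM by (simp add: Fixed_def)
qed

end

section \<open>From homomorphisms to actions, and the arithmetic of the bounds\<close>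

lemma fixed_point_property_SAut:
  fixes n d :: nat
  assumes n: "n \<ge> 5" and bound: "\<And>k. 2 \<le> k \<Longrightarrow> k \<le> d + 1 \<Longrightarrow> d < k * ((n - 1) div (k + 2))"
  shows "fixed_point_property (complete_CAT0_spaces d :: 'a metric set) (SAut n)"
  unfolding fixed_point_property_def
proof (intro ballI)
  fix X :: "'a metric" and \<rho>
  assume X: "X \<in> complete_CAT0_spaces d" and \<rho>: "\<rho> \<in> hom (SAut n) (isometry_group X)"
  interpret MS: Metric_space "mspace X" "mdist X" by simp
  have CAT0: "CAT0 X" and ne: "mspace X \<noteq> {}" and comp: "mcomplete_of X"
    and dim: "has_covering_dim (mtopology_of X) d"
    using X by (auto simp: complete_CAT0_spaces_def)
  interpret S: group "SAut n" by (rule group_SAut)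
  have bij: "\<rho> g \<in> Bij (mspace X)" and iso: "\<And>x y. x \<in> mspace X \<Longrightarrow> y \<in> mspace X \<Longrightarrow> mdist X (\<rho> g x) (\<rho> g y) = mdist X x y"
    if "g \<in> carrier (SAut n)" for g
    using hom_in_carrier[OF \<rho> that] by (auto simp: isometry_group_def)
  have closed: "\<rho> g x \<in> mspace X" if "g \<in> carrier (SAut n)" "x \<in> mspace X" for g x
    using Bij_imp_funcset[OF bij[OF that(1)]] that by blast
  have mult: "\<rho> (g \<otimes>\<^bsub>SAut n\<^esub> h) x = \<rho> g (\<rho> h x)"
    if "g \<in> carrier (SAut n)" "h \<in> carrier (SAut n)" "x \<in> mspace X" for g h x
    using hom_mult[OF \<rho> that(1,2)] bij[OF that(1)] bij[OF that(2)] that(3)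
    by (simp add: isometry_group_def BijGroup_def compose_def)
  \<comment> \<open>Multiplicativity makes the image of the identity idempotent, and an idempotent
    injective map is the identity.\<close>
  have one: "\<rho> \<one>\<^bsub>SAut n\<^esub> x = x" if "x \<in> mspace X" for x
  proof -
    have "\<rho> \<one>\<^bsub>SAut n\<^esub> (\<rho> \<one>\<^bsub>SAut n\<^esub> x) = \<rho> \<one>\<^bsub>SAut n\<^esub> x"
      using mult[OF S.one_closed S.one_closed that] by (simp del: aut_free.one_SAut)
    moreover have "inj_on (\<rho> \<one>\<^bsub>SAut n\<^esub>) (mspace X)"
      using bij[OF S.one_closed] by (auto simp: Bij_def bij_betw_def)
    ultimately show ?thesis using that closed[OF S.one_closed that] by (auto dest: inj_onD)
  qed
  interpret saut_action n "mspace X" "mdist X" \<rho>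
  proof unfold_locales
    show "5 \<le> n" by (rule n)
    show "MS.mcomplete" using comp by (simp add: mcomplete_of_def)
    show "mspace X \<noteq> {}" by (rule ne)
    show "\<exists>z\<in>mspace X. \<forall>w\<in>mspace X. (mdist X w z)\<^sup>2
        \<le> (1 - t) * (mdist X w x)\<^sup>2 + t * (mdist X w y)\<^sup>2 - t * (1 - t) * (mdist X x y)\<^sup>2"
      if "x \<in> mspace X" "y \<in> mspace X" "0 \<le> t" "t \<le> 1" for x y t
      using CAT0_imp_CN[OF CAT0 that] .
  qed (use closed mult one iso in auto)
  have cov: "covering_dim_le MS.mtopology d"
    using dim by (simp add: has_covering_dim_def mtopology_of_def)
  have "Fixed (sigma ` {..<n}) \<noteq> {}" by (rule Fixed_sigma_nonempty[OF cov]) (rule bound)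
  then obtain x where "x \<in> Fixed (carrier (SAut n))" using Fixed_sigma_subset by blast
  then show "\<exists>x\<in>mspace X. \<forall>g\<in>carrier (SAut n). \<rho> g x = x" by (auto simp: Fixed_def)
qed

text \<open>Put \<open>f = N div (k + 2)\<close>. Since \<open>2 * (d + 2) \<le> N\<close> and
  \<open>N < (f + 1) * (k + 2)\<close>, it suffices that
  \<open>(f + 1) * (k + 2) \<le> 2 * k * f + 4\<close>, which says that
  \<open>(f - 1) * (k - 2)\<close> is not negative. The case \<open>f = 0\<close> is impossible
  because \<open>k \<le> d + 1\<close> forces \<open>k + 2 \<le> N\<close>.\<close>

lemma linear_bound_imp_min_bound:
  fixes N d k :: nat
  assumes d: "d + 2 \<le> 2 * (N div 4)" and k: "2 \<le> k" "k \<le> d + 1"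
  shows "d < k * (N div (k + 2))"
proof -
  define m f where "m = N div 4" and "f = N div (k + 2)"
  have m4: "4 * m \<le> N" by (simp add: m_def)
  have dm: "d + 2 \<le> 2 * m" using d by (simp add: m_def)
  have lt: "N < (f + 1) * (k + 2)"
    using dividend_less_div_times[of "k + 2" N] by (simp add: f_def algebra_simps)
  consider "f = 0" | "f = 1" | "k = 2" | "2 \<le> f" "3 \<le> k" using k by linarith
  then have "d < k * f"
  proof cases
    case 1
    then show ?thesis using lt m4 dm k by simp
  next
    case 2
    then show ?thesis using lt m4 dm k by simp
  next
    case 3
    then have "f = m" by (simp add: f_def m_def)
    then show ?thesis using dm 3 by simp
  next
    case 4
    \<comment> \<open>After shifting \<open>f\<close> and \<open>k\<close> by their lower bounds,
      the product \<open>p\<close> of the shifted values is the only nonlinear term left and can be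
      treated as one natural number.\<close>
    define f' k' p where "f' = f - 2" and "k' = k - 3" and "p = f' * k'"
    then have fk: "f = f' + 2" "k = k' + 3" using 4 by simp_all
    have "N < p + 5 * f' + 3 * k' + 15" using lt by (simp add: fk \<open>p = _\<close> algebra_simps)
    moreover have "k * f = p + 3 * f' + 2 * k' + 6" by (simp add: fk \<open>p = _\<close> algebra_simps)
    ultimately show ?thesis using dm m4 by linarith
  qed
  then show ?thesis by (simp add: f_def)
qed

theorem theoremB:
  fixes n d :: nat
  assumes "n \<ge> 5"
  shows "(enat d < (INF k\<in>{2..d + 1}. enat (k * ((n - 1) div (k + 2))))
            \<longrightarrow> fixed_point_property (complete_CAT0_spaces d :: 'a metric set) (SAut n))
       \<and> (int d < 2 * ((int n - 1) div 4) - 1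
            \<longrightarrow> fixed_point_property (complete_CAT0_spaces d :: 'a metric set) (SAut n))"
proof (intro conjI impI)
  assume lt: "enat d < (INF k\<in>{2..d + 1}. enat (k * ((n - 1) div (k + 2))))"
  show "fixed_point_property (complete_CAT0_spaces d :: 'a metric set) (SAut n)"
  proof (rule fixed_point_property_SAut[OF assms])
    fix k assume "2 \<le> k" "k \<le> d + 1"
    then have "enat d < enat (k * ((n - 1) div (k + 2)))"
      by (intro less_le_trans[OF lt INF_lower]) simp
    then show "d < k * ((n - 1) div (k + 2))" by simp
  qed
next
  assume lt: "int d < 2 * ((int n - 1) div 4) - 1"
  have "(int n - 1) div 4 = int ((n - 1) div 4)"
    using assms by (simp add: zdiv_int of_nat_diff)
  then have "d + 2 \<le> 2 * ((n - 1) div 4)" using lt by linarith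
  then show "fixed_point_property (complete_CAT0_spaces d :: 'a metric set) (SAut n)"
    by (intro fixed_point_property_SAut[OF assms] linear_bound_imp_min_bound)
qed

end
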